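(* Let $M\ge4$, let $p\ge0$ be an integer with $4(p+1)\le M$, and let $$\mathcal F_{\mathcal B_{0\prec p}}=\Phi_{\mathcal E_p}\Phi_{\mathcal J_p}\,\Phi_{\mathcal E_{p-1}}\Phi_{\mathcal J_{p-1}}\cdots\Phi_{\mathcal E_0}\Phi_{\mathcal J_0},\qquad \Phi_{\mathcal J_k}=\exp\!\left(H^k_{1+2}\otimes\sigma^k_{1+2}\right),\quad \Phi_{\mathcal E_k}=\exp\!\left(I^{1\otimes2}_{M-4k}\bigl(1\otimes e^{-\frac12\sigma^k_{1+2}}\bigr)\right)$$ be the canonical chain of extended jordanian twists of $U(so(M))$. For $0\le k\le p$ put $$G^k_{1-2}=E^k_{1-2}-I^1_{M-4k},\qquad G^k_{2-1}=E^k_{2-1}-I^2_{M-4k}\,e^{-\sigma^k_{1+2}}.$$ Then: (1) for every $0\le k\le p$ the elements $H^k_{1-2}$, $G^k_{1-2}$, $G^k_{2-1}$ are primitive for the twisted coproduct $\Delta_{\mathcal F}=\mathcal F\Delta\mathcal F^{-1}$ with $\mathcal F=\mathcal F_{\mathcal B_{0\prec p}}$, i.e. $\Delta_{\mathcal F}(x)=x\otimes1+1\otimes x$ for each of them; (2) they satisfy $[H^k_{1-2},G^k_{1-2}]=G^k_{1-2}$, $[H^k_{1-2},G^k_{2-1}]=-G^k_{2-1}$, $[G^k_{1-2},G^k_{2-1}]=2H^k_{1-2}$, so that their span is a Lie algebra $so^{(k)}_G(3)$, and $so_G^{(k)}(3)$ commutes with the subalgebra $so(M-4(k+1))$; (3)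 the elements of the subalgebra $so(M-4(p+1))$ are primitive for $\Delta_{\mathcal F}$, and the twisted algebra contains the direct sum of Lie algebras of primitive elements $so(M-4(p+1))\oplus\bigoplus_{k=0}^{p}so^{(k)}_G(3)$.
   Context: All Lie algebras are over $\mathbb C$. Let $N=[M/2]$, let $\mathcal E_{i,j}$ be the $M\times M$ matrix units, $A_{i,j}=\mathcal E_{i,j}-\mathcal E_{M+1-j,M+1-i}$, and realize $so(M)$ as the span of the $A_{i,j}$, $1\le i,j\le M$. Put $H_i=\frac12(\mathcal E_{i,i}-\mathcal E_{M+1-i,M+1-i})$ for $1\le i\le N$, $E_{i-j}=-A_{i,j}$ for $1\le i\neq j\le N$, $E_{i+j}=-A_{i,M+1-j}$ for $1\le i<j\le N$; if $M=2N+1$ is odd put also $E_i=-A_{i,N+1}$ for $1\le i\le N$. For $0\le m\le M/2$ the subalgebra $so(M-2m)\subset so(M)$ is the span of the $A_{i,j}$ with $m+1\le i,j\le M-m$. For $k\ge 0$ with $4(k+1)\le M$ let $a_1=2k+1$, $a_2=2k+2$, and define $H^k_{1\pm2}=H_{a_1}\pm H_{a_2}$, $E^k_{1+2}=E_{a_1+a_2}$, $E^k_{1-2}=E_{a_1-a_2}=-A_{a_1,a_2}$, $E^k_{2-1}=E_{a_2-a_1}=-A_{a_2,a_1}$, $\sigma^k_{1+2}=\ln(1+E^k_{1+2})$, $$I^{1\otimes2}_{M-4k}=\delta\,E_{a_1}\otimes E_{a_2}+\sum_{l=2k+3}^{N}\left(E_{a_1+l}\otimes E_{a_2-l}+E_{a_1-l}\otimes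 E_{a_2+l}\right),$$ $$I^s_{M-4k}=\tfrac{\delta}{2}E_{a_s}^2+\sum_{l=2k+3}^{N}E_{a_s+l}E_{a_s-l}\quad(s=1,2),$$ where $\delta=1$ if $M$ is odd and $\delta=0$ (term absent) if $M$ is even. $U(so(M))$ carries its usual Hopf structure. Logarithms and exponentials denote their power series, in the following completion. Grade $so(M)$ by the eigenvalues of $\mathrm{ad}\bigl(\sum_{i}2(N+1-i)H_i\bigr)$ (positive root vectors have positive degree, $H_i$ has degree $0$); this grades $U(so(M))^{\otimes n}$ by total degree $d\in\mathbb Z$, and $\widehat U_n=\bigcup_{d_0\in\mathbb Z}\prod_{d\ge d_0}\left(U(so(M))^{\otimes n}\right)_d$ is an algebra, to which $\Delta$ extends degreewise. The elements above lie in $\widehat U_1$ and $\mathcal F_{\mathcal B_{0\prec p}}$ is an invertible element of $\widehat U_2$. *)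

theory Defs
  imports
    "HOL-Analysis.Analysis"
    "HOL-Library.Poly_Mapping"
    "HOL-Library.Numeral_Type"
    "HOL-Computational_Algebra.Formal_Laurent_Series"
begin

unbundle no fps_syntax

section \<open>Complex vector spaces, associative algebras and Lie algebras\<close>

class complex_vector = ab_group_add +
  fixes scaleC :: "complex \<Rightarrow> 'a \<Rightarrow> 'a" (infixr \<open>*\<^sub>C\<close> 75)
  assumes scaleC_add_right: "c *\<^sub>C (x + y) = c *\<^sub>C x + c *\<^sub>C y"
    and scaleC_add_left: "(c + d) *\<^sub>C x = c *\<^sub>C x + d *\<^sub>C x"
    and scaleC_scaleC: "c *\<^sub>C d *\<^sub>C x = (c * d) *\<^sub>C x"
    and scaleC_one: "1 *\<^sub>C x = x"

global_interpretation complex_vector: vector_space "scaleC :: complex \<Rightarrow> 'a \<Rightarrow> 'a::complex_vector"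
  by unfold_locales (rule scaleC_add_right scaleC_add_left scaleC_scaleC scaleC_one)+

class complex_algebra_1 = complex_vector + ring_1 +
  assumes mult_scaleC_left: "(c *\<^sub>C x) * y = c *\<^sub>C (x * y)"
    and mult_scaleC_right: "x * (c *\<^sub>C y) = c *\<^sub>C (x * y)"

class lie_algebra = complex_vector +
  fixes lie_bracket :: "'a \<Rightarrow> 'a \<Rightarrow> 'a"
  assumes lie_add_left: "lie_bracket (x + y) z = lie_bracket x z + lie_bracket y z"
    and lie_add_right: "lie_bracket x (y + z) = lie_bracket x y + lie_bracket x z"
    and lie_scaleC_left: "lie_bracket (c *\<^sub>C x) y = c *\<^sub>C lie_bracket x y"
    and lie_scaleC_right: "lie_bracket x (c *\<^sub>C y) = c *\<^sub>C lie_bracket x y"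
    and lie_alternating: "lie_bracket x x = 0"
    and lie_jacobi: "lie_bracket x (lie_bracket y z) + lie_bracket y (lie_bracket z x)
                       + lie_bracket z (lie_bracket x y) = 0"

definition commutator :: "'a::ring_1 \<Rightarrow> 'a \<Rightarrow> 'a" where
  "commutator x y = x * y - y * x"

instantiation complex :: complex_algebra_1
begin
definition scaleC_complex :: "complex \<Rightarrow> complex \<Rightarrow> complex" where
  "scaleC_complex c x = c * x"
instance
  by standard (simp_all add: scaleC_complex_def algebra_simps)
end

instantiation vec :: (complex_vector, finite) complex_vector
begin
definition scaleC_vec :: "complex \<Rightarrow> 'a ^ 'b \<Rightarrow> 'a ^ 'b" where
  "scaleC_vec c v = (\<chi> i. c *\<^sub>C (v $ i))"
instance
  by standard
    (simp_all add: scaleC_vec_def vec_eq_iff scaleC_add_right scaleC_add_left scaleC_scaleC scaleC_one)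
end

instantiation fls :: (complex_vector) complex_vector
begin
lift_definition scaleC_fls :: "complex \<Rightarrow> 'a fls \<Rightarrow> 'a fls" is "\<lambda>c f n. c *\<^sub>C f n"
  by (elim MOST_mono) simp
instance
  by standard
    (transfer; simp add: fun_eq_iff scaleC_add_right scaleC_add_left scaleC_scaleC scaleC_one)+
end

instance fls :: (complex_algebra_1) complex_algebra_1
proof
  fix c :: complex and x y :: "'a fls"
  have n: "fls_nth (c *\<^sub>C z) n = c *\<^sub>C fls_nth z n" for z :: "'a fls" and n
    by transfer simp
  have sub: "fls_subdegree (c *\<^sub>C z) = fls_subdegree z" if "c \<noteq> 0" for z :: "'a fls"
  proof -
    have "c *\<^sub>C z = 0 \<longleftrightarrow> z = 0"
      using that by (simp)
    thus ?thesis using that by (simp add: fls_subdegree_def n)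
  qed
  show "(c *\<^sub>C x) * y = c *\<^sub>C (x * y)"
  proof (cases "c = 0")
    case False
    thus ?thesis
      by (intro fls_eqI)
        (simp add: fls_times_nth(1) sub n mult_scaleC_left complex_vector.scale_sum_right)
  qed simp
  show "x * (c *\<^sub>C y) = c *\<^sub>C (x * y)"
  proof (cases "c = 0")
    case False
    thus ?thesis
      by (intro fls_eqI)
        (simp add: fls_times_nth(1) sub n mult_scaleC_right complex_vector.scale_sum_right)
  qed simp
qed


section \<open>Quotients of monoid algebras\<close>

text \<open>For an additively written monoid \<open>'k\<close>, the type \<open>'k \<Rightarrow>\<^sub>0 complex\<close> with its convolution
  product is the monoid algebra.\<close>

inductive_set ideal_of :: "'r::ring_1 set \<Rightarrow> 'r set" for S :: "'r set" where
  ideal_zero: "0 \<in> ideal_of S"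
| ideal_gen: "s \<in> S \<Longrightarrow> a * s * b \<in> ideal_of S"
| ideal_add: "x \<in> ideal_of S \<Longrightarrow> y \<in> ideal_of S \<Longrightarrow> x + y \<in> ideal_of S"

lemma ideal_mult_left: "x \<in> ideal_of S \<Longrightarrow> c * x \<in> ideal_of S"
proof (induction rule: ideal_of.induct)
  case (ideal_gen s a b)
  thus ?case using ideal_of.ideal_gen[of s S "c * a" b] by (simp add: mult.assoc)
qed (auto simp: distrib_left intro: ideal_of.intros)

lemma ideal_mult_right: "x \<in> ideal_of S \<Longrightarrow> x * c \<in> ideal_of S"
proof (induction rule: ideal_of.induct)
  case (ideal_gen s a b)
  thus ?case using ideal_of.ideal_gen[of s S a "b * c"] by (simp add: mult.assoc)
qed (auto simp: distrib_right intro: ideal_of.intros)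

lemma ideal_uminus: "x \<in> ideal_of S \<Longrightarrow> - x \<in> ideal_of S"
  using ideal_mult_left[of x S "-1"] by simp

lemma ideal_diff: "x \<in> ideal_of S \<Longrightarrow> y \<in> ideal_of S \<Longrightarrow> x - y \<in> ideal_of S"
  using ideal_add[of x S "- y"] ideal_uminus[of y S] by simp

definition cong_ideal :: "'r::ring_1 set \<Rightarrow> 'r \<Rightarrow> 'r \<Rightarrow> bool" where
  "cong_ideal S x y \<longleftrightarrow> x - y \<in> ideal_of S"

lemma equivp_cong_ideal: "equivp (cong_ideal S)"
proof (rule equivpI)
  show "reflp (cong_ideal S)"
    by (rule reflpI) (simp add: cong_ideal_def ideal_zero)
  show "symp (cong_ideal S)"
  proof (rule sympI)
    fix x y assume "cong_ideal S x y"
    thus "cong_ideal S y x" using ideal_uminus[of "x - y" S] by (simp add: cong_ideal_def)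
  qed
  show "transp (cong_ideal S)"
  proof (rule transpI)
    fix x y z assume "cong_ideal S x y" "cong_ideal S y z"
    thus "cong_ideal S x z" using ideal_add[of "x - y" S "y - z"] by (simp add: cong_ideal_def)
  qed
qed

lemma cong_ideal_refl [simp]: "cong_ideal S x x"
  by (simp add: cong_ideal_def ideal_zero)

lemma cong_ideal_add:
  "cong_ideal S x x' \<Longrightarrow> cong_ideal S y y' \<Longrightarrow> cong_ideal S (x + y) (x' + y')"
  using ideal_add[of "x - x'" S "y - y'"] by (simp add: cong_ideal_def add_diff_add)

lemma cong_ideal_uminus: "cong_ideal S x x' \<Longrightarrow> cong_ideal S (- x) (- x')"
  using ideal_uminus[of "x - x'" S] by (simp add: cong_ideal_def)

lemma cong_ideal_diff:
  "cong_ideal S x x' \<Longrightarrow> cong_ideal S y y' \<Longrightarrow> cong_ideal S (x - y) (x' - y')"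
  using cong_ideal_add[of S x x' "- y" "- y'"] cong_ideal_uminus[of S y y'] by simp

lemma cong_ideal_mult:
  assumes "cong_ideal S x x'" "cong_ideal S y y'"
  shows "cong_ideal S (x * y) (x' * y')"
proof -
  have "x * y - x' * y' = (x - x') * y + x' * (y - y')"
    by (simp add: algebra_simps)
  thus ?thesis
    using assms by (simp add: cong_ideal_def ideal_add ideal_mult_left ideal_mult_right)
qed

definition monoid_algebra_lift :: "('k \<Rightarrow> 'b::complex_vector) \<Rightarrow> ('k \<Rightarrow>\<^sub>0 complex) \<Rightarrow> 'b" where
  "monoid_algebra_lift m f = (\<Sum>k\<in>Poly_Mapping.keys f. Poly_Mapping.lookup f k *\<^sub>C m k)"

lemma lift_eq_sum:
  assumes "finite A" "Poly_Mapping.keys f \<subseteq> A"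
  shows "monoid_algebra_lift m f = (\<Sum>k\<in>A. Poly_Mapping.lookup f k *\<^sub>C m k)"
  unfolding monoid_algebra_lift_def
  by (rule sum.mono_neutral_left) (use assms in \<open>auto simp: in_keys_iff\<close>)

lemma lift_zero [simp]: "monoid_algebra_lift m 0 = 0"
  by (simp add: monoid_algebra_lift_def)

lemma lift_single [simp]: "monoid_algebra_lift m (Poly_Mapping.single k c) = c *\<^sub>C m k"
  by (subst lift_eq_sum[of "{k}"]) auto

lemma lift_one: "monoid_algebra_lift m 1 = m 0"
  using lift_single[of m 0 1] by (simp del: lift_single)

lemma lift_add:
  "monoid_algebra_lift m (f + g) = monoid_algebra_lift m f + monoid_algebra_lift m g"
proof -
  let ?A = "Poly_Mapping.keys f \<union> Poly_Mapping.keys g"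
  have "monoid_algebra_lift m h = (\<Sum>k\<in>?A. Poly_Mapping.lookup h k *\<^sub>C m k)"
    if "Poly_Mapping.keys h \<subseteq> ?A" for h
    using that by (intro lift_eq_sum) auto
  from this[of f] this[of g] this[of "f + g"] show ?thesis
    using Poly_Mapping.keys_add[of f g]
    by (simp add: lookup_add scaleC_add_left sum.distrib)
qed

lemma lift_uminus: "monoid_algebra_lift m (- f) = - monoid_algebra_lift m f"
  using lift_add[of m f "- f"] by (simp add: eq_neg_iff_add_eq_0) (simp add: add.commute)

lemma lift_diff:
  "monoid_algebra_lift m (f - g) = monoid_algebra_lift m f - monoid_algebra_lift m g"
  using lift_add[of m f "- g"] lift_uminus[of m g] by simp

lemma poly_mapping_single_induct [case_names zero single add]:
  assumes "P 0" "\<And>k c. P (Poly_Mapping.single k c)" "\<And>f g. P f \<Longrightarrow> P g \<Longrightarrow> P (f + g)"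
  shows "P (f :: 'k \<Rightarrow>\<^sub>0 'c::comm_monoid_add)"
proof -
  have "f = (\<Sum>k\<in>Poly_Mapping.keys f. Poly_Mapping.single k (Poly_Mapping.lookup f k))"
    by (rule poly_mapping_eqI)
      (simp add: lookup_sum lookup_single when_def sum.delta in_keys_iff)
  moreover have "P (\<Sum>k\<in>A. Poly_Mapping.single k (Poly_Mapping.lookup f k))" if "finite A" for A
    using that by (induction A rule: finite_induct) (auto intro: assms)
  ultimately show ?thesis
    by (metis finite_keys)
qed

lemma lift_mult:
  fixes m :: "'k::monoid_add \<Rightarrow> 'b::complex_algebra_1"
  assumes m: "\<And>k l. m (k + l) = m k * m l"
  shows "monoid_algebra_lift m (f * g) = monoid_algebra_lift m f * monoid_algebra_lift m g"
proof (induction f rule: poly_mapping_single_induct)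
  case (single k c)
  show ?case
    by (induction g rule: poly_mapping_single_induct)
      (simp_all add: mult_single m distrib_left lift_add mult_scaleC_left mult_scaleC_right scaleC_scaleC)
qed (simp_all add: distrib_right lift_add)

lemma lift_ideal:
  fixes m :: "'k::monoid_add \<Rightarrow> 'b::complex_algebra_1"
  assumes m: "\<And>k l. m (k + l) = m k * m l" and S: "\<forall>s\<in>S. monoid_algebra_lift m s = 0"
    and f: "f \<in> ideal_of S"
  shows "monoid_algebra_lift m f = 0"
  using f
proof (induction rule: ideal_of.induct)
  case (ideal_gen s a b)
  thus ?case using S by (simp add: lift_mult[of m, OF m])
qed (simp_all add: lift_add)

lemma lift_cong_ideal:
  fixes m :: "'k::monoid_add \<Rightarrow> 'b::complex_algebra_1"
  assumes "\<And>k l. m (k + l) = m k * m l" "\<forall>s\<in>S. monoid_algebra_lift m s = 0"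
    and "cong_ideal S f g"
  shows "monoid_algebra_lift m f = monoid_algebra_lift m g"
  using lift_ideal[of m S "f - g", OF assms(1,2)] assms(3) by (simp add: cong_ideal_def lift_diff)

lemma single_zero_central:
  fixes f :: "'k::monoid_add \<Rightarrow>\<^sub>0 complex"
  shows "f * Poly_Mapping.single 0 c = Poly_Mapping.single 0 c * f"
  by (induction f rule: poly_mapping_single_induct)
    (simp_all add: mult_single algebra_simps)

lemma single_zero_mult_left_commute:
  fixes f :: "'k::monoid_add \<Rightarrow>\<^sub>0 complex"
  shows "f * (Poly_Mapping.single 0 c * g) = Poly_Mapping.single 0 c * (f * g)"
  using single_zero_central[of f c] by (simp flip: mult.assoc)


section \<open>The universal enveloping algebra\<close>

instantiation list :: (type) monoid_add
begin
definition zero_list :: "'a list" where "zero_list = []"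
definition plus_list :: "'a list \<Rightarrow> 'a list \<Rightarrow> 'a list" where "plus_list = (@)"
instance by standard (simp_all add: zero_list_def plus_list_def)
end

text \<open>\<open>'a list \<Rightarrow>\<^sub>0 complex\<close> is the free associative algebra on the set of elements of the Lie
  algebra \<open>'a\<close>. The first two families of relations make the letters linear (so that the quotient
  by them is the tensor algebra), the third one is the defining relation of the enveloping algebra.\<close>

inductive_set uea_relations :: "('a::lie_algebra list \<Rightarrow>\<^sub>0 complex) set" where
  uea_rel_add: "Poly_Mapping.single [x + y] 1 - Poly_Mapping.single [x] 1 - Poly_Mapping.single [y] 1
    \<in> uea_relations"
| uea_rel_scale: "Poly_Mapping.single [c *\<^sub>C x] 1 - Poly_Mapping.single [x] c \<in> uea_relations"
| uea_rel_bracket: "Poly_Mapping.single [x, y] 1 - Poly_Mapping.single [y, x] 1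
    - Poly_Mapping.single [lie_bracket x y] 1 \<in> uea_relations"

quotient_type (overloaded) 'a uea =
  "'a::lie_algebra list \<Rightarrow>\<^sub>0 complex" / "cong_ideal uea_relations"
  by (rule equivp_cong_ideal)

lift_definition uea_of :: "'a::lie_algebra \<Rightarrow> 'a uea" is "\<lambda>x. Poly_Mapping.single [x] 1" .

lemma uea_lift_welldef:
  fixes \<phi> :: "'a::lie_algebra \<Rightarrow> 'b::complex_algebra_1"
  assumes "\<And>x y. \<phi> (x + y) = \<phi> x + \<phi> y" "\<And>c x. \<phi> (c *\<^sub>C x) = c *\<^sub>C \<phi> x"
    and "\<And>x y. \<phi> (lie_bracket x y) = commutator (\<phi> x) (\<phi> y)"
    and "cong_ideal uea_relations f g"
  shows "monoid_algebra_lift (\<lambda>w. prod_list (map \<phi> w)) f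
       = monoid_algebra_lift (\<lambda>w. prod_list (map \<phi> w)) g"
proof (rule lift_cong_ideal[OF _ _ assms(4)])
  show "\<forall>s\<in>uea_relations. monoid_algebra_lift (\<lambda>w. prod_list (map \<phi> w)) s = 0"
  proof
    fix s :: "'a list \<Rightarrow>\<^sub>0 complex"
    assume "s \<in> uea_relations"
    thus "monoid_algebra_lift (\<lambda>w. prod_list (map \<phi> w)) s = 0"
      by cases (simp_all add: lift_diff assms(1-3) commutator_def)
  qed
qed (simp add: plus_list_def)

instantiation uea :: (lie_algebra) complex_algebra_1
begin
lift_definition zero_uea :: "'a uea" is 0 .
lift_definition one_uea :: "'a uea" is 1 .
lift_definition plus_uea :: "'a uea \<Rightarrow> 'a uea \<Rightarrow> 'a uea" is "(+)" by (rule cong_ideal_add)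
lift_definition minus_uea :: "'a uea \<Rightarrow> 'a uea \<Rightarrow> 'a uea" is "(-)" by (rule cong_ideal_diff)
lift_definition uminus_uea :: "'a uea \<Rightarrow> 'a uea" is uminus by (rule cong_ideal_uminus)
lift_definition times_uea :: "'a uea \<Rightarrow> 'a uea \<Rightarrow> 'a uea" is "(*)" by (rule cong_ideal_mult)
lift_definition scaleC_uea :: "complex \<Rightarrow> 'a uea \<Rightarrow> 'a uea"
  is "\<lambda>c f. Poly_Mapping.single 0 c * f"
  by (intro cong_ideal_mult cong_ideal_refl)

instance
proof
  show "(0::'a uea) \<noteq> 1"
  proof transfer
    show "\<not> cong_ideal uea_relations (0 :: 'a list \<Rightarrow>\<^sub>0 complex) 1"
    proof
      assume "cong_ideal uea_relations (0 :: 'a list \<Rightarrow>\<^sub>0 complex) 1"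
      from uea_lift_welldef[of "\<lambda>_. 0::complex", OF _ _ _ this] show False
        by (simp add: commutator_def lift_one zero_list_def)
    qed
  qed
  fix a b c :: "'a uea" and r t :: complex
  show "a + b + c = a + (b + c)" by transfer (simp add: add.assoc)
  show "a + b = b + a" by transfer (simp add: add.commute)
  show "0 + a = a" "- a + a = 0" "a - b = a + - b" by (transfer; simp)+
  show "a * b * c = a * (b * c)" by transfer (simp add: mult.assoc)
  show "1 * a = a" "a * 1 = a" by (transfer; simp)+
  show "(a + b) * c = a * c + b * c" by transfer (simp add: distrib_right)
  show "a * (b + c) = a * b + a * c" by transfer (simp add: distrib_left)
  show "r *\<^sub>C (a + b) = r *\<^sub>C a + r *\<^sub>C b" by transfer (simp add: distrib_left)
  show "(r + t) *\<^sub>C a = r *\<^sub>C a + t *\<^sub>C a" by transfer (simp add: distrib_right single_add)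
  show "r *\<^sub>C t *\<^sub>C a = (r * t) *\<^sub>C a"
    by transfer (simp add: mult_single mult.assoc[symmetric])
  show "1 *\<^sub>C a = a" by transfer simp
  show "r *\<^sub>C a * b = r *\<^sub>C (a * b)" by transfer (simp add: mult.assoc)
  show "a * (r *\<^sub>C b) = r *\<^sub>C (a * b)"
    by transfer (simp add: single_zero_mult_left_commute)
qed
end


section \<open>Tensor products of algebras and the coproduct\<close>

datatype ('a, 'b) pure_tensor = Pure 'a 'b

instantiation pure_tensor :: (monoid_mult, monoid_mult) monoid_add
begin
definition zero_pure_tensor :: "('a, 'b) pure_tensor" where "0 = Pure 1 1"
fun plus_pure_tensor :: "('a, 'b) pure_tensor \<Rightarrow> ('a, 'b) pure_tensor \<Rightarrow> ('a, 'b) pure_tensor" where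
  "Pure a b + Pure a' b' = Pure (a * a') (b * b')"
instance
proof
  fix x y z :: "('a, 'b) pure_tensor"
  show "x + y + z = x + (y + z)" by (cases x; cases y; cases z) (simp add: mult.assoc)
  show "0 + x = x" "x + 0 = x" by (cases x; simp add: zero_pure_tensor_def)+
qed
end

text \<open>In the monoid algebra of pairs \<open>(a, b)\<close> with componentwise multiplication, the bilinearity
  relations below are stable under multiplication by pairs. So the ideal they generate is just their
  linear span, and the quotient is the usual tensor product of algebras.\<close>

inductive_set bilinear_relations ::
    "(('a::complex_algebra_1, 'b::complex_algebra_1) pure_tensor \<Rightarrow>\<^sub>0 complex) set" where
  bilinear_add_left: "Poly_Mapping.single (Pure (a + a') b) 1 - Poly_Mapping.single (Pure a b) 1
    - Poly_Mapping.single (Pure a' b) 1 \<in> bilinear_relations"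
| bilinear_add_right: "Poly_Mapping.single (Pure a (b + b')) 1 - Poly_Mapping.single (Pure a b) 1
    - Poly_Mapping.single (Pure a b') 1 \<in> bilinear_relations"
| bilinear_scale_left: "Poly_Mapping.single (Pure (c *\<^sub>C a) b) 1 - Poly_Mapping.single (Pure a b) c
    \<in> bilinear_relations"
| bilinear_scale_right: "Poly_Mapping.single (Pure a (c *\<^sub>C b)) 1 - Poly_Mapping.single (Pure a b) c
    \<in> bilinear_relations"

quotient_type (overloaded) ('a, 'b) tensor =
  "('a::complex_algebra_1, 'b::complex_algebra_1) pure_tensor \<Rightarrow>\<^sub>0 complex"
  / "cong_ideal bilinear_relations"
  by (rule equivp_cong_ideal)

lift_definition tensor_of ::
    "'a::complex_algebra_1 \<Rightarrow> 'b::complex_algebra_1 \<Rightarrow> ('a, 'b) tensor" (infixr \<open>\<otimes>\<close> 76)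
  is "\<lambda>a b. Poly_Mapping.single (Pure a b) 1" .

lemma exists_functional_one: "\<exists>f. f (1::'a::complex_algebra_1) = (1::complex) \<and>
    (\<forall>x y. f (x + y) = f x + f y) \<and> (\<forall>c x. f (c *\<^sub>C x) = c * f x)"
proof -
  interpret vector_space_pair "scaleC :: complex \<Rightarrow> 'a \<Rightarrow> 'a" "scaleC :: complex \<Rightarrow> complex \<Rightarrow> complex" ..
  have "complex_vector.independent {1::'a}" by simp
  from linear_independent_extend[OF this, of "\<lambda>_. 1"] obtain f :: "'a \<Rightarrow> complex"
    where "Vector_Spaces.linear (*\<^sub>C) (*\<^sub>C) f" "f (1::'a) = 1" by (auto simp: fun_eq_iff)
  thus ?thesis
    by (intro exI[of _ f])
      (auto simp: Vector_Spaces.linear_iff scaleC_complex_def)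
qed

lemma one_notin_bilinear_ideal:
  "(1 :: ('a::complex_algebra_1, 'b::complex_algebra_1) pure_tensor \<Rightarrow>\<^sub>0 complex)
     \<notin> ideal_of bilinear_relations"
proof
  obtain f where f: "f (1::'a) = (1::complex)" "\<And>x y. f (x + y) = f x + f y"
    "\<And>c x. f (c *\<^sub>C x) = c * f x" using exists_functional_one by blast
  obtain g where g: "g (1::'b) = (1::complex)" "\<And>x y. g (x + y) = g x + g y"
    "\<And>c x. g (c *\<^sub>C x) = c * g x" using exists_functional_one by blast
  define m where "m k = (case k of Pure a b \<Rightarrow> f a * g b)" for k
  have sandwich: "monoid_algebra_lift m (Poly_Mapping.single k c * s * Poly_Mapping.single l d) = 0"
    if "s \<in> bilinear_relations" for k c s l d
    using that
    by (cases k; cases l; cases rule: bilinear_relations.cases)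
      (simp_all add: left_diff_distrib right_diff_distrib mult_single lift_diff m_def f g
        scaleC_complex_def distrib_left distrib_right mult_scaleC_left mult_scaleC_right)
  have gen: "monoid_algebra_lift m (p * s * q) = 0" if s: "s \<in> bilinear_relations" for p s q
  proof (induction p rule: poly_mapping_single_induct)
    case (single k c)
    show ?case
      by (induction q rule: poly_mapping_single_induct)
        (simp_all add: distrib_left lift_add sandwich[OF s])
  qed (simp_all add: distrib_right lift_add)
  have "monoid_algebra_lift m x = 0" if "x \<in> ideal_of bilinear_relations" for x
    using that by induction (simp_all add: lift_add gen)
  moreover assume "(1 :: ('a, 'b) pure_tensor \<Rightarrow>\<^sub>0 complex) \<in> ideal_of bilinear_relations"
  ultimately have "monoid_algebra_lift m 1 = 0" by blast
  thus False
    by (simp add: lift_one m_def zero_pure_tensor_def f g)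
qed

instantiation tensor :: (complex_algebra_1, complex_algebra_1) complex_algebra_1
begin
lift_definition zero_tensor :: "('a, 'b) tensor" is 0 .
lift_definition one_tensor :: "('a, 'b) tensor" is 1 .
lift_definition plus_tensor :: "('a, 'b) tensor \<Rightarrow> ('a, 'b) tensor \<Rightarrow> ('a, 'b) tensor"
  is "(+)" by (rule cong_ideal_add)
lift_definition minus_tensor :: "('a, 'b) tensor \<Rightarrow> ('a, 'b) tensor \<Rightarrow> ('a, 'b) tensor"
  is "(-)" by (rule cong_ideal_diff)
lift_definition uminus_tensor :: "('a, 'b) tensor \<Rightarrow> ('a, 'b) tensor"
  is uminus by (rule cong_ideal_uminus)
lift_definition times_tensor :: "('a, 'b) tensor \<Rightarrow> ('a, 'b) tensor \<Rightarrow> ('a, 'b) tensor"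
  is "(*)" by (rule cong_ideal_mult)
lift_definition scaleC_tensor :: "complex \<Rightarrow> ('a, 'b) tensor \<Rightarrow> ('a, 'b) tensor"
  is "\<lambda>c f. Poly_Mapping.single 0 c * f"
  by (intro cong_ideal_mult cong_ideal_refl)

instance
proof
  show "(0::('a, 'b) tensor) \<noteq> 1"
  proof transfer
    show "\<not> cong_ideal bilinear_relations (0 :: ('a, 'b) pure_tensor \<Rightarrow>\<^sub>0 complex) 1"
    proof
      assume "cong_ideal bilinear_relations (0 :: ('a, 'b) pure_tensor \<Rightarrow>\<^sub>0 complex) 1"
      hence "(- 1 :: ('a, 'b) pure_tensor \<Rightarrow>\<^sub>0 complex) \<in> ideal_of bilinear_relations"
        by (simp add: cong_ideal_def)
      from ideal_uminus[OF this] show False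
        by (simp add: one_notin_bilinear_ideal)
    qed
  qed
  fix a b c :: "('a, 'b) tensor" and r t :: complex
  show "a + b + c = a + (b + c)" by transfer (simp add: add.assoc)
  show "a + b = b + a" by transfer (simp add: add.commute)
  show "0 + a = a" "- a + a = 0" "a - b = a + - b" by (transfer; simp)+
  show "a * b * c = a * (b * c)" by transfer (simp add: mult.assoc)
  show "1 * a = a" "a * 1 = a" by (transfer; simp)+
  show "(a + b) * c = a * c + b * c" by transfer (simp add: distrib_right)
  show "a * (b + c) = a * b + a * c" by transfer (simp add: distrib_left)
  show "r *\<^sub>C (a + b) = r *\<^sub>C a + r *\<^sub>C b" by transfer (simp add: distrib_left)
  show "(r + t) *\<^sub>C a = r *\<^sub>C a + t *\<^sub>C a" by transfer (simp add: distrib_right single_add)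
  show "r *\<^sub>C t *\<^sub>C a = (r * t) *\<^sub>C a"
    by transfer (simp add: mult_single mult.assoc[symmetric])
  show "1 *\<^sub>C a = a" by transfer simp
  show "r *\<^sub>C a * b = r *\<^sub>C (a * b)" by transfer (simp add: mult.assoc)
  show "a * (r *\<^sub>C b) = r *\<^sub>C (a * b)"
    by transfer (simp add: single_zero_mult_left_commute)
qed
end

lemma tensor_mult: "(a \<otimes> b) * (a' \<otimes> b') = (a * a') \<otimes> (b * b')"
  by transfer (simp add: mult_single )

lemma tensor_add_left: "(a + a') \<otimes> b = a \<otimes> b + a' \<otimes> b"
proof transfer
  fix a a' :: 'a and b :: 'b
  have "1 * (Poly_Mapping.single (Pure (a + a') b) 1 - Poly_Mapping.single (Pure a b) 1
        - Poly_Mapping.single (Pure a' b) 1) * 1 \<in> ideal_of bilinear_relations"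
    by (intro ideal_gen bilinear_relations.intros)
  thus "cong_ideal bilinear_relations (Poly_Mapping.single (Pure (a + a') b) 1)
     (Poly_Mapping.single (Pure a b) 1 + Poly_Mapping.single (Pure a' b) 1)"
    by (simp add: cong_ideal_def algebra_simps)
qed

lemma tensor_add_right: "a \<otimes> (b + b') = a \<otimes> b + a \<otimes> b'"
proof transfer
  fix a :: 'a and b b' :: 'b
  have "1 * (Poly_Mapping.single (Pure a (b + b')) 1 - Poly_Mapping.single (Pure a b) 1
        - Poly_Mapping.single (Pure a b') 1) * 1 \<in> ideal_of bilinear_relations"
    by (intro ideal_gen bilinear_relations.intros)
  thus "cong_ideal bilinear_relations (Poly_Mapping.single (Pure a (b + b')) 1)
     (Poly_Mapping.single (Pure a b) 1 + Poly_Mapping.single (Pure a b') 1)"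
    by (simp add: cong_ideal_def algebra_simps)
qed

lemma tensor_scaleC_left: "(c *\<^sub>C a) \<otimes> b = c *\<^sub>C (a \<otimes> b)"
proof transfer
  fix a :: 'a and b :: 'b and c
  have "1 * (Poly_Mapping.single (Pure (c *\<^sub>C a) b) 1 - Poly_Mapping.single (Pure a b) c) * 1
      \<in> ideal_of bilinear_relations"
    by (intro ideal_gen bilinear_relations.intros)
  thus "cong_ideal bilinear_relations (Poly_Mapping.single (Pure (c *\<^sub>C a) b) 1)
     (Poly_Mapping.single 0 c * Poly_Mapping.single (Pure a b) 1)"
    by (simp add: cong_ideal_def mult_single)
qed

lemma tensor_scaleC_right: "a \<otimes> (c *\<^sub>C b) = c *\<^sub>C (a \<otimes> b)"
proof transfer
  fix a :: 'a and b :: 'b and c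
  have "1 * (Poly_Mapping.single (Pure a (c *\<^sub>C b)) 1 - Poly_Mapping.single (Pure a b) c) * 1
      \<in> ideal_of bilinear_relations"
    by (intro ideal_gen bilinear_relations.intros)
  thus "cong_ideal bilinear_relations (Poly_Mapping.single (Pure a (c *\<^sub>C b)) 1)
     (Poly_Mapping.single 0 c * Poly_Mapping.single (Pure a b) 1)"
    by (simp add: cong_ideal_def mult_single)
qed

lemma uea_of_add: "uea_of (x + y) = uea_of x + uea_of y"
proof transfer
  fix x y :: 'a
  have "1 * (Poly_Mapping.single [x + y] 1 - Poly_Mapping.single [x] 1 - Poly_Mapping.single [y] 1) * 1
      \<in> ideal_of uea_relations"
    by (intro ideal_gen uea_relations.intros)
  thus "cong_ideal uea_relations (Poly_Mapping.single [x + y] 1)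
     (Poly_Mapping.single [x] 1 + Poly_Mapping.single [y] 1)"
    by (simp add: cong_ideal_def algebra_simps)
qed

lemma uea_of_scaleC: "uea_of (c *\<^sub>C x) = c *\<^sub>C uea_of x"
proof transfer
  fix x :: 'a and c
  have "1 * (Poly_Mapping.single [c *\<^sub>C x] 1 - Poly_Mapping.single [x] c) * 1
      \<in> ideal_of uea_relations"
    by (intro ideal_gen uea_relations.intros)
  thus "cong_ideal uea_relations (Poly_Mapping.single [c *\<^sub>C x] 1)
     (Poly_Mapping.single 0 c * Poly_Mapping.single [x] 1)"
    by (simp add: cong_ideal_def mult_single)
qed

lemma uea_of_bracket: "uea_of (lie_bracket x y) = commutator (uea_of x) (uea_of y)"
  unfolding commutator_def
proof transfer
  fix x y :: 'a
  have "1 * (Poly_Mapping.single [x, y] 1 - Poly_Mapping.single [y, x] 1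
        - Poly_Mapping.single [lie_bracket x y] 1) * 1 \<in> ideal_of uea_relations"
    by (intro ideal_gen uea_relations.intros)
  from ideal_uminus[OF this]
  show "cong_ideal uea_relations (Poly_Mapping.single [lie_bracket x y] 1)
     (Poly_Mapping.single [x] 1 * Poly_Mapping.single [y] 1
      - Poly_Mapping.single [y] 1 * Poly_Mapping.single [x] 1)"
    by (simp add: cong_ideal_def mult_single plus_list_def)
qed

lift_definition coproduct :: "'a::lie_algebra uea \<Rightarrow> ('a uea, 'a uea) tensor"
  is "monoid_algebra_lift (\<lambda>w. prod_list (map (\<lambda>x. uea_of x \<otimes> 1 + 1 \<otimes> uea_of x) w))"
proof -
  fix f g :: "'a list \<Rightarrow>\<^sub>0 complex"
  assume fg: "cong_ideal uea_relations f g"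
  define d :: "'a \<Rightarrow> ('a uea, 'a uea) tensor" where "d = (\<lambda>x. uea_of x \<otimes> 1 + 1 \<otimes> uea_of x)"
  have "d (lie_bracket x y) = commutator (d x) (d y)" for x y
  proof -
    have neg: "(- a) \<otimes> b = - (a \<otimes> b)" "b \<otimes> (- a) = - (b \<otimes> a)" for a b :: "'a uea"
      using tensor_scaleC_left[of "-1" a b] tensor_scaleC_right[of b "-1" a]
      by (simp_all add: scaleC_one)
    have diff: "(a - b) \<otimes> c = a \<otimes> c - b \<otimes> c" "c \<otimes> (a - b) = c \<otimes> a - c \<otimes> b"
      for a b c :: "'a uea"
      using tensor_add_left[of a "- b" c] tensor_add_right[of c a "- b"] by (simp_all add: neg)
    show ?thesis
      by (simp add: d_def uea_of_bracket commutator_def diff tensor_mult distrib_left distrib_right)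
  qed
  moreover have "d (x + y) = d x + d y" "d (c *\<^sub>C x) = c *\<^sub>C d x" for x y c
    by (simp_all add: d_def uea_of_add uea_of_scaleC tensor_add_left tensor_add_right
       tensor_scaleC_left tensor_scaleC_right scaleC_add_right)
  ultimately have "monoid_algebra_lift (\<lambda>w. prod_list (map d w)) f
      = monoid_algebra_lift (\<lambda>w. prod_list (map d w)) g"
    by (intro uea_lift_welldef fg)
  thus "monoid_algebra_lift (\<lambda>w. prod_list (map (\<lambda>x. uea_of x \<otimes> 1 + 1 \<otimes> uea_of x) w)) f
      = monoid_algebra_lift (\<lambda>w. prod_list (map (\<lambda>x. uea_of x \<otimes> 1 + 1 \<otimes> uea_of x) w)) g"
    by (simp add: d_def)
qed


section \<open>The Lie algebra \<open>so(M)\<close> with \<open>M = CARD('m)\<close>\<close>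

text \<open>Indices are natural numbers \<open>1, \<dots>, M\<close> as in the matrix notation, identified with the elements
  of \<open>'m\<close> through the enumeration of the type.\<close>

definition idx :: "nat \<Rightarrow> 'm::enum" where
  "idx i = enum_class.enum ! (i - 1)"

type_synonym 'm sqmat = "((complex, 'm) vec, 'm) vec"

definition mat_unit :: "nat \<Rightarrow> nat \<Rightarrow> 'm::enum sqmat" where
  "mat_unit i j = (\<chi> r s. if r = idx i \<and> s = idx j then 1 else 0)"

definition A_mat :: "nat \<Rightarrow> nat \<Rightarrow> 'm::enum sqmat" where
  "A_mat i j = mat_unit i j - mat_unit (CARD('m) + 1 - j) (CARD('m) + 1 - i)"

typedef (overloaded) 'm so =
  "complex_vector.span {A_mat i j | i j. i \<in> {1..CARD('m::enum)} \<and> j \<in> {1..CARD('m)}}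
     :: 'm sqmat set"
  using complex_vector.span_zero by blast

setup_lifting type_definition_so

lemma idx_eq_iff:
  assumes "i \<in> {1..CARD('m::enum)}" "j \<in> {1..CARD('m)}"
  shows "(idx i :: 'm) = idx j \<longleftrightarrow> i = j"
proof -
  have d: "distinct (enum_class.enum :: 'm list)"
    by (rule enum_distinct)
  have "length (enum_class.enum :: 'm list) = CARD('m)"
    using distinct_card[OF d] by (simp add: UNIV_enum)
  thus ?thesis
    using assms nth_eq_iff_index_eq[OF d, of "i - 1" "j - 1"] unfolding idx_def by force
qed

lemma mat_unit_mult:
  assumes "j \<in> {1..CARD('m)}" "k \<in> {1..CARD('m)}"
  shows "(mat_unit i j :: 'm::enum sqmat) ** mat_unit k l
       = (if j = k then mat_unit i l else 0)"
proof -
  have "(\<Sum>t\<in>UNIV. (if r = idx i \<and> (t::'m) = idx j then 1 else 0) *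
           (if t = idx k \<and> s = idx l then 1 else (0::complex)))
      = (if j = k \<and> r = idx i \<and> s = idx l then 1 else 0)" for r s :: 'm
  proof -
    have "(\<Sum>t\<in>UNIV. (if r = idx i \<and> (t::'m) = idx j then 1 else 0) *
             (if t = idx k \<and> s = idx l then 1 else (0::complex)))
        = (\<Sum>t\<in>UNIV. if t = (idx j :: 'm) then
             (if r = idx i \<and> idx j = (idx k :: 'm) \<and> s = idx l then 1 else 0) else 0)"
      by (intro sum.cong) auto
    thus ?thesis using idx_eq_iff[OF assms] by (simp add: sum.delta)
  qed
  thus ?thesis
    by (auto simp: matrix_matrix_mult_def mat_unit_def vec_eq_iff)
qed

lemma matrix_mult_add:
  fixes X Y Z :: "'m::finite sqmat"
  shows "(X + Y) ** Z = X ** Z + Y ** Z" "Z ** (X + Y) = Z ** X + Z ** Y"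
  by (simp_all add: matrix_matrix_mult_def vec_eq_iff sum.distrib algebra_simps)

lemma matrix_mult_diff:
  fixes X Y Z :: "'m::finite sqmat"
  shows "(X - Y) ** Z = X ** Z - Y ** Z" "Z ** (X - Y) = Z ** X - Z ** Y"
  by (simp_all add: matrix_matrix_mult_def vec_eq_iff sum_subtractf algebra_simps)

lemma scaleC_matrix_mult:
  fixes X Y :: "'m::finite sqmat"
  shows "(c *\<^sub>C X) ** Y = c *\<^sub>C (X ** Y)" "X ** (c *\<^sub>C Y) = c *\<^sub>C (X ** Y)"
  by (simp_all add: matrix_matrix_mult_def scaleC_vec_def scaleC_complex_def vec_eq_iff
      sum_distrib_left algebra_simps)

lemma A_mat_bracket:
  assumes "i \<in> {1..CARD('m)}" "j \<in> {1..CARD('m)}" "k \<in> {1..CARD('m)}" "l \<in> {1..CARD('m)}"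
  defines "M \<equiv> CARD('m)"
  shows "(A_mat i j :: 'm::enum sqmat) ** A_mat k l - A_mat k l ** A_mat i j =
      (if j = k then A_mat i l else 0) - (if j = M + 1 - l then A_mat i (M + 1 - k) else 0)
      - (if k = M + 1 - i then A_mat (M + 1 - j) l else 0) - (if i = l then A_mat k j else 0)"
proof -
  define p q u v where "p = M + 1 - i" and "q = M + 1 - j" and "u = M + 1 - k"
    and "v = M + 1 - l"
  note pquv = this
  have rng: "p \<in> {1..CARD('m)}" "q \<in> {1..CARD('m)}" "u \<in> {1..CARD('m)}" "v \<in> {1..CARD('m)}"
    and eqs: "p = k \<longleftrightarrow> k = p" "p = v \<longleftrightarrow> i = l" "l = i \<longleftrightarrow> i = l" "l = q \<longleftrightarrow> j = v"
      "u = i \<longleftrightarrow> k = p" "u = q \<longleftrightarrow> j = k"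
    and double: "M + 1 - p = i" "M + 1 - q = j" "M + 1 - u = k" "M + 1 - v = l"
    using assms(1-4) by (auto simp: M_def pquv)
  show ?thesis
    unfolding A_mat_def M_def[symmetric] matrix_mult_diff pquv(1-4)[symmetric] double
      mat_unit_mult[OF assms(2,3)] mat_unit_mult[OF assms(2) rng(4)]
      mat_unit_mult[OF rng(1) assms(3)] mat_unit_mult[OF rng(1,4)]
      mat_unit_mult[OF assms(4,1)] mat_unit_mult[OF assms(4) rng(2)]
      mat_unit_mult[OF rng(3) assms(1)] mat_unit_mult[OF rng(3,2)] eqs
    by (cases "j = k"; cases "j = v"; cases "k = p"; cases "i = l") simp_all
qed

lemma so_bracket_closed:
  fixes X Y :: "'m::enum sqmat"
  defines "S \<equiv> {A_mat i j | i j. i \<in> {1..CARD('m)} \<and> j \<in> {1..CARD('m)}} :: 'm sqmat set"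
  assumes X: "X \<in> complex_vector.span S" and Y: "Y \<in> complex_vector.span S"
  shows "X ** Y - Y ** X \<in> complex_vector.span S"
proof -
  let ?V = "complex_vector.span S"
  have A: "A_mat i j \<in> ?V" if "i \<in> {1..CARD('m)}" "j \<in> {1..CARD('m)}" for i j
    using that by (auto simp: S_def intro!: complex_vector.span_base)
  have add: "P ** (Q + R) - (Q + R) ** P = (P ** Q - Q ** P) + (P ** R - R ** P)"
    and scale: "P ** (c *\<^sub>C Q) - (c *\<^sub>C Q) ** P = c *\<^sub>C (P ** Q - Q ** P)"
    and anti: "P ** Q - Q ** P = - (Q ** P - P ** Q)" for P Q R :: "'m sqmat" and c
    by (simp_all add: matrix_mult_add scaleC_matrix_mult
        complex_vector.scale_right_diff_distrib)
  have step: "P ** Q - Q ** P \<in> ?V"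
    if P: "\<And>Q'. Q' \<in> S \<Longrightarrow> P ** Q' - Q' ** P \<in> ?V" and Q: "Q \<in> ?V" for P Q :: "'m sqmat"
    using Q
  proof (induction rule: complex_vector.span_induct_alt)
    case base
    show ?case by (simp add: complex_vector.span_zero)
  next
    case (step c x y)
    show ?case
      unfolding add scale
      by (intro complex_vector.span_add complex_vector.span_scale P step)
  qed
  have "P ** Q - Q ** P \<in> ?V" if "P \<in> S" "Q \<in> S" for P Q
  proof -
    have c: "(if b then Z else 0) \<in> ?V" if "b \<Longrightarrow> Z \<in> ?V" for b Z
      using that by (simp add: complex_vector.span_zero)
    from that obtain i j k l where "P = A_mat i j" "Q = A_mat k l"
      "i \<in> {1..CARD('m)}" "j \<in> {1..CARD('m)}" "k \<in> {1..CARD('m)}" "l \<in> {1..CARD('m)}"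
      by (auto simp: S_def)
    thus ?thesis
      by (simp only: A_mat_bracket) (intro complex_vector.span_diff c A; auto)
  qed
  hence "P ** Q - Q ** P \<in> ?V" if "P \<in> S" "Q \<in> ?V" for P Q
    using step that by blast
  hence "P ** Q - Q ** P \<in> ?V" if "P \<in> S" "Q \<in> ?V" for P Q
    using that by blast
  hence "Y ** Q - Q ** Y \<in> ?V" if "Q \<in> S" for Q
    using that Y anti[of Y Q] by (metis complex_vector.span_neg)
  from step[OF this X] show ?thesis
    using anti[of X Y] by (metis complex_vector.span_neg)
qed

instantiation so :: (enum) lie_algebra
begin
lift_definition zero_so :: "'a so" is 0 by (rule complex_vector.span_zero)
lift_definition plus_so :: "'a so \<Rightarrow> 'a so \<Rightarrow> 'a so" is "(+)" by (rule complex_vector.span_add)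
lift_definition minus_so :: "'a so \<Rightarrow> 'a so \<Rightarrow> 'a so" is "(-)" by (rule complex_vector.span_diff)
lift_definition uminus_so :: "'a so \<Rightarrow> 'a so" is uminus by (rule complex_vector.span_neg)
lift_definition scaleC_so :: "complex \<Rightarrow> 'a so \<Rightarrow> 'a so" is scaleC
  by (rule complex_vector.span_scale)
lift_definition lie_bracket_so :: "'a so \<Rightarrow> 'a so \<Rightarrow> 'a so" is "\<lambda>X Y. X ** Y - Y ** X"
  by (rule so_bracket_closed)

instance
proof
  fix x y z :: "'a so" and c d :: complex
  show "x + y + z = x + (y + z)" by transfer (simp add: add.assoc)
  show "x + y = y + x" by transfer (simp add: add.commute)
  show "0 + x = x" "- x + x = 0" "x - y = x + - y" by (transfer; simp)+
  show "c *\<^sub>C (x + y) = c *\<^sub>C x + c *\<^sub>C y" by transfer (rule scaleC_add_right)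
  show "(c + d) *\<^sub>C x = c *\<^sub>C x + d *\<^sub>C x" by transfer (rule scaleC_add_left)
  show "c *\<^sub>C d *\<^sub>C x = (c * d) *\<^sub>C x" by transfer (rule scaleC_scaleC)
  show "1 *\<^sub>C x = x" by transfer (rule scaleC_one)
  show "lie_bracket (x + y) z = lie_bracket x z + lie_bracket y z"
    "lie_bracket x (y + z) = lie_bracket x y + lie_bracket x z"
    by (transfer; simp add: matrix_mult_add)+
  show "lie_bracket (c *\<^sub>C x) y = c *\<^sub>C lie_bracket x y"
    "lie_bracket x (c *\<^sub>C y) = c *\<^sub>C lie_bracket x y"
    by (transfer; simp add: scaleC_matrix_mult complex_vector.scale_right_diff_distrib)+
  show "lie_bracket x x = 0" by transfer simp
  show "lie_bracket x (lie_bracket y z) + lie_bracket y (lie_bracket z x)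
          + lie_bracket z (lie_bracket x y) = 0"
    by transfer (simp add: matrix_mult_diff matrix_mul_assoc)
qed
end


lift_definition A_so :: "nat \<Rightarrow> nat \<Rightarrow> 'm::enum so"
  is "\<lambda>i j. if i \<in> {1..CARD('m)} \<and> j \<in> {1..CARD('m)} then A_mat i j else 0"
  by (auto intro: complex_vector.span_base complex_vector.span_zero)

text \<open>Note that \<open>A\<^sub>i\<^sub>i\<close> is the difference of the diagonal matrix units at \<open>i\<close> and \<open>M + 1 - i\<close>.\<close>

definition H_so :: "nat \<Rightarrow> 'm::enum so" where
  "H_so i = (1/2) *\<^sub>C A_so i i"

text \<open>Root vectors for the roots \<open>i - j\<close>, \<open>i + j\<close> and (if \<open>M\<close> is odd) \<open>i\<close>.\<close>

definition E_minus :: "nat \<Rightarrow> nat \<Rightarrow> 'm::enum so" where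
  "E_minus i j = - A_so i j"

definition E_plus :: "nat \<Rightarrow> nat \<Rightarrow> 'm::enum so" where
  "E_plus i j = - A_so i (CARD('m) + 1 - j)"

definition E_short :: "nat \<Rightarrow> 'm::enum so" where
  "E_short i = - A_so i (CARD('m) div 2 + 1)"

text \<open>The subalgebra \<open>so(M - 2m)\<close>.\<close>

definition so_sub :: "nat \<Rightarrow> 'm::enum so set" where
  "so_sub m = complex_vector.span {A_so i j | i j. i \<in> {m + 1..CARD('m) - m} \<and> j \<in> {m + 1..CARD('m) - m}}"


section \<open>The grading and the completions of \<open>U\<close> and \<open>U \<otimes> U\<close>\<close>

definition grading_element :: "'m::enum so" where
  "grading_element = (\<Sum>i = 1..CARD('m) div 2. of_nat (2 * (CARD('m) div 2 + 1 - i)) *\<^sub>C H_so i)"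

definition so_degree :: "int \<Rightarrow> 'm::enum so set" where
  "so_degree d = {x. lie_bracket grading_element x = of_int d *\<^sub>C x}"

definition uea_degree :: "int \<Rightarrow> 'm::enum so uea set" where
  "uea_degree d = complex_vector.span {prod_list (map (uea_of \<circ> snd) ys) | ys.
     (\<forall>(e, x) \<in> set ys. x \<in> so_degree e) \<and> sum_list (map fst ys) = d}"

definition tensor_degree :: "int \<Rightarrow> ('m::enum so uea, 'm so uea) tensor set" where
  "tensor_degree d =
     complex_vector.span {a \<otimes> b | a b i j. a \<in> uea_degree i \<and> b \<in> uea_degree j \<and> i + j = d}"

text \<open>An element of a completion is the family of its homogeneous components, which vanish in all
  sufficiently low degrees; the product is the Cauchy product, i.e. the product of formal Laurent
  series over \<open>U\<close> respectively \<open>U \<otimes> U\<close>. The completions are the subrings of those series whose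
  \<open>d\<close>-th coefficient is homogeneous of degree \<open>d\<close>.\<close>

type_synonym 'm U_series = "'m so uea fls"
type_synonym 'm UU_series = "('m so uea, 'm so uea) tensor fls"

definition U_completion :: "'m::enum U_series set" where
  "U_completion = {f. \<forall>d. fls_nth f d \<in> uea_degree d}"

definition UU_completion :: "'m::enum UU_series set" where
  "UU_completion = {f. \<forall>d. fls_nth f d \<in> tensor_degree d}"

text \<open>The embedding of \<open>U\<close> sends an element to its homogeneous components.\<close>

definition to_completion :: "'m::enum so uea \<Rightarrow> 'm U_series" where
  "to_completion u = (THE f. f \<in> U_completion \<and> finite {d. fls_nth f d \<noteq> 0} \<and>
     (\<Sum>d | fls_nth f d \<noteq> 0. fls_nth f d) = u)"

definition so_hat :: "'m::enum so \<Rightarrow> 'm U_series" where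
  "so_hat x = to_completion (uea_of x)"

definition fls_map :: "('a::zero \<Rightarrow> 'b::zero) \<Rightarrow> 'a fls \<Rightarrow> 'b fls" where
  "fls_map h f = Abs_fls (\<lambda>d. h (fls_nth f d))"

definition tensor_hat :: "'m::enum U_series \<Rightarrow> 'm U_series \<Rightarrow> 'm UU_series" (infixr \<open>\<otimes>\<^sub>h\<close> 76) where
  "x \<otimes>\<^sub>h y = fls_map (\<lambda>a. a \<otimes> 1) x * fls_map (\<lambda>b. 1 \<otimes> b) y"

definition coproduct_hat :: "'m::enum U_series \<Rightarrow> 'm UU_series" where
  "coproduct_hat = fls_map coproduct"

text \<open>Substitution of \<open>x\<close> into the power series \<open>F\<close>, for \<open>x\<close> with components in positive degrees only.
  The power \<open>x ^ j\<close> then starts in degree \<open>j\<close> or higher, so only the \<open>j \<le> n\<close> contribute to degree \<open>n\<close>.\<close>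

definition fps_apply :: "complex fps \<Rightarrow> 'a::complex_algebra_1 fls \<Rightarrow> 'a fls" where
  "fps_apply F x =
     fps_to_fls (Abs_fps (\<lambda>n. \<Sum>j\<le>n. fps_nth F j *\<^sub>C fls_nth (x ^ j) (int n)))"

definition exp_hat :: "'a::complex_algebra_1 fls \<Rightarrow> 'a fls" where
  "exp_hat = fps_apply (fps_exp 1)"

text \<open>\<open>ln1p_hat x\<close> is \<open>ln (1 + x)\<close>: the series \<open>fps_ln 1\<close> is the one of \<open>ln (1 + X)\<close>.\<close>

definition ln1p_hat :: "'a::complex_algebra_1 fls \<Rightarrow> 'a fls" where
  "ln1p_hat = fps_apply (fps_ln 1)"


section \<open>The chain of extended jordanian twists\<close>

text \<open>The index \<open>k\<close> refers to the \<open>k\<close>-th link, with \<open>a\<^sub>1 = 2k + 1\<close> and \<open>a\<^sub>2 = 2k + 2\<close>.\<close>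

definition H_link_plus :: "nat \<Rightarrow> 'm::enum U_series" where
  "H_link_plus k = so_hat (H_so (2*k+1) + H_so (2*k+2))"

definition H_link_minus :: "nat \<Rightarrow> 'm::enum U_series" where
  "H_link_minus k = so_hat (H_so (2*k+1) - H_so (2*k+2))"

definition sigma :: "nat \<Rightarrow> 'm::enum U_series" where
  "sigma k = ln1p_hat (so_hat (E_plus (2*k+1) (2*k+2)))"

definition I_tensor :: "nat \<Rightarrow> 'm::enum UU_series" where
  "I_tensor k =
     (if odd CARD('m) then so_hat (E_short (2*k+1)) \<otimes>\<^sub>h so_hat (E_short (2*k+2)) else 0)
     + (\<Sum>l = 2*k+3..CARD('m) div 2.
          so_hat (E_plus (2*k+1) l) \<otimes>\<^sub>h so_hat (E_minus (2*k+2) l)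
        + so_hat (E_minus (2*k+1) l) \<otimes>\<^sub>h so_hat (E_plus (2*k+2) l))"

text \<open>\<open>I_quad k s\<close> is \<open>I\<^sup>s\<close> for \<open>s = 1, 2\<close>, with \<open>a\<^sub>s = 2k + s\<close>.\<close>

definition I_quad :: "nat \<Rightarrow> nat \<Rightarrow> 'm::enum U_series" where
  "I_quad k s =
     (if odd CARD('m) then (1/2) *\<^sub>C so_hat (E_short (2*k+s)) ^ 2 else 0)
     + (\<Sum>l = 2*k+3..CARD('m) div 2. so_hat (E_plus (2*k+s) l) * so_hat (E_minus (2*k+s) l))"

definition Phi_J :: "nat \<Rightarrow> 'm::enum UU_series" where
  "Phi_J k = exp_hat (H_link_plus k \<otimes>\<^sub>h sigma k)"

definition Phi_E :: "nat \<Rightarrow> 'm::enum UU_series" where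
  "Phi_E k = exp_hat (I_tensor k * (1 \<otimes>\<^sub>h exp_hat (- ((1/2) *\<^sub>C sigma k))))"

fun chain_twist :: "nat \<Rightarrow> 'm::enum UU_series" where
  "chain_twist 0 = Phi_E 0 * Phi_J 0"
| "chain_twist (Suc p) = Phi_E (Suc p) * Phi_J (Suc p) * chain_twist p"

definition G12 :: "nat \<Rightarrow> 'm::enum U_series" where
  "G12 k = so_hat (E_minus (2*k+1) (2*k+2)) - I_quad k 1"

definition G21 :: "nat \<Rightarrow> 'm::enum U_series" where
  "G21 k = so_hat (E_minus (2*k+2) (2*k+1)) - I_quad k 2 * exp_hat (- sigma k)"

definition so3_G :: "nat \<Rightarrow> 'm::enum U_series set" where
  "so3_G k = complex_vector.span {H_link_minus k, G12 k, G21 k}"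


section \<open>Twisted coproduct, primitive elements, direct sums\<close>

definition UU_inverse :: "'m::enum UU_series \<Rightarrow> 'm UU_series" where
  "UU_inverse F = (THE G. G \<in> UU_completion \<and> F * G = 1 \<and> G * F = 1)"

definition twisted_coproduct :: "'m::enum UU_series \<Rightarrow> 'm U_series \<Rightarrow> 'm UU_series" where
  "twisted_coproduct F x = F * coproduct_hat x * UU_inverse F"

definition primitive :: "'m::enum UU_series \<Rightarrow> 'm U_series \<Rightarrow> bool" where
  "primitive F x \<longleftrightarrow> twisted_coproduct F x = x \<otimes>\<^sub>h 1 + 1 \<otimes>\<^sub>h x"

definition lie_embedding :: "'g::lie_algebra set \<Rightarrow> ('g \<Rightarrow> 'a::complex_algebra_1) \<Rightarrow> bool" where
  "lie_embedding L \<phi> \<longleftrightarrow> inj_on \<phi> L \<and>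
     (\<forall>x\<in>L. \<forall>y\<in>L. \<phi> (x + y) = \<phi> x + \<phi> y \<and> \<phi> (lie_bracket x y) = commutator (\<phi> x) (\<phi> y)) \<and>
     (\<forall>c. \<forall>x\<in>L. \<phi> (c *\<^sub>C x) = c *\<^sub>C \<phi> x)"

definition lie_subalgebra :: "'a::complex_algebra_1 set \<Rightarrow> bool" where
  "lie_subalgebra L \<longleftrightarrow> complex_vector.subspace L \<and> (\<forall>x\<in>L. \<forall>y\<in>L. commutator x y \<in> L)"

definition lie_direct_sum :: "'i set \<Rightarrow> ('i \<Rightarrow> 'a::complex_algebra_1 set) \<Rightarrow> bool" where
  "lie_direct_sum I L \<longleftrightarrow>
     (\<forall>i\<in>I. lie_subalgebra (L i)) \<and>
     (\<forall>i\<in>I. \<forall>j\<in>I. i \<noteq> j \<longrightarrow> (\<forall>x\<in>L i. \<forall>y\<in>L j. commutator x y = 0)) \<and>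
     (\<forall>x. (\<forall>i\<in>I. x i \<in> L i) \<and> (\<Sum>i\<in>I. x i) = 0 \<longrightarrow> (\<forall>i\<in>I. x i = 0))"

end

theory Submission
  imports Defs
begin

text \<open>
  Write \<open>F = \<Phi>\<^sub>p \<cdots> \<Phi>\<^sub>0\<close> with \<open>\<Phi>\<^sub>k = \<Phi>\<^sub>E\<^sub>k \<Phi>\<^sub>J\<^sub>k\<close>. An element \<open>x\<close> is primitive for the twisted coproduct
  iff \<open>F \<Delta>(x) = (x \<otimes> 1 + 1 \<otimes> x) F\<close>, so everything is a computation of how the \<open>\<Phi>\<^sub>k\<close> conjugate
  elements of \<open>U \<otimes> U\<close>.

  One link. Let \<open>a = 2k + 1\<close>, \<open>b = 2k + 2\<close>, and let \<open>s\<close> run through the indices of \<open>so(M - 4(k + 1))\<close>, with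
  mirror image \<open>s' = M + 1 - s\<close>. The elements \<open>u\<^sub>s = A\<^sub>a\<^sub>s\<close> and \<open>v\<^sub>s = A\<^sub>b\<^sub>s\<close> satisfy Heisenberg relations
  \<open>[u\<^sub>s, v\<^sub>t] = \<delta>\<^sub>t\<^sub>s\<^sub>' E\<close> with \<open>E = E\<^sub>a\<^sub>+\<^sub>b\<close> commuting with all of them, and uniformly in the parity of \<open>M\<close>
  \<open>I\<^sup>1\<^sup>\<otimes>\<^sup>2 = \<Sum> u\<^sub>s \<otimes> v\<^sub>s\<^sub>'\<close>, \<open>I\<^sup>1 = \<Sum> u\<^sub>s u\<^sub>s\<^sub>' / 2\<close>, \<open>I\<^sup>2 = \<Sum> v\<^sub>s v\<^sub>s\<^sub>' / 2\<close> (lemmas \<open>I_tensor_sum\<close>,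
  \<open>I_quad_sum\<close>). Conjugation by the jordanian factor multiplies \<open>u\<^sub>s \<otimes> 1\<close> and \<open>v\<^sub>s \<otimes> 1\<close> by
  \<open>1 \<otimes> e\<^sup>\<sigma>\<^sup>/\<^sup>2\<close>. The extension factor is \<open>e\<^sup>W\<close>, where at most two brackets with \<open>W\<close> are nonzero on the
  generators, so that its conjugation is an explicit quadratic expression (lemma
  \<open>exp_hat_conjugate\<close>). Together they send \<open>\<Delta>(u\<^sub>s)\<close> to \<open>u\<^sub>s \<otimes> e\<^sup>-\<^sup>\<sigma>\<^sup>/\<^sup>2 + 1 \<otimes> u\<^sub>s\<close> and \<open>\<Delta>(v\<^sub>s)\<close> to
  \<open>v\<^sub>s \<otimes> e\<^sup>\<sigma>\<^sup>/\<^sup>2 + e\<^sup>\<sigma> \<otimes> v\<^sub>s\<close>, which gives the images of \<open>\<Delta>(I\<^sup>1)\<close> and \<open>\<Delta>(I\<^sup>2 e\<^sup>-\<^sup>\<sigma>)\<close>. The terms by which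
  these fail to be primitive are the same as for the root vectors \<open>E\<^sub>1\<^sub>-\<^sub>2\<close> and \<open>E\<^sub>2\<^sub>-\<^sub>1\<close>, and cancel in
  \<open>G\<^sub>1\<^sub>-\<^sub>2\<close> and \<open>G\<^sub>2\<^sub>-\<^sub>1\<close> (lemmas \<open>twisted_G_up\<close>, \<open>twisted_G_down\<close>).

  The chain. The contractions \<open>I\<^sup>1\<^sup>\<otimes>\<^sup>2\<close>, \<open>I\<^sup>1\<close>, \<open>I\<^sup>2\<close> are invariant under \<open>so(M - 4(k + 1))\<close>, because its vector
  representation carries an invariant form (lemma \<open>commutator_contraction\<close>). Hence \<open>\<Phi>\<^sub>j\<close> commutes
  with \<open>\<Delta>(z)\<close> for all series \<open>z\<close> in \<open>so(M - 4(j + 1))\<close>, in particular for the elements of the links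
  \<open>k > j\<close>. Also \<open>so\<^sub>G(3)\<close> of link \<open>k\<close> commutes with \<open>so(M - 4(k + 1))\<close>, so its legs commute with the
  later factors \<open>\<Phi>\<^sub>j\<close>, which are series in the legs of \<open>so(M - 4j)\<close>. Lemma \<open>chain_link\<close> puts the three
  facts together.

  The Lie algebras. The copies of \<open>so(3)\<close> commute with each other and with \<open>so(M - 4(p + 1))\<close>, and they
  have no centre; a vanishing sum of elements of mutually commuting subalgebras has central summands,
  so the sum is direct (lemma \<open>lie_direct_sum_of_centerless\<close>). That \<open>so(M)\<close> embeds into its
  enveloping algebra follows from the defining representation being faithful (lemma \<open>inj_uea_of\<close>).
\<close>

section \<open>Formal Laurent series over a noncommutative algebra\<close>

definition vanishes_below :: "int \<Rightarrow> 'a::zero fls \<Rightarrow> bool" where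
  "vanishes_below a f \<longleftrightarrow> (\<forall>n<a. fls_nth f n = 0)"

lemma fls_nth_scaleC [simp]: "fls_nth (c *\<^sub>C f) n = c *\<^sub>C fls_nth f n"
  by transfer simp

lemma fls_nth_sum: "fls_nth (\<Sum>i\<in>A. f i) n = (\<Sum>i\<in>A. fls_nth (f i) n)"
  by (induction A rule: infinite_finite_induct) simp_all

lemma vanishes_below_exists: "\<exists>a. vanishes_below a f"
  by (rule exI[of _ "fls_subdegree f"]) (simp add: vanishes_below_def)

lemma vanishes_below_mono: "vanishes_below a f \<Longrightarrow> b \<le> a \<Longrightarrow> vanishes_below b f"
  by (auto simp: vanishes_below_def)

lemma vanishes_below_0 [simp]: "vanishes_below a 0"
  by (simp add: vanishes_below_def)

lemma vanishes_below_1: "vanishes_below 0 (1 :: 'a::ring_1 fls)"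
  by (simp add: vanishes_below_def)

lemma vanishes_below_add:
  "vanishes_below a f \<Longrightarrow> vanishes_below a g \<Longrightarrow> vanishes_below a (f + g :: 'a::ring_1 fls)"
  by (simp add: vanishes_below_def)

lemma vanishes_below_diff:
  "vanishes_below a f \<Longrightarrow> vanishes_below a g \<Longrightarrow> vanishes_below a (f - g :: 'a::ring_1 fls)"
  by (simp add: vanishes_below_def)

lemma vanishes_below_uminus: "vanishes_below a f \<Longrightarrow> vanishes_below a (- f :: 'a::ring_1 fls)"
  by (simp add: vanishes_below_def)

lemma vanishes_below_scaleC:
  "vanishes_below a f \<Longrightarrow> vanishes_below a (c *\<^sub>C f :: 'a::complex_algebra_1 fls)"
  by (simp add: vanishes_below_def)

lemma vanishes_below_sum:
  "(\<And>i. i \<in> A \<Longrightarrow> vanishes_below a (f i)) \<Longrightarrow> vanishes_below a (\<Sum>i\<in>A. f i :: 'a::ring_1 fls)"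
  by (simp add: vanishes_below_def fls_nth_sum)

lemma fls_nth_mult:
  fixes f g :: "'a::ring_1 fls"
  assumes "vanishes_below a f" "vanishes_below b g"
  shows "fls_nth (f * g) n = (\<Sum>i=a..n-b. fls_nth f i * fls_nth g (n - i))"
proof (cases "f = 0 \<or> g = 0")
  case False
  have le: "a \<le> fls_subdegree f" "b \<le> fls_subdegree g"
    using assms False
    by (meson fls_subdegree_geI vanishes_below_def)+
  show ?thesis
    unfolding fls_times_nth(2)
    by (rule sum.mono_neutral_left) (use le in auto)
qed auto

lemma vanishes_below_mult:
  fixes f g :: "'a::ring_1 fls"
  assumes "vanishes_below a f" "vanishes_below b g"
  shows "vanishes_below (a + b) (f * g)"
  unfolding vanishes_below_def by (auto simp: fls_nth_mult[OF assms])

lemma vanishes_below_power: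
  fixes x :: "'a::ring_1 fls"
  shows "vanishes_below 1 x \<Longrightarrow> vanishes_below (int j) (x ^ j)"
  by (induction j)
    (auto simp: vanishes_below_1 add.commute intro: vanishes_below_mult[of 1 _ "int j" for j, simplified])

lemma vanishes_below_eqI:
  fixes f g :: "'a::ring_1 fls"
  assumes "\<And>K::nat. vanishes_below (int K + b) (f - g)"
  shows "f = g"
proof (rule fls_eqI)
  fix n
  have "n < int (nat (n - b + 1)) + b" by linarith
  with assms[of "nat (n - b + 1)"] show "fls_nth f n = fls_nth g n"
    by (simp add: vanishes_below_def)
qed


subsection \<open>Substitution into power series\<close>

lemma fps_apply_nth:
  assumes "vanishes_below 1 x" "nat n \<le> K"
  shows "fls_nth (fps_apply F x) n = (\<Sum>j\<le>K. fps_nth F j *\<^sub>C fls_nth (x ^ j) n)"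
proof -
  have z: "fls_nth (x ^ j) n = 0" if "n < int j" for j
    using vanishes_below_power[OF assms(1)] that by (auto simp: vanishes_below_def)
  have "(\<Sum>j\<le>nat n. fps_nth F j *\<^sub>C fls_nth (x ^ j) n) = (\<Sum>j\<le>K. fps_nth F j *\<^sub>C fls_nth (x ^ j) n)"
    by (rule sum.mono_neutral_left) (use assms(2) z in auto)
  thus ?thesis
    unfolding fps_apply_def using z by (cases "n < 0") auto
qed

lemma vanishes_below_fps_apply_0: "vanishes_below 0 (fps_apply F x)"
  by (simp add: fps_apply_def vanishes_below_def)

lemma vanishes_below_fps_apply:
  assumes "vanishes_below 1 x" "fps_nth F 0 = 0"
  shows "vanishes_below 1 (fps_apply F x)"
  unfolding vanishes_below_def
proof (intro allI impI)
  fix n :: int assume "n < 1"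
  thus "fls_nth (fps_apply F x) n = 0"
    using fps_apply_nth[OF assms(1), of n 0 F] assms(2) by simp
qed

lemma fps_apply_approx:
  assumes "vanishes_below 1 x"
  shows "vanishes_below (int K + 1) (fps_apply F x - (\<Sum>j\<le>K. fps_nth F j *\<^sub>C x ^ j))"
  unfolding vanishes_below_def
  by (auto simp: fps_apply_nth[OF assms, of _ K] fls_nth_sum)

text \<open>A linear map that lowers degrees by at most a constant is determined on \<open>F(x)\<close> by its values on
  the powers of \<open>x\<close>, since each coefficient of \<open>F(x)\<close> sees only finitely many powers. This plays
  the role of continuity.\<close>

definition filtered_linear :: "('a::complex_algebra_1 fls \<Rightarrow> 'b::complex_algebra_1 fls) \<Rightarrow> bool" where
  "filtered_linear T \<longleftrightarrow> (\<forall>f g. T (f + g) = T f + T g) \<and> (\<forall>c f. T (c *\<^sub>C f) = c *\<^sub>C T f) \<and>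
     (\<exists>b. \<forall>a f. vanishes_below a f \<longrightarrow> vanishes_below (a + b) (T f))"

lemma filtered_linear_approx:
  fixes T :: "'a::complex_algebra_1 fls \<Rightarrow> 'b::complex_algebra_1 fls"
  assumes T: "filtered_linear T"
  shows "\<exists>b. \<forall>F x K. vanishes_below 1 x \<longrightarrow>
    vanishes_below (int K + b) (T (fps_apply F x) - (\<Sum>j\<le>K. fps_nth F j *\<^sub>C T (x ^ j)))"
proof -
  from T obtain b where add: "\<And>f g. T (f + g) = T f + T g" and scale: "\<And>c f. T (c *\<^sub>C f) = c *\<^sub>C T f"
    and b: "\<And>a f. vanishes_below a f \<Longrightarrow> vanishes_below (a + b) (T f)"
    unfolding filtered_linear_def by blast
  have zero: "T 0 = 0" using add[of 0 0] by simp
  have diff: "T (f - g) = T f - T g" for f g using add[of "f - g" g] by (simp add: algebra_simps)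
  have sum: "T (\<Sum>i\<in>A. f i) = (\<Sum>i\<in>A. T (f i))" for f and A :: "nat set"
    by (induction A rule: infinite_finite_induct) (simp_all add: zero add)
  show ?thesis
  proof (intro exI[of _ "1 + b"] allI impI)
    fix F K and x :: "'a fls" assume "vanishes_below 1 x"
    from b[OF fps_apply_approx[OF this]]
    show "vanishes_below (int K + (1 + b)) (T (fps_apply F x) - (\<Sum>j\<le>K. fps_nth F j *\<^sub>C T (x ^ j)))"
      by (simp add: diff sum scale add.assoc)
  qed
qed

text \<open>All commutation rules and homomorphism properties of substitutions come from this lemma: the
  corresponding statement about powers is purely algebraic.\<close>

lemma fps_apply_transport:
  assumes T: "filtered_linear T" "filtered_linear T'" and x: "vanishes_below 1 x" "vanishes_below 1 x'"
    and eq: "\<And>j. T (x ^ j) = T' (x' ^ j)"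
  shows "T (fps_apply F x) = T' (fps_apply F x')"
proof -
  from filtered_linear_approx[OF T(1)] obtain b where
    b: "\<And>K. vanishes_below (int K + b) (T (fps_apply F x) - (\<Sum>j\<le>K. fps_nth F j *\<^sub>C T (x ^ j)))"
    using x by blast
  from filtered_linear_approx[OF T(2)] obtain b' where
    b': "\<And>K. vanishes_below (int K + b') (T' (fps_apply F x') - (\<Sum>j\<le>K. fps_nth F j *\<^sub>C T' (x' ^ j)))"
    using x by blast
  show ?thesis
  proof (rule vanishes_below_eqI[of "min b b'"])
    fix K
    have "vanishes_below (int K + min b b')
        ((T (fps_apply F x) - (\<Sum>j\<le>K. fps_nth F j *\<^sub>C T (x ^ j)))
        - (T' (fps_apply F x') - (\<Sum>j\<le>K. fps_nth F j *\<^sub>C T' (x' ^ j))))"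
      by (intro vanishes_below_diff vanishes_below_mono[OF b] vanishes_below_mono[OF b']) auto
    thus "vanishes_below (int K + min b b') (T (fps_apply F x) - T' (fps_apply F x'))"
      by (simp add: eq)
  qed
qed

lemma filtered_linear_id: "filtered_linear (\<lambda>f. f)"
  unfolding filtered_linear_def by (auto intro!: exI[of _ 0])

lemma filtered_linear_mult_left: "filtered_linear (\<lambda>f. y * f)"
proof -
  obtain b where b: "vanishes_below b y" using vanishes_below_exists by blast
  show ?thesis unfolding filtered_linear_def
    by (auto simp: distrib_left mult_scaleC_right add.commute[of _ b]
        intro!: exI[of _ b] vanishes_below_mult[OF b])
qed

lemma filtered_linear_mult_right: "filtered_linear (\<lambda>f. f * y)"
proof -
  obtain b where b: "vanishes_below b y" using vanishes_below_exists by blast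
  show ?thesis unfolding filtered_linear_def
    by (auto simp: distrib_right mult_scaleC_left intro!: exI[of _ b] vanishes_below_mult[OF _ b])
qed

lemma power_intertwine:
  fixes x :: "'a::monoid_mult"
  assumes "x * y = y * x'" shows "x ^ j * y = y * x' ^ j"
proof (induction j)
  case (Suc j)
  have "x ^ Suc j * y = x * (x ^ j * y)" by (simp add: mult.assoc)
  also have "\<dots> = (x * y) * x' ^ j" by (simp add: Suc mult.assoc)
  also have "\<dots> = y * x' ^ Suc j" by (simp add: assms mult.assoc)
  finally show ?case .
qed simp

lemma fps_apply_intertwine:
  assumes "vanishes_below 1 x" "vanishes_below 1 x'" "x * y = y * x'"
  shows "fps_apply F x * y = y * fps_apply F x'"
  by (rule fps_apply_transport[OF filtered_linear_mult_right filtered_linear_mult_left assms(1,2)])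
    (rule power_intertwine[OF assms(3)])

text \<open>Allowing two different arguments serves both the multiplicativity in the power series (\<open>x = y\<close>)
  and the exponential law. Products \<open>x\<^sup>i y\<^sup>j\<close> with \<open>i + j > K\<close> start above degree \<open>n\<close>, so the
  square of indices may be cut down to the triangle.\<close>

lemma fps_apply_mult_nth:
  assumes x: "vanishes_below 1 x" and y: "vanishes_below 1 y" and K: "nat n \<le> K"
  shows "fls_nth (fps_apply F x * fps_apply G y) n
    = (\<Sum>m\<le>K. \<Sum>i\<le>m. (fps_nth F i * fps_nth G (m - i)) *\<^sub>C fls_nth (x ^ i * y ^ (m - i)) n)"
proof -
  have 0: "vanishes_below 0 (x ^ i)" "vanishes_below 0 (y ^ i)" for i
    using vanishes_below_power[OF x, of i] vanishes_below_power[OF y, of i]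
    by (auto elim: vanishes_below_mono)
  let ?t = "\<lambda>i j. (fps_nth F i * fps_nth G j) *\<^sub>C fls_nth (x ^ i * y ^ j) n"
  have "fls_nth (fps_apply F x * fps_apply G y) n
      = (\<Sum>d=0..n. fls_nth (fps_apply F x) d * fls_nth (fps_apply G y) (n - d))"
    by (simp add: fls_nth_mult[OF vanishes_below_fps_apply_0 vanishes_below_fps_apply_0])
  also have "\<dots> = (\<Sum>d=0..n. (\<Sum>i\<le>K. fps_nth F i *\<^sub>C fls_nth (x ^ i) d)
      * (\<Sum>j\<le>K. fps_nth G j *\<^sub>C fls_nth (y ^ j) (n - d)))"
  proof (intro sum.cong refl)
    fix d assume "d \<in> {0..n}"
    hence "nat d \<le> K" "nat (n - d) \<le> K" using K by auto
    thus "fls_nth (fps_apply F x) d * fls_nth (fps_apply G y) (n - d)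
        = (\<Sum>i\<le>K. fps_nth F i *\<^sub>C fls_nth (x ^ i) d)
        * (\<Sum>j\<le>K. fps_nth G j *\<^sub>C fls_nth (y ^ j) (n - d))"
      by (simp only: fps_apply_nth[OF x] fps_apply_nth[OF y])
  qed
  also have "\<dots> = (\<Sum>d=0..n. \<Sum>i\<le>K. \<Sum>j\<le>K. (fps_nth F i * fps_nth G j) *\<^sub>C
      (fls_nth (x ^ i) d * fls_nth (y ^ j) (n - d)))"
    by (simp add: sum_product mult_scaleC_left mult_scaleC_right scaleC_scaleC mult.commute[of "fps_nth G _"])
  also have "\<dots> = (\<Sum>i\<le>K. \<Sum>j\<le>K. \<Sum>d=0..n. (fps_nth F i * fps_nth G j) *\<^sub>C
      (fls_nth (x ^ i) d * fls_nth (y ^ j) (n - d)))"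
    by (subst sum.swap, rule sum.cong[OF refl], subst sum.swap) (rule refl)
  also have "\<dots> = (\<Sum>i\<le>K. \<Sum>j\<le>K. ?t i j)"
    by (simp add: fls_nth_mult[OF 0] complex_vector.scale_sum_right)
  also have "\<dots> = (\<Sum>(i,j)\<in>{..K}\<times>{..K}. ?t i j)"
    by (simp add: sum.cartesian_product)
  also have "\<dots> = (\<Sum>(i,j)\<in>{(i,j). i + j \<le> K}. ?t i j)"
  proof (rule sum.mono_neutral_right)
    show "\<forall>p\<in>{..K} \<times> {..K} - {(i,j). i + j \<le> K}. (case p of (i, j) \<Rightarrow> ?t i j) = 0"
    proof
      fix p assume "p \<in> {..K} \<times> {..K} - {(i,j). i + j \<le> K}"
      then obtain i j where p: "p = (i, j)" and "K < i + j" by auto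
      have "vanishes_below (int i + int j) (x ^ i * y ^ j)"
        by (intro vanishes_below_mult vanishes_below_power x y)
      moreover have "n < int i + int j" using K \<open>K < i + j\<close> by linarith
      ultimately show "(case p of (i, j) \<Rightarrow> ?t i j) = 0" by (simp add: p vanishes_below_def)
    qed
  qed auto
  also have "\<dots> = (\<Sum>m\<le>K. \<Sum>i\<le>m. ?t i (m - i))"
    by (rule sum.triangle_reindex_eq)
  finally show ?thesis .
qed

lemma fps_apply_mult:
  assumes x: "vanishes_below 1 x"
  shows "fps_apply (F * G) x = fps_apply F x * fps_apply G x"
proof (rule fls_eqI)
  fix n
  show "fls_nth (fps_apply (F * G) x) n = fls_nth (fps_apply F x * fps_apply G x) n"
    unfolding fps_apply_mult_nth[OF x x order.refl] fps_apply_nth[OF x order.refl]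
    by (intro sum.cong refl)
      (simp add: fps_mult_nth complex_vector.scale_sum_left atLeast0AtMost flip: power_add)
qed

lemma fps_apply_1: "vanishes_below 1 x \<Longrightarrow> fps_apply 1 x = 1"
  by (rule fls_eqI) (auto simp: fps_apply_nth[OF _ order.refl] scaleC_one sum.delta
      if_distrib[of "\<lambda>c. c *\<^sub>C _"] cong: if_cong)

lemma fps_apply_X: "vanishes_below 1 x \<Longrightarrow> fps_apply fps_X x = x"
proof (rule fls_eqI)
  fix n assume x: "vanishes_below 1 x"
  show "fls_nth (fps_apply fps_X x) n = fls_nth x n"
    by (subst fps_apply_nth[OF x, of _ "Suc (nat n)"])
      (auto simp: fps_X_nth scaleC_one sum.delta if_distrib[of "\<lambda>c. c *\<^sub>C _"] cong: if_cong)
qed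

lemma fps_apply_add: "vanishes_below 1 x \<Longrightarrow> fps_apply (F + G) x = fps_apply F x + fps_apply G x"
  by (rule fls_eqI) (simp add: fps_apply_nth[OF _ order.refl] scaleC_add_left sum.distrib)

lemma fps_apply_power: "vanishes_below 1 x \<Longrightarrow> fps_apply (F ^ j) x = fps_apply F x ^ j"
  by (induction j) (simp_all add: fps_apply_1 fps_apply_mult)

lemma fps_apply_compose:
  assumes x: "vanishes_below 1 x" and G: "fps_nth G 0 = 0"
  shows "fps_apply F (fps_apply G x) = fps_apply (F oo G) x"
proof (rule fls_eqI)
  fix n
  let ?K = "nat n"
  have "fls_nth (fps_apply F (fps_apply G x)) n
      = (\<Sum>j\<le>?K. fps_nth F j *\<^sub>C (\<Sum>i\<le>?K. fps_nth (G ^ j) i *\<^sub>C fls_nth (x ^ i) n))"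
    unfolding fps_apply_nth[OF vanishes_below_fps_apply[OF x G] order.refl]
      fps_apply_power[OF x, symmetric] fps_apply_nth[OF x order.refl] ..
  also have "\<dots> = (\<Sum>i\<le>?K. (\<Sum>j\<le>?K. fps_nth F j * fps_nth (G ^ j) i) *\<^sub>C fls_nth (x ^ i) n)"
    unfolding complex_vector.scale_sum_right scaleC_scaleC complex_vector.scale_sum_left
    by (rule sum.swap)
  also have "\<dots> = (\<Sum>i\<le>?K. fps_nth (F oo G) i *\<^sub>C fls_nth (x ^ i) n)"
  proof (intro sum.cong refl arg_cong2[of _ _ _ _ scaleC])
    fix i assume "i \<in> {..?K}"
    thus "(\<Sum>j\<le>?K. fps_nth F j * fps_nth (G ^ j) i) = fps_nth (F oo G) i"
      unfolding fps_compose_nth atLeast0AtMost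
      by (intro sum.mono_neutral_right) (auto simp: startsby_zero_power_prefix[OF G])
  qed
  also have "\<dots> = fls_nth (fps_apply (F oo G) x) n"
    by (rule fps_apply_nth[OF x order.refl, symmetric])
  finally show "fls_nth (fps_apply F (fps_apply G x)) n = fls_nth (fps_apply (F oo G) x) n" .
qed


subsection \<open>Exponentials\<close>

lemma exp_ln1p:
  assumes x: "vanishes_below 1 x"
  shows "exp_hat (ln1p_hat x) = 1 + x"
proof -
  have "fps_exp 1 oo fps_ln (1::complex) = 1 + fps_X"
    using fps_inv_fps_exp_compose(2)[of "1::complex"]
    by (simp add: fps_ln_fps_exp_inv fps_compose_sub_distrib diff_eq_eq add.commute)
  thus ?thesis
    by (simp add: exp_hat_def ln1p_hat_def fps_apply_compose[OF x] fps_apply_add[OF x]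
        fps_apply_1[OF x] fps_apply_X[OF x])
qed

lemma exp_hat_0: "exp_hat 0 = 1"
proof (rule fls_eqI)
  fix n :: int
  have "(\<Sum>j\<le>nat n. fps_nth (fps_exp 1) j *\<^sub>C fls_nth ((0::'a fls) ^ j) n)
      = (\<Sum>j\<in>{0}. fps_nth (fps_exp 1) j *\<^sub>C fls_nth ((0::'a fls) ^ j) n)"
    by (rule sum.mono_neutral_right) (auto simp: power_0_left)
  thus "fls_nth (exp_hat (0::'a fls)) n = fls_nth 1 n"
    unfolding exp_hat_def by (subst fps_apply_nth[OF _ order.refl]) (auto simp: scaleC_one)
qed

text \<open>The binomial theorem for two commuting elements of a noncommutative algebra, in divided powers.
  It follows from \<open>z z\<^sup>k / k! = (k + 1) z\<^sup>k\<^sup>+\<^sup>1 / (k + 1)!\<close>, applied to \<open>x + y\<close>, \<open>x\<close> and \<open>y\<close>.\<close>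

lemma divided_power_add:
  fixes x y :: "'a::complex_algebra_1"
  assumes comm: "x * y = y * x"
  defines "s \<equiv> \<lambda>(x::'a) n. (1 / fact n) *\<^sub>C x ^ n"
  shows "s (x + y) n = (\<Sum>i\<le>n. s x i * s y (n - i))"
proof (induction n)
  case 0
  show ?case by (simp add: s_def scaleC_one)
next
  case (Suc n)
  have step: "z * s z k = of_nat (Suc k) *\<^sub>C s z (Suc k)" for z k
    by (simp add: s_def mult_scaleC_right scaleC_scaleC del: of_nat_Suc)
  have ys: "y * s x i = s x i * y" for i
    using power_intertwine[OF comm, of i] by (simp add: s_def mult_scaleC_left mult_scaleC_right)
  have "of_nat (Suc n) *\<^sub>C s (x + y) (Suc n) = (x + y) * s (x + y) n"
    by (simp only: step)
  also have "\<dots> = (\<Sum>i\<le>n. (x * s x i) * s y (n - i)) + (\<Sum>i\<le>n. s x i * (y * s y (n - i)))"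
    by (simp add: Suc distrib_right sum_distrib_left sum.distrib mult.assoc[symmetric] ys)
  also have "(\<Sum>i\<le>n. (x * s x i) * s y (n - i))
      = (\<Sum>i\<le>Suc n. of_nat i *\<^sub>C (s x i * s y (Suc n - i)))"
    by (subst sum.atMost_Suc_shift) (simp add: step mult_scaleC_left del: of_nat_Suc)
  also have "(\<Sum>i\<le>n. s x i * (y * s y (n - i)))
      = (\<Sum>i\<le>Suc n. of_nat (Suc n - i) *\<^sub>C (s x i * s y (Suc n - i)))"
    by (simp add: step mult_scaleC_right Suc_diff_le del: of_nat_Suc of_nat_diff cong: sum.cong_simp)
  also have "(\<Sum>i\<le>Suc n. of_nat i *\<^sub>C (s x i * s y (Suc n - i))) + \<dots>
      = of_nat (Suc n) *\<^sub>C (\<Sum>i\<le>Suc n. s x i * s y (Suc n - i))"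
    unfolding complex_vector.scale_sum_right sum.distrib[symmetric]
    by (intro sum.cong refl) (simp add: of_nat_diff scaleC_add_left[symmetric])
  finally show ?case
    by (metis complex_vector.scale_left_imp_eq of_nat_eq_0_iff nat.distinct(2))
qed

lemma exp_hat_add:
  assumes x: "vanishes_below 1 x" and y: "vanishes_below 1 y" and comm: "x * y = y * x"
  shows "exp_hat (x + y) = exp_hat x * exp_hat y"
proof (rule fls_eqI)
  fix n
  have "fls_nth (exp_hat (x + y)) n = (\<Sum>m\<le>nat n. fls_nth ((1 / fact m) *\<^sub>C (x + y) ^ m) n)"
    unfolding exp_hat_def fps_apply_nth[OF vanishes_below_add[OF x y] order.refl] by simp
  also have "\<dots> = fls_nth (exp_hat x * exp_hat y) n"
    unfolding exp_hat_def fps_apply_mult_nth[OF x y order.refl] divided_power_add[OF comm]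
    by (simp add: fls_nth_sum mult_scaleC_left mult_scaleC_right scaleC_scaleC mult.commute)
  finally show "fls_nth (exp_hat (x + y)) n = fls_nth (exp_hat x * exp_hat y) n" .
qed

lemma exp_hat_uminus:
  assumes x: "vanishes_below 1 x"
  shows "exp_hat x * exp_hat (- x) = 1" "exp_hat (- x) * exp_hat x = 1"
  using exp_hat_add[OF x vanishes_below_uminus[OF x]] exp_hat_add[OF vanishes_below_uminus[OF x] x]
  by (simp_all add: exp_hat_0)

text \<open>The formula \<open>e\<^sup>x y e\<^sup>-\<^sup>x = y + [x,y] + [x,[x,y]]/2\<close> when the triple bracket vanishes. Third order is
  exactly what conjugation by the extension factors of the twist needs.\<close>

lemma exp_hat_conjugate:
  assumes x: "vanishes_below 1 x"
    and y: "x * y = y * x + z" and z: "x * z = z * x + w" and w: "x * w = w * x"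
  shows "exp_hat x * y = (y + z + (1/2) *\<^sub>C w) * exp_hat x"
proof -
  \<comment> \<open>Moving \<open>y\<close> across the divided powers of \<open>x\<close> costs one divided power per bracket.\<close>
  define s :: "nat \<Rightarrow> 'a fls" where "s n = (1 / fact n) *\<^sub>C x ^ n" for n
  have step: "x * s n = of_nat (Suc n) *\<^sub>C s (Suc n)" for n
    by (simp add: s_def mult_scaleC_right scaleC_scaleC del: of_nat_Suc)
  have comm: "s n * x = x * s n" for n
    by (simp add: s_def mult_scaleC_left mult_scaleC_right power_commutes)
  have cancel: "a = b" if "of_nat (Suc n) *\<^sub>C a = of_nat (Suc n) *\<^sub>C b" for a b :: "'a fls" and n
    using that by (metis complex_vector.scale_left_imp_eq of_nat_eq_0_iff nat.distinct(2))
  have sw: "s n * w = w * s n" for n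
    using power_intertwine[OF w] by (simp add: s_def mult_scaleC_left mult_scaleC_right)
  have s0: "s 0 = 1" and s1: "s (Suc 0) = x" by (simp_all add: s_def scaleC_one)
  have two: "2 *\<^sub>C v = v + v" for v :: "'a fls"
    using scaleC_add_left[of 1 1 v] by (simp add: scaleC_one)
  have sz: "s (Suc n) * z = z * s (Suc n) + w * s n" for n
  proof (induction n)
    case 0
    show ?case by (simp add: s0 s1 z)
  next
    case (Suc n)
    have "of_nat (Suc (Suc n)) *\<^sub>C (s (Suc (Suc n)) * z) = x * (s (Suc n) * z)"
      by (simp add: mult.assoc[symmetric] step mult_scaleC_left del: of_nat_Suc)
    also have "\<dots> = z * (x * s (Suc n)) + w * s (Suc n) + w * (x * s n)"
      by (simp add: Suc distrib_left mult.assoc[symmetric] z w distrib_right)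
    also have "\<dots> = of_nat (Suc (Suc n)) *\<^sub>C (z * s (Suc (Suc n)) + w * s (Suc n))"
      unfolding step mult_scaleC_right scaleC_add_right
      by (simp add: scaleC_add_left scaleC_one algebra_simps two)
    finally show ?case by (rule cancel)
  qed
  have sy: "s (Suc (Suc n)) * y = y * s (Suc (Suc n)) + z * s (Suc n) + (1/2) *\<^sub>C (w * s n)" for n
  proof (induction n)
    case 0
    have "of_nat (Suc (Suc 0)) *\<^sub>C (s (Suc (Suc 0)) * y) = x * (x * y)"
      by (simp only: mult.assoc[symmetric] step[symmetric] mult_scaleC_left[symmetric] s1)
    also have "\<dots> = y * (x * x) + (z * x + z * x) + w"
      by (simp add: y z distrib_left mult.assoc[symmetric] distrib_right)
    also have "\<dots> = of_nat (Suc (Suc 0)) *\<^sub>C (y * s (Suc (Suc 0)) + z * s (Suc 0) + (1/2) *\<^sub>C (w * s 0))"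
      unfolding scaleC_add_right mult_scaleC_right[symmetric] step[symmetric] s1 s0
      by (simp add: scaleC_add_left scaleC_one mult_scaleC_right scaleC_scaleC two distrib_left)
    finally show ?case by (rule cancel)
  next
    case (Suc n)
    have "of_nat (Suc (Suc (Suc n))) *\<^sub>C (s (Suc (Suc (Suc n))) * y) = x * (s (Suc (Suc n)) * y)"
      by (simp add: mult.assoc[symmetric] step mult_scaleC_left del: of_nat_Suc)
    also have "\<dots> = y * (x * s (Suc (Suc n))) + z * s (Suc (Suc n)) + z * (x * s (Suc n)) + w * s (Suc n)
        + (1/2) *\<^sub>C (w * (x * s n))"
      by (simp add: Suc distrib_left mult.assoc[symmetric] y z w distrib_right mult_scaleC_right)
    also have "\<dots> = of_nat (Suc (Suc (Suc n))) *\<^sub>C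
        (y * s (Suc (Suc (Suc n))) + z * s (Suc (Suc n)) + (1/2) *\<^sub>C (w * s (Suc n)))"
    proof -
      have half: "(a + 2) *\<^sub>C (1/2) *\<^sub>C v = v + (1/2) *\<^sub>C a *\<^sub>C v" for a and v :: "'a fls"
        by (simp add: add_divide_distrib scaleC_add_left scaleC_scaleC scaleC_one)
      have e: "of_nat (Suc (Suc (Suc n))) = (of_nat (Suc n) + 2 :: complex)"
        "of_nat (Suc (Suc (Suc n))) = (of_nat (Suc (Suc n)) + 1 :: complex)" by simp_all
      show ?thesis
        unfolding step mult_scaleC_right scaleC_add_right
        unfolding e(1) half unfolding e(1)[symmetric] unfolding e(2) scaleC_add_left scaleC_one
        by (simp only: ac_simps)
    qed
    finally show ?case by (rule cancel)
  qed
  have sums: "(\<Sum>j\<le>Suc (Suc K). s j * y)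
      = y * (\<Sum>j\<le>Suc (Suc K). s j) + z * (\<Sum>j\<le>Suc K. s j) + (1/2) *\<^sub>C (w * (\<Sum>j\<le>K. s j))" for K
  proof (induction K)
    case 0
    show ?case using sy[of 0] by (simp add: s0 s1 y distrib_left algebra_simps)
  next
    case (Suc K)
    show ?case
      unfolding sum.atMost_Suc[of _ "Suc (Suc K)"] Suc sy
      unfolding sum.atMost_Suc[of _ "Suc K"] sum.atMost_Suc[of _ K]
      by (simp add: distrib_left scaleC_add_right algebra_simps)
  qed
  have e: "(\<Sum>j\<le>K. fps_nth (fps_exp 1) j *\<^sub>C x ^ j) = (\<Sum>j\<le>K. s j)" for K
    by (simp add: s_def)
  \<comment> \<open>Cutting the three copies of the series at \<open>K + 2\<close>, \<open>K + 1\<close> and \<open>K\<close> makes \<open>sums\<close> exact, so the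
    two sides agree up to terms of degree above \<open>K\<close> plus a constant.\<close>
  define X where "X = exp_hat x"
  have approx: "vanishes_below (int K + 1) (X - (\<Sum>j\<le>K. s j))" for K
    using fps_apply_approx[OF x, of K "fps_exp 1"] unfolding e X_def exp_hat_def .
  obtain c where c: "vanishes_below c y" "vanishes_below c z" "vanishes_below c w"
  proof -
    obtain a1 a2 a3 where "vanishes_below a1 y" "vanishes_below a2 z" "vanishes_below a3 w"
      using vanishes_below_exists by metis
    thus ?thesis
      by (intro that[of "min a1 (min a2 a3)"]) (auto elim: vanishes_below_mono)
  qed
  show ?thesis
    unfolding X_def[symmetric]
  proof (rule vanishes_below_eqI[of "c + 1"])
    fix K
    have 1: "vanishes_below (int K + (c + 1)) ((X - (\<Sum>j\<le>Suc (Suc K). s j)) * y)"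
      by (rule vanishes_below_mono[OF vanishes_below_mult[OF approx c(1)]]) simp
    have 2: "vanishes_below (int K + (c + 1)) (v * (X - (\<Sum>j\<le>K'. s j)))"
      if "vanishes_below c v" "K \<le> K'" for v K'
      by (rule vanishes_below_mono[OF vanishes_below_mult[OF that(1) approx]]) (use that in simp)
    have "vanishes_below (int K + (c + 1)) ((X - (\<Sum>j\<le>Suc (Suc K). s j)) * y
        - y * (X - (\<Sum>j\<le>Suc (Suc K). s j)) - z * (X - (\<Sum>j\<le>Suc K. s j))
        - (1/2) *\<^sub>C (w * (X - (\<Sum>j\<le>K. s j))))"
      by (intro vanishes_below_diff vanishes_below_scaleC 1 2 c) auto
    also have "((X - (\<Sum>j\<le>Suc (Suc K). s j)) * y
        - y * (X - (\<Sum>j\<le>Suc (Suc K). s j)) - z * (X - (\<Sum>j\<le>Suc K. s j))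
        - (1/2) *\<^sub>C (w * (X - (\<Sum>j\<le>K. s j)))) = X * y - (y + z + (1/2) *\<^sub>C w) * X"
    proof -
      define S2 S1 S0 where "S2 = (\<Sum>j\<le>Suc (Suc K). s j)" and "S1 = (\<Sum>j\<le>Suc K. s j)"
        and "S0 = (\<Sum>j\<le>K. s j)"
      have "S2 * y = y * S2 + z * S1 + (1/2) *\<^sub>C (w * S0)"
        using sums[of K] unfolding sum_distrib_right[symmetric] S2_def S1_def S0_def .
      thus ?thesis
        unfolding S2_def[symmetric] S1_def[symmetric] S0_def[symmetric] left_diff_distrib right_diff_distrib
          complex_vector.scale_right_diff_distrib distrib_right mult_scaleC_left
        by (simp add: algebra_simps)
    qed
    finally show "vanishes_below (int K + (c + 1)) (X * y - (y + z + (1/2) *\<^sub>C w) * X)" .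
  qed
qed


subsection \<open>Algebra homomorphisms, and subalgebras closed under substitution\<close>

definition algebra_hom :: "('a::complex_algebra_1 \<Rightarrow> 'b::complex_algebra_1) \<Rightarrow> bool" where
  "algebra_hom h \<longleftrightarrow> (\<forall>x y. h (x + y) = h x + h y) \<and> (\<forall>x y. h (x * y) = h x * h y) \<and>
     (\<forall>c x. h (c *\<^sub>C x) = c *\<^sub>C h x) \<and> h 1 = 1"

lemma algebra_homD:
  assumes "algebra_hom h"
  shows "h (x + y) = h x + h y" "h (x * y) = h x * h y" "h (c *\<^sub>C x) = c *\<^sub>C h x" "h 1 = 1"
    "h 0 = 0" "h (- x) = - h x" "h (x - y) = h x - h y" "h (\<Sum>i\<in>A. f i) = (\<Sum>i\<in>A. h (f i))"
    "h (x ^ n) = h x ^ n"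
proof -
  show add: "h (x + y) = h x + h y" and mult: "h (x * y) = h x * h y"
    and scale: "h (c *\<^sub>C x) = c *\<^sub>C h x" and one: "h 1 = 1" for x y c
    using assms by (simp_all add: algebra_hom_def)
  show zero: "h 0 = 0" using add[of 0 0] by simp
  show neg: "h (- x) = - h x" for x
    using add[of x "- x"] zero by (simp add: eq_neg_iff_add_eq_0 add.commute)
  show "h (x - y) = h x - h y" using add[of x "- y"] neg[of y] by simp
  show "h (\<Sum>i\<in>A. f i) = (\<Sum>i\<in>A. h (f i))"
    by (induction A rule: infinite_finite_induct) (simp_all add: zero add)
  show "h (x ^ n) = h x ^ n" by (induction n) (simp_all add: one mult)
qed

lemma fls_map_nth:
  assumes "h 0 = 0"
  shows "fls_nth (fls_map h f) n = h (fls_nth f n)"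
proof -
  obtain a where "vanishes_below a f" using vanishes_below_exists by blast
  thus ?thesis
    unfolding fls_map_def
    by (intro nth_Abs_fls_lower_bound[of a]) (simp add: assms vanishes_below_def)
qed

lemma vanishes_below_fls_map: "h 0 = 0 \<Longrightarrow> vanishes_below a f \<Longrightarrow> vanishes_below a (fls_map h f)"
  by (simp add: vanishes_below_def fls_map_nth)

lemma algebra_hom_fls_map:
  assumes h: "algebra_hom h"
  shows "algebra_hom (fls_map h)"
proof -
  note hD = algebra_homD[OF h]
  note nth = fls_map_nth[of h, OF hD(5)]
  have "fls_map h (f * g) = fls_map h f * fls_map h g" for f g
  proof (rule fls_eqI)
    fix n
    obtain a b where ab: "vanishes_below a f" "vanishes_below b g"
      using vanishes_below_exists by metis
    note ab' = ab[THEN vanishes_below_fls_map[of h, OF hD(5)]]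
    show "fls_nth (fls_map h (f * g)) n = fls_nth (fls_map h f * fls_map h g) n"
      by (simp add: nth fls_nth_mult[OF ab] fls_nth_mult[OF ab'] hD)
  qed
  thus ?thesis
    unfolding algebra_hom_def
    by (auto intro!: fls_eqI simp: nth hD)
qed

lemma filtered_linear_fls_map:
  assumes h: "algebra_hom h"
  shows "filtered_linear (fls_map h)"
  unfolding filtered_linear_def
  using algebra_homD[OF algebra_hom_fls_map[OF h]] vanishes_below_fls_map[of h, OF algebra_homD(5)[OF h]]
  by (auto intro!: exI[of _ 0])

lemma fls_map_fps_apply:
  assumes h: "algebra_hom h" and x: "vanishes_below 1 x"
  shows "fls_map h (fps_apply F x) = fps_apply F (fls_map h x)"
  by (rule fps_apply_transport[OF filtered_linear_fls_map[OF h] filtered_linear_id x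
        vanishes_below_fls_map[of h, OF algebra_homD(5)[OF h] x]])
    (rule algebra_homD(9)[OF algebra_hom_fls_map[OF h]])

text \<open>The smallest subalgebra closed under substitution into power series. It is a convenient substitute
  for a topological closure: the elements of the chain lie in such closures of \<open>so(M - 2m)\<close> or of its
  two tensor legs, and membership in a centralizer or in the graded completion is inherited from the generators.\<close>

inductive_set series_closure :: "'a::complex_algebra_1 fls set \<Rightarrow> 'a fls set"
  for S :: "'a fls set" where
  base: "x \<in> S \<Longrightarrow> x \<in> series_closure S"
| one: "1 \<in> series_closure S"
| add: "x \<in> series_closure S \<Longrightarrow> y \<in> series_closure S \<Longrightarrow> x + y \<in> series_closure S"
| mult: "x \<in> series_closure S \<Longrightarrow> y \<in> series_closure S \<Longrightarrow> x * y \<in> series_closure S"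
| scale: "x \<in> series_closure S \<Longrightarrow> c *\<^sub>C x \<in> series_closure S"
| apply_fps: "x \<in> series_closure S \<Longrightarrow> vanishes_below 1 x \<Longrightarrow> fps_apply F x \<in> series_closure S"

lemma series_closure_zero: "0 \<in> series_closure S"
  using series_closure.scale[OF series_closure.one, of 0] by simp

lemma series_closure_uminus: "x \<in> series_closure S \<Longrightarrow> - x \<in> series_closure S"
  using series_closure.scale[of x S "-1"] by (simp add: scaleC_one)

lemma series_closure_diff:
  "x \<in> series_closure S \<Longrightarrow> y \<in> series_closure S \<Longrightarrow> x - y \<in> series_closure S"
  using series_closure.add[of x S "- y"] series_closure_uminus[of y S] by simp

lemma series_closure_sum:
  "(\<And>i. i \<in> A \<Longrightarrow> f i \<in> series_closure S) \<Longrightarrow> (\<Sum>i\<in>A. f i) \<in> series_closure S"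
  by (induction A rule: infinite_finite_induct) (auto intro: series_closure_zero series_closure.add)

lemma series_closure_subset:
  assumes "S \<subseteq> series_closure S'" shows "series_closure S \<subseteq> series_closure S'"
proof
  fix x assume "x \<in> series_closure S"
  thus "x \<in> series_closure S'"
    by induction (use assms in \<open>auto intro: series_closure.intros\<close>)
qed

lemma series_closure_mono: "S \<subseteq> S' \<Longrightarrow> series_closure S \<subseteq> series_closure S'"
  by (rule series_closure_subset) (auto intro: series_closure.base)

lemma series_closure_commute:
  assumes "\<And>s. s \<in> S \<Longrightarrow> s * y = y * s" and "x \<in> series_closure S"
  shows "x * y = y * x"
  using assms(2)
proof induction
  case (mult x x')
  thus ?case by (metis mult.assoc)
next
  case (apply_fps x F)
  thus ?case using fps_apply_intertwine[of x x y F] by simp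
qed (auto simp: assms(1) distrib_left distrib_right mult_scaleC_left mult_scaleC_right)

lemma series_closure_fls_map:
  assumes h: "algebra_hom h" and "x \<in> series_closure S"
  shows "fls_map h x \<in> series_closure (fls_map h ` S)"
  using assms(2)
proof induction
  case (apply_fps x F)
  thus ?case
    by (simp add: fls_map_fps_apply[OF h] series_closure.apply_fps vanishes_below_fls_map
        algebra_homD(5)[OF h])
qed (auto simp: algebra_homD[OF algebra_hom_fls_map[OF h]] intro: series_closure.intros)

section \<open>The enveloping algebra, its coproduct, and the legs of the tensor square\<close>

lemma coproduct_uea_of: "coproduct (uea_of x) = uea_of x \<otimes> 1 + 1 \<otimes> uea_of x"
  by transfer' (simp add: scaleC_one)

lemma algebra_hom_coproduct: "algebra_hom coproduct"
proof -
  let ?d = "\<lambda>x::'a. uea_of x \<otimes> (1::'a uea) + 1 \<otimes> uea_of x"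
  have m: "prod_list (map ?d (k + l)) = prod_list (map ?d k) * prod_list (map ?d l)" for k l
    by (simp add: plus_list_def)
  show ?thesis
    unfolding algebra_hom_def
  proof (intro conjI allI)
    fix x y :: "'a uea" and c
    show "coproduct (x + y) = coproduct x + coproduct y" by transfer (rule lift_add)
    show "coproduct (x * y) = coproduct x * coproduct y" by transfer (rule lift_mult[OF m])
    show "coproduct (c *\<^sub>C x) = c *\<^sub>C coproduct x"
      by transfer (simp add: lift_mult[OF m] zero_list_def mult_scaleC_left)
    show "coproduct (1 :: 'a uea) = 1" by transfer (simp add: lift_one zero_list_def)
  qed
qed

lemma tensor_one: "1 \<otimes> 1 = 1"
  by transfer (simp add: zero_pure_tensor_def flip: Poly_Mapping.single_one)

definition left_leg :: "'m::enum U_series \<Rightarrow> 'm UU_series" where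
  "left_leg = fls_map (\<lambda>a. a \<otimes> 1)"

definition right_leg :: "'m::enum U_series \<Rightarrow> 'm UU_series" where
  "right_leg = fls_map (\<lambda>b. 1 \<otimes> b)"

lemma algebra_hom_tensor_left: "algebra_hom (\<lambda>a. a \<otimes> 1)"
  by (simp add: algebra_hom_def tensor_add_left tensor_mult tensor_scaleC_left tensor_one)

lemma algebra_hom_tensor_right: "algebra_hom (\<lambda>b. 1 \<otimes> b)"
  by (simp add: algebra_hom_def tensor_add_right tensor_mult tensor_scaleC_right tensor_one)

lemma algebra_hom_left_leg: "algebra_hom left_leg"
  unfolding left_leg_def by (rule algebra_hom_fls_map[OF algebra_hom_tensor_left])

lemma algebra_hom_right_leg: "algebra_hom right_leg"
  unfolding right_leg_def by (rule algebra_hom_fls_map[OF algebra_hom_tensor_right])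

lemma algebra_hom_coproduct_hat: "algebra_hom coproduct_hat"
  unfolding coproduct_hat_def by (rule algebra_hom_fls_map[OF algebra_hom_coproduct])

lemma tensor_hat_legs: "x \<otimes>\<^sub>h y = left_leg x * right_leg y"
  by (simp add: tensor_hat_def left_leg_def right_leg_def)

lemma left_leg_nth: "fls_nth (left_leg x) n = fls_nth x n \<otimes> 1"
  unfolding left_leg_def by (rule fls_map_nth[of "\<lambda>a. a \<otimes> 1", OF algebra_homD(5)[OF algebra_hom_tensor_left]])

lemma right_leg_nth: "fls_nth (right_leg x) n = 1 \<otimes> fls_nth x n"
  unfolding right_leg_def by (rule fls_map_nth[of "\<lambda>b. 1 \<otimes> b", OF algebra_homD(5)[OF algebra_hom_tensor_right]])

lemma coproduct_hat_nth: "fls_nth (coproduct_hat x) n = coproduct (fls_nth x n)"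
  unfolding coproduct_hat_def by (rule fls_map_nth[of coproduct, OF algebra_homD(5)[OF algebra_hom_coproduct]])

lemma vanishes_below_left_leg: "vanishes_below a x \<Longrightarrow> vanishes_below a (left_leg x)"
  unfolding left_leg_def
  by (rule vanishes_below_fls_map[of "\<lambda>a. a \<otimes> 1", OF algebra_homD(5)[OF algebra_hom_tensor_left]])

lemma vanishes_below_right_leg: "vanishes_below a x \<Longrightarrow> vanishes_below a (right_leg x)"
  unfolding right_leg_def
  by (rule vanishes_below_fls_map[of "\<lambda>b. 1 \<otimes> b", OF algebra_homD(5)[OF algebra_hom_tensor_right]])

lemma legs_commute: "right_leg y * left_leg x = left_leg x * right_leg y"
proof (rule fls_eqI)
  fix n
  obtain a where a: "vanishes_below a x" using vanishes_below_exists by blast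
  obtain b where b: "vanishes_below b y" using vanishes_below_exists by blast
  note ab = vanishes_below_left_leg[OF a] vanishes_below_right_leg[OF b]
  have "(\<Sum>i=b..n-a. fls_nth x (n - i) \<otimes> fls_nth y i) = (\<Sum>i=a..n-b. fls_nth x i \<otimes> fls_nth y (n - i))"
    by (rule sum.reindex_bij_witness[of _ "\<lambda>i. n - i" "\<lambda>i. n - i"]) auto
  thus "fls_nth (right_leg y * left_leg x) n = fls_nth (left_leg x * right_leg y) n"
    by (simp add: fls_nth_mult[OF ab] fls_nth_mult[OF ab(2,1)] left_leg_nth right_leg_nth tensor_mult)
qed


section \<open>The Lie algebra: generators, weights, and a faithful representation\<close>

lemma A_so_rep: "i \<in> {1..CARD('m)} \<Longrightarrow> j \<in> {1..CARD('m)} \<Longrightarrow> Rep_so (A_so i j :: 'm::enum so) = A_mat i j"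
  by (simp add: A_so.rep_eq)

lemma so_span_induct:
  fixes x :: "'m::enum so"
  assumes gen: "\<And>i j. i \<in> {1..CARD('m)} \<Longrightarrow> j \<in> {1..CARD('m)} \<Longrightarrow> P (A_so i j)"
    and zero: "P 0" and add: "\<And>x y. P x \<Longrightarrow> P y \<Longrightarrow> P (x + y)" and scale: "\<And>c x. P x \<Longrightarrow> P (c *\<^sub>C x)"
  shows "P x"
proof -
  let ?Q = "\<lambda>X. \<exists>x. Rep_so x = X \<and> P x"
  have "?Q (Rep_so x)"
  proof (rule complex_vector.span_induct[OF Rep_so])
    show "complex_vector.subspace (Collect ?Q)"
    proof (rule complex_vector.subspaceI)
      show "0 \<in> Collect ?Q"
        by (intro CollectI exI[of _ 0] conjI zero zero_so.rep_eq)
    next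
      fix X Y assume "X \<in> Collect ?Q" "Y \<in> Collect ?Q"
      then obtain x y where "Rep_so x = X" "P x" "Rep_so y = Y" "P y" by auto
      thus "X + Y \<in> Collect ?Q"
        by (intro CollectI exI[of _ "x + y"] conjI add) (simp_all add: plus_so.rep_eq)
    next
      fix c X assume "X \<in> Collect ?Q"
      then obtain x where "Rep_so x = X" "P x" by auto
      thus "c *\<^sub>C X \<in> Collect ?Q"
        by (intro CollectI exI[of _ "c *\<^sub>C x"] conjI scale) (simp_all add: scaleC_so.rep_eq)
    qed
  next
    fix X :: "'m sqmat" assume "X \<in> {A_mat i j |i j. i \<in> {1..CARD('m)} \<and> j \<in> {1..CARD('m)}}"
    then obtain i j where ij: "i \<in> {1..CARD('m)}" "j \<in> {1..CARD('m)}" "X = A_mat i j" by blast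
    show "?Q X" by (intro exI[of _ "A_so i j"] conjI gen ij(1,2)) (simp only: ij(3) A_so_rep[OF ij(1,2)])
  qed
  thus ?thesis by (simp add: Rep_so_inject)
qed

lemma A_so_bracket:
  assumes "i \<in> {1..CARD('m)}" "j \<in> {1..CARD('m)}" "k \<in> {1..CARD('m)}" "l \<in> {1..CARD('m)}"
  shows "lie_bracket (A_so i j) (A_so k l :: 'm::enum so) =
      (if j = k then A_so i l else 0) - (if j = CARD('m) + 1 - l then A_so i (CARD('m) + 1 - k) else 0)
      - (if k = CARD('m) + 1 - i then A_so (CARD('m) + 1 - j) l else 0) - (if i = l then A_so k j else 0)"
proof -
  have r: "CARD('m) + 1 - i \<in> {1..CARD('m)}" if "i \<in> {1..CARD('m)}" for i using that by auto
  show ?thesis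
    unfolding Rep_so_inject[symmetric] lie_bracket_so.rep_eq A_so_rep[OF assms(1,2)] A_so_rep[OF assms(3,4)]
      A_mat_bracket[OF assms] minus_so.rep_eq if_distrib[of Rep_so] zero_so.rep_eq
      A_so_rep[OF assms(1,4)] A_so_rep[OF assms(3,2)] A_so_rep[OF assms(1) r[OF assms(3)]]
      A_so_rep[OF r[OF assms(2)] assms(4)] ..
qed

lemma A_so_flip:
  assumes "i \<in> {1..CARD('m)}" "j \<in> {1..CARD('m)}"
  shows "(A_so (CARD('m) + 1 - j) (CARD('m) + 1 - i) :: 'm::enum so) = - A_so i j"
proof -
  have "CARD('m) + 1 - j \<in> {1..CARD('m)}" "CARD('m) + 1 - i \<in> {1..CARD('m)}" using assms by auto
  note r = A_so_rep[OF this] and rr = A_so_rep[OF assms]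
  have "CARD('m) + 1 - (CARD('m) + 1 - i) = i" "CARD('m) + 1 - (CARD('m) + 1 - j) = j"
    using assms by auto
  thus ?thesis
    unfolding Rep_so_inject[symmetric] uminus_so.rep_eq r rr by (simp add: A_mat_def)
qed

lemma lie_bracket_zero: "lie_bracket 0 x = (0::'a::lie_algebra)" "lie_bracket x 0 = (0::'a)"
  using lie_add_left[of 0 0 x] lie_add_right[of x 0 0] by simp_all

lemma lie_bracket_sum_left: "lie_bracket (\<Sum>i\<in>A. f i) x = (\<Sum>i\<in>A. lie_bracket (f i) (x::'a::lie_algebra))"
  by (induction A rule: infinite_finite_induct) (simp_all add: lie_bracket_zero lie_add_left)

lemma lie_bracket_uminus: "lie_bracket (- x) y = - lie_bracket x (y::'a::lie_algebra)"
  "lie_bracket x (- y) = - lie_bracket x y"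
  using lie_scaleC_left[of "-1" x y] lie_scaleC_right[of x "-1" y] by (simp_all add: scaleC_one)

lemma lie_bracket_anti: "lie_bracket y x = - lie_bracket x (y::'a::lie_algebra)"
proof -
  have "lie_bracket y x + lie_bracket x y = 0"
    using lie_alternating[of "x + y"] lie_alternating[of x] lie_alternating[of y]
    by (simp add: lie_add_left lie_add_right)
  thus ?thesis by (simp add: eq_neg_iff_add_eq_0)
qed

text \<open>The degree of the \<open>i\<close>-th basis vector of \<open>\<complex>\<^sup>M\<close>: the \<open>i\<close>-th diagonal entry of the grading element.\<close>

definition so_weight :: "nat \<Rightarrow> nat \<Rightarrow> int" where
  "so_weight M i = (if i \<le> M div 2 then int (M div 2 + 1 - i) else 0)
    - (if M + 1 - i \<le> M div 2 then int (M div 2 + 1 - (M + 1 - i)) else 0)"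

lemma so_weight_less: "1 \<le> i \<Longrightarrow> i < j \<Longrightarrow> j \<le> M \<Longrightarrow> so_weight M j < so_weight M i"
  unfolding so_weight_def by (auto; presburger)

lemma A_so_degree:
  assumes k: "k \<in> {1..CARD('m)}" and l: "l \<in> {1..CARD('m)}"
  shows "(A_so k l :: 'm::enum so) \<in> so_degree (so_weight CARD('m) k - so_weight CARD('m) l)"
proof -
  define M where "M = CARD('m)"
  define N where "N = M div 2"
  note kl = k[folded M_def] l[folded M_def]
  let ?c = "\<lambda>h. of_nat (N + 1 - h) :: complex"
  let ?A = "A_so k l :: 'm so"
  have H: "lie_bracket (of_nat (2 * (N + 1 - h)) *\<^sub>C H_so h) ?A =
      (if h = k then ?c h *\<^sub>C ?A else 0) + (if h = M + 1 - l then ?c h *\<^sub>C ?A else 0)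
      - (if h = M + 1 - k then ?c h *\<^sub>C ?A else 0) - (if h = l then ?c h *\<^sub>C ?A else 0)"
    if h: "h \<in> {1..N}" for h
  proof -
    have hM: "h \<in> {1..CARD('m)}" using h by (auto simp: N_def M_def)
    have "lie_bracket (A_so h h) ?A = (if h = k then ?A else 0) + (if h = M + 1 - l then ?A else 0)
        - (if h = M + 1 - k then ?A else 0) - (if h = l then ?A else 0)"
    proof -
      have e: "(k = M + 1 - h) = (h = M + 1 - k)" using kl h by auto
      have 1: "(if h = k then A_so h l else 0) = (if h = k then ?A else 0)"
        and 4: "(if h = l then A_so k h else 0) = (if h = l then ?A else 0)" by simp_all
      have 2: "(if h = M + 1 - l then A_so h (M + 1 - k) else 0) = (if h = M + 1 - l then - ?A else 0)"
        using A_so_flip[OF k l] by (simp only: M_def split: if_splits) simp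
      have 3: "(if h = M + 1 - k then A_so (M + 1 - h) l else 0) = (if h = M + 1 - k then ?A else 0)"
        using kl by simp
      show ?thesis
        unfolding A_so_bracket[OF hM hM k l] M_def[symmetric] e 1 2 3 4 by simp
    qed
    thus ?thesis
      by (simp add: H_so_def lie_scaleC_left scaleC_scaleC complex_vector.scale_right_distrib
          complex_vector.scale_right_diff_distrib)
  qed
  have d: "(\<Sum>h=1..N. if h = a then ?c h *\<^sub>C ?A else 0) = (if a \<le> N then ?c a else 0) *\<^sub>C ?A"
    if "1 \<le> a" for a
    using that by (simp add: sum.delta)
  have "lie_bracket grading_element ?A = (\<Sum>h=1..N. lie_bracket (of_nat (2 * (N + 1 - h)) *\<^sub>C H_so h) ?A)"
    by (simp add: grading_element_def lie_bracket_sum_left N_def M_def)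
  also have "\<dots> = (\<Sum>h=1..N. (if h = k then ?c h *\<^sub>C ?A else 0) + (if h = M + 1 - l then ?c h *\<^sub>C ?A else 0)
      - (if h = M + 1 - k then ?c h *\<^sub>C ?A else 0) - (if h = l then ?c h *\<^sub>C ?A else 0))"
    by (intro sum.cong refl H)
  also have "\<dots> = ((if k \<le> N then ?c k else 0) + (if M + 1 - l \<le> N then ?c (M + 1 - l) else 0)
      - (if M + 1 - k \<le> N then ?c (M + 1 - k) else 0) - (if l \<le> N then ?c l else 0)) *\<^sub>C ?A"
    using kl d[of k] d[of l] d[of "M + 1 - k"] d[of "M + 1 - l"]
    by (simp only: sum_subtractf sum.distrib scaleC_add_left complex_vector.scale_left_diff_distrib)
      auto
  also have "((if k \<le> N then ?c k else 0) + (if M + 1 - l \<le> N then ?c (M + 1 - l) else 0)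
      - (if M + 1 - k \<le> N then ?c (M + 1 - k) else 0) - (if l \<le> N then ?c l else 0))
      = of_int (so_weight M k - so_weight M l)"
    by (auto simp: so_weight_def N_def)
  finally show ?thesis by (simp add: so_degree_def M_def)
qed

lemma so_degree_bracket:
  assumes "x \<in> so_degree d" "y \<in> so_degree e"
  shows "lie_bracket x y \<in> so_degree (d + e)"
proof -
  let ?g = "grading_element :: 'a so"
  have "lie_bracket ?g (lie_bracket x y) = lie_bracket (lie_bracket ?g x) y + lie_bracket x (lie_bracket ?g y)"
    using lie_jacobi[of ?g x y] lie_bracket_anti[of y ?g] lie_bracket_anti[of y "lie_bracket ?g x"]
    by (simp add: lie_bracket_uminus algebra_simps eq_neg_iff_add_eq_0)
  thus ?thesis
    using assms by (simp add: so_degree_def lie_scaleC_left lie_scaleC_right scaleC_add_left)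
qed

text \<open>Square matrices as an associative algebra: the product on the type of vectors of vectors is the
  componentwise one, hence a copy of that type.\<close>

typedef 'm matrix_algebra = "UNIV :: ('m::finite) sqmat set" ..

setup_lifting type_definition_matrix_algebra

instantiation matrix_algebra :: (finite) complex_algebra_1
begin
lift_definition zero_matrix_algebra :: "'a matrix_algebra" is 0 .
lift_definition one_matrix_algebra :: "'a matrix_algebra" is "mat 1" .
lift_definition plus_matrix_algebra :: "'a matrix_algebra \<Rightarrow> 'a matrix_algebra \<Rightarrow> 'a matrix_algebra" is "(+)" .
lift_definition minus_matrix_algebra :: "'a matrix_algebra \<Rightarrow> 'a matrix_algebra \<Rightarrow> 'a matrix_algebra" is "(-)" .
lift_definition uminus_matrix_algebra :: "'a matrix_algebra \<Rightarrow> 'a matrix_algebra" is uminus .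
lift_definition times_matrix_algebra :: "'a matrix_algebra \<Rightarrow> 'a matrix_algebra \<Rightarrow> 'a matrix_algebra" is "(**)" .
lift_definition scaleC_matrix_algebra :: "complex \<Rightarrow> 'a matrix_algebra \<Rightarrow> 'a matrix_algebra" is scaleC .
instance
proof
  fix a b c :: "'a matrix_algebra" and r t :: complex
  show "(0 :: 'a matrix_algebra) \<noteq> 1" by transfer (simp add: vec_eq_iff mat_def)
  show "a + b + c = a + (b + c)" by transfer (simp add: add.assoc)
  show "a + b = b + a" by transfer (simp add: add.commute)
  show "0 + a = a" "- a + a = 0" "a - b = a + - b" by (transfer; simp)+
  show "a * b * c = a * (b * c)" by transfer (simp add: matrix_mul_assoc)
  show "1 * a = a" "a * 1 = a" by (transfer; simp)+
  show "(a + b) * c = a * c + b * c" "a * (b + c) = a * b + a * c" by (transfer; simp add: matrix_mult_add)+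
  show "r *\<^sub>C (a + b) = r *\<^sub>C a + r *\<^sub>C b" by transfer (rule scaleC_add_right)
  show "(r + t) *\<^sub>C a = r *\<^sub>C a + t *\<^sub>C a" by transfer (rule scaleC_add_left)
  show "r *\<^sub>C t *\<^sub>C a = (r * t) *\<^sub>C a" by transfer (rule scaleC_scaleC)
  show "1 *\<^sub>C a = a" by transfer (rule scaleC_one)
  show "r *\<^sub>C a * b = r *\<^sub>C (a * b)" "a * (r *\<^sub>C b) = r *\<^sub>C (a * b)"
    by (transfer; simp add: scaleC_matrix_mult)+
qed
end

definition so_matrix :: "'m::enum so \<Rightarrow> 'm matrix_algebra" where
  "so_matrix x = Abs_matrix_algebra (Rep_so x)"

lift_definition uea_matrix :: "'m::enum so uea \<Rightarrow> 'm matrix_algebra"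
  is "monoid_algebra_lift (\<lambda>w. prod_list (map so_matrix w))"
  by (rule uea_lift_welldef)
    (simp_all add: so_matrix_def commutator_def plus_so.rep_eq scaleC_so.rep_eq lie_bracket_so.rep_eq
      plus_matrix_algebra.abs_eq scaleC_matrix_algebra.abs_eq times_matrix_algebra.abs_eq
      minus_matrix_algebra.abs_eq eq_onp_def)

text \<open>The enveloping algebra acts on \<open>\<complex>\<^sup>M\<close> by the defining representation, which is faithful on
  \<open>so(M)\<close>; this replaces the Poincare-Birkhoff-Witt theorem.\<close>

lemma inj_uea_of: "inj (uea_of :: 'm::enum so \<Rightarrow> 'm so uea)"
proof
  fix x y :: "'m so" assume "uea_of x = uea_of y"
  moreover have "uea_matrix (uea_of z) = so_matrix z" for z :: "'m so"
    by transfer (simp add: scaleC_one)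
  ultimately have "so_matrix x = so_matrix y" by metis
  thus "x = y" by (simp add: so_matrix_def Abs_matrix_algebra_inject Rep_so_inject)
qed


section \<open>The grading\<close>

text \<open>The common properties of the gradings of \<open>U\<close> and of \<open>U \<otimes> U\<close>.\<close>

definition graded_algebra :: "(int \<Rightarrow> 'a::complex_algebra_1 set) \<Rightarrow> bool" where
  "graded_algebra D \<longleftrightarrow> (\<forall>d. complex_vector.subspace (D d)) \<and> 1 \<in> D 0 \<and>
     (\<forall>d e x y. x \<in> D d \<longrightarrow> y \<in> D e \<longrightarrow> x * y \<in> D (d + e))"

lemma span_mult_closed:
  assumes "\<And>x y. x \<in> S \<Longrightarrow> y \<in> T \<Longrightarrow> x * y \<in> complex_vector.span R"
    and "x \<in> complex_vector.span S" "y \<in> complex_vector.span T"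
  shows "x * (y :: 'a::complex_algebra_1) \<in> complex_vector.span R"
proof -
  have 1: "x * y \<in> complex_vector.span R" if "x \<in> S" for x
    using assms(3)
    by (rule complex_vector.span_induct)
      (auto simp: complex_vector.subspace_def distrib_left mult_scaleC_right complex_vector.span_zero
        intro: complex_vector.span_add complex_vector.span_scale assms(1) that)
  show ?thesis
    using assms(2)
    by (rule complex_vector.span_induct)
      (auto simp: complex_vector.subspace_def distrib_right mult_scaleC_left complex_vector.span_zero
        intro: complex_vector.span_add complex_vector.span_scale 1)
qed

lemma graded_algebra_uea: "graded_algebra (uea_degree :: int \<Rightarrow> 'm::enum so uea set)"
  unfolding graded_algebra_def
proof (intro conjI allI impI)
  fix d :: int
  show "complex_vector.subspace (uea_degree d :: 'm so uea set)"
    by (simp add: uea_degree_def complex_vector.subspace_span)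
next
  show "1 \<in> (uea_degree 0 :: 'm so uea set)"
    unfolding uea_degree_def by (rule complex_vector.span_base) (auto intro!: exI[of _ "[]"])
next
  fix d e and x y :: "'m so uea"
  assume "x \<in> uea_degree d" "y \<in> uea_degree e"
  thus "x * y \<in> uea_degree (d + e)"
    unfolding uea_degree_def
  proof (rule span_mult_closed[rotated])
    fix x y :: "'m so uea"
    assume "x \<in> {prod_list (map (uea_of \<circ> snd) ys) |ys. (\<forall>(e, x)\<in>set ys. x \<in> so_degree e) \<and> sum_list (map fst ys) = d}"
      "y \<in> {prod_list (map (uea_of \<circ> snd) ys) |ys. (\<forall>(e, x)\<in>set ys. x \<in> so_degree e) \<and> sum_list (map fst ys) = e}"
    then obtain xs ys where "x = prod_list (map (uea_of \<circ> snd) xs)" "\<forall>(e, x)\<in>set xs. x \<in> so_degree e"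
      "sum_list (map fst xs) = d" "y = prod_list (map (uea_of \<circ> snd) ys)" "\<forall>(e, x)\<in>set ys. x \<in> so_degree e"
      "sum_list (map fst ys) = e" by auto
    thus "x * y \<in> complex_vector.span {prod_list (map (uea_of \<circ> snd) ys) |ys.
        (\<forall>(e, x)\<in>set ys. x \<in> so_degree e) \<and> sum_list (map fst ys) = d + e}"
      by (intro complex_vector.span_base CollectI exI[of _ "xs @ ys"]) auto
  qed
qed

lemma subspace_uea_degree: "complex_vector.subspace (uea_degree d)"
  by (simp add: uea_degree_def complex_vector.subspace_span)

lemma uea_of_degree: "x \<in> so_degree d \<Longrightarrow> uea_of x \<in> uea_degree d"
  unfolding uea_degree_def by (rule complex_vector.span_base) (auto intro!: exI[of _ "[(d, x)]"])

lemma tensor_degreeI: "a \<in> uea_degree i \<Longrightarrow> b \<in> uea_degree j \<Longrightarrow> a \<otimes> b \<in> tensor_degree (i + j)"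
  unfolding tensor_degree_def by (rule complex_vector.span_base) auto

lemma graded_algebra_tensor: "graded_algebra (tensor_degree :: int \<Rightarrow> ('m::enum so uea, 'm so uea) tensor set)"
  unfolding graded_algebra_def
proof (intro conjI allI impI)
  fix d :: int
  show "complex_vector.subspace (tensor_degree d :: ('m so uea, 'm so uea) tensor set)"
    by (simp add: tensor_degree_def complex_vector.subspace_span)
next
  have "1 \<in> (uea_degree 0 :: 'm so uea set)" using graded_algebra_uea by (auto simp: graded_algebra_def)
  from tensor_degreeI[OF this this] show "1 \<in> (tensor_degree 0 :: ('m so uea, 'm so uea) tensor set)"
    by (simp add: tensor_one)
next
  fix d e and x y :: "('m so uea, 'm so uea) tensor"
  assume "x \<in> tensor_degree d" "y \<in> tensor_degree e"
  thus "x * y \<in> tensor_degree (d + e)"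
    unfolding tensor_degree_def
  proof (rule span_mult_closed[rotated])
    fix x y :: "('m so uea, 'm so uea) tensor"
    assume "x \<in> {a \<otimes> b |a b i j. a \<in> uea_degree i \<and> b \<in> uea_degree j \<and> i + j = d}"
      "y \<in> {a \<otimes> b |a b i j. a \<in> uea_degree i \<and> b \<in> uea_degree j \<and> i + j = e}"
    then obtain a b i j a' b' i' j' where x: "x = a \<otimes> b" "a \<in> uea_degree i" "b \<in> uea_degree j" "i + j = d"
      and y: "y = a' \<otimes> b'" "a' \<in> uea_degree i'" "b' \<in> uea_degree j'" "i' + j' = e" by blast
    have "a * a' \<in> uea_degree (i + i')" "b * b' \<in> uea_degree (j + j')"
      using graded_algebra_uea[where 'm = 'm] x y unfolding graded_algebra_def by blast+
    moreover have "x * y = (a * a') \<otimes> (b * b')" by (simp add: x y tensor_mult)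
    moreover have "(i + i') + (j + j') = d + e" using x y by simp
    ultimately show "x * y \<in> complex_vector.span
        {a \<otimes> b |a b i j. a \<in> uea_degree i \<and> b \<in> uea_degree j \<and> i + j = d + e}"
      by (intro complex_vector.span_base) blast
  qed
qed

definition graded_series :: "(int \<Rightarrow> 'a::complex_algebra_1 set) \<Rightarrow> 'a fls set" where
  "graded_series D = {f. \<forall>d. fls_nth f d \<in> D d}"

lemma graded_series_closure:
  assumes D: "graded_algebra D" and S: "S \<subseteq> graded_series D"
  shows "series_closure S \<subseteq> graded_series D"
proof
  have sub: "complex_vector.subspace (D d)" and one: "1 \<in> D 0"
    and mult: "x \<in> D d \<Longrightarrow> y \<in> D e \<Longrightarrow> x * y \<in> D (d + e)" for d e x y
    using D by (auto simp: graded_algebra_def)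
  have prod: "f * g \<in> graded_series D" if "f \<in> graded_series D" "g \<in> graded_series D" for f g
  proof -
    obtain a where a: "vanishes_below a f" using vanishes_below_exists by blast
    obtain b where b: "vanishes_below b g" using vanishes_below_exists by blast
    have "fls_nth f i * fls_nth g (n - i) \<in> D n" for n i
      using mult[of "fls_nth f i" i "fls_nth g (n - i)" "n - i"] that by (simp add: graded_series_def)
    thus ?thesis
      by (auto simp: graded_series_def fls_nth_mult[OF a b] intro: complex_vector.subspace_sum[OF sub])
  qed
  have 1: "1 \<in> graded_series D"
    using one by (auto simp: graded_series_def complex_vector.subspace_0[OF sub])
  fix x assume "x \<in> series_closure S"
  thus "x \<in> graded_series D"
  proof induction
    case (apply_fps x F)
    have "x ^ j \<in> graded_series D" for j
      by (induction j) (simp_all add: 1 prod apply_fps)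
    thus ?case
      by (auto simp: graded_series_def fps_apply_nth[OF apply_fps(2) order.refl]
          intro!: complex_vector.subspace_sum[OF sub] complex_vector.subspace_scale[OF sub])
  qed (use S 1 prod in \<open>auto simp: graded_series_def complex_vector.subspace_add[OF sub]
      complex_vector.subspace_scale[OF sub]\<close>)
qed

lemma U_completion_graded: "U_completion = graded_series uea_degree"
  by (simp add: U_completion_def graded_series_def)

lemma UU_completion_graded: "UU_completion = graded_series tensor_degree"
  by (simp add: UU_completion_def graded_series_def)

lemma uea_degree_eigen:
  assumes "x \<in> uea_degree d"
  shows "commutator (uea_of grading_element) x = of_int d *\<^sub>C x"
proof -
  let ?g = "uea_of grading_element :: 'a so uea"
  have list: "commutator ?g (prod_list (map (uea_of \<circ> snd) ys)) = of_int (sum_list (map fst ys)) *\<^sub>C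
      prod_list (map (uea_of \<circ> snd) ys)" if "\<forall>(e, x)\<in>set ys. x \<in> so_degree e" for ys
    using that
  proof (induction ys)
    case Nil
    show ?case by (simp add: commutator_def)
  next
    case (Cons p ys)
    obtain e y where p: "p = (e, y)" by force
    let ?P = "prod_list (map (uea_of \<circ> snd) ys)"
    have "commutator ?g (uea_of y) = of_int e *\<^sub>C uea_of y"
      using Cons.prems by (simp add: p so_degree_def flip: uea_of_bracket uea_of_scaleC)
    moreover have "commutator ?g (uea_of y * ?P) = commutator ?g (uea_of y) * ?P + uea_of y * commutator ?g ?P"
      by (simp add: commutator_def algebra_simps)
    moreover have "commutator ?g ?P = of_int (sum_list (map fst ys)) *\<^sub>C ?P"
      by (rule Cons.IH) (use Cons.prems in simp)
    ultimately have "commutator ?g (uea_of y * ?P) = of_int (e + sum_list (map fst ys)) *\<^sub>C (uea_of y * ?P)"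
      by (simp only: mult_scaleC_left mult_scaleC_right scaleC_add_left of_int_add)
    moreover have "prod_list (map (uea_of \<circ> snd) (p # ys)) = uea_of y * ?P"
      "sum_list (map fst (p # ys)) = e + sum_list (map fst ys)" by (simp_all add: p)
    ultimately show ?case by (simp only:)
  qed
  show ?thesis
    using assms unfolding uea_degree_def
  proof (rule complex_vector.span_induct)
    have add: "commutator ?g (x + y) = commutator ?g x + commutator ?g y" for x y
      by (simp add: commutator_def algebra_simps)
    have scale: "commutator ?g (c *\<^sub>C x) = c *\<^sub>C commutator ?g x" for c x
      by (simp add: commutator_def mult_scaleC_left mult_scaleC_right complex_vector.scale_right_diff_distrib)
    show "complex_vector.subspace {x. commutator ?g x = of_int d *\<^sub>C x}"
      by (auto simp: complex_vector.subspace_def add scale scaleC_add_right scaleC_scaleC mult.commute)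
        (simp add: commutator_def)
  qed (use list in blast)
qed

lemma eigenvectors_independent:
  fixes T :: "'a::complex_vector \<Rightarrow> 'a" and h :: "int \<Rightarrow> 'a"
  assumes add: "\<And>x y. T (x + y) = T x + T y" and scale: "\<And>c x. T (c *\<^sub>C x) = c *\<^sub>C T x"
    and "finite A" and "\<And>d. d \<in> A \<Longrightarrow> T (h d) = of_int d *\<^sub>C h d" and "(\<Sum>d\<in>A. h d) = 0"
  shows "\<forall>d\<in>A. h d = 0"
  using assms(3-)
proof (induction A arbitrary: h)
  case (insert a A)
  have zero: "T 0 = 0" using add[of 0 0] by simp
  have sum: "T (\<Sum>d\<in>B. f d) = (\<Sum>d\<in>B. T (f d))" for B :: "int set" and f
    by (induction B rule: infinite_finite_induct) (simp_all add: add zero)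
  let ?h = "\<lambda>d. of_int (d - a) *\<^sub>C h d"
  have ha: "(\<Sum>d\<in>A. h d) = - h a" using insert.prems(2) insert.hyps by (simp add: eq_neg_iff_add_eq_0 add.commute)
  have Th: "T (h d) = of_int d *\<^sub>C h d" if "d \<in> insert a A" for d by (rule insert.prems(1)[OF that])
  have "(\<Sum>d\<in>A. ?h d) = (\<Sum>d\<in>A. T (h d)) - of_int a *\<^sub>C (\<Sum>d\<in>A. h d)"
    using Th by (simp add: complex_vector.scale_sum_right sum_subtractf[symmetric]
        complex_vector.scale_left_diff_distrib)
  also have "\<dots> = T (- h a) + of_int a *\<^sub>C h a" by (simp add: ha flip: sum)
  also have "T (- h a) = - (of_int a *\<^sub>C h a)"
    using Th[of a] scale[of "-1" "h a"] by (simp add: scaleC_one)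
  finally have "(\<Sum>d\<in>A. ?h d) = 0" by simp
  moreover have "T (?h d) = of_int d *\<^sub>C ?h d" if "d \<in> A" for d
    using that Th by (simp add: scale scaleC_scaleC mult.commute)
  ultimately have "\<forall>d\<in>A. ?h d = 0" using insert.IH[of ?h] by blast
  moreover have "of_int (d - a) \<noteq> (0::complex)" if "d \<in> A" for d
    using that insert.hyps by auto
  ultimately have "\<forall>d\<in>A. h d = 0" by (auto simp del: of_int_diff)
  thus ?case using ha by auto
qed simp

text \<open>The condition under which the completion map sends \<open>u\<close> to \<open>f\<close>. Uniqueness of \<open>f\<close> holds because
  the grading element acts on degree \<open>d\<close> by the scalar \<open>d\<close>, so that components of different
  degrees are linearly independent.\<close>

definition components_of :: "'m::enum so uea \<Rightarrow> 'm U_series \<Rightarrow> bool" where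
  "components_of u f \<longleftrightarrow> f \<in> U_completion \<and> finite {d. fls_nth f d \<noteq> 0} \<and>
     (\<Sum>d | fls_nth f d \<noteq> 0. fls_nth f d) = u"

lemma components_ofI:
  assumes "f \<in> U_completion" "finite A" "\<And>d. d \<notin> A \<Longrightarrow> fls_nth f d = 0" "(\<Sum>d\<in>A. fls_nth f d) = u"
  shows "components_of u f"
proof -
  have sub: "{d. fls_nth f d \<noteq> 0} \<subseteq> A" using assms(3) by auto
  have "(\<Sum>d | fls_nth f d \<noteq> 0. fls_nth f d) = (\<Sum>d\<in>A. fls_nth f d)"
    by (rule sum.mono_neutral_left) (use assms sub in auto)
  thus ?thesis using assms finite_subset[OF sub] by (simp add: components_of_def)
qed

lemma components_of_sum:
  assumes "components_of u f" "finite A" "{d. fls_nth f d \<noteq> 0} \<subseteq> A"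
  shows "(\<Sum>d\<in>A. fls_nth f d) = u"
proof -
  have "(\<Sum>d\<in>A. fls_nth f d) = (\<Sum>d | fls_nth f d \<noteq> 0. fls_nth f d)"
    by (rule sum.mono_neutral_right) (use assms in auto)
  thus ?thesis using assms(1) by (simp add: components_of_def)
qed

lemma components_of_unique:
  assumes f: "components_of u f" and g: "components_of u g"
  shows "f = g"
proof -
  let ?A = "{d. fls_nth f d \<noteq> 0} \<union> {d. fls_nth g d \<noteq> 0}"
  have fin: "finite ?A" using f g by (simp add: components_of_def)
  have s: "(\<Sum>d\<in>?A. fls_nth f d) = u" "(\<Sum>d\<in>?A. fls_nth g d) = u"
    by (rule components_of_sum[OF f fin] components_of_sum[OF g fin]; blast)+
  have "\<forall>d\<in>?A. fls_nth f d - fls_nth g d = 0"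
  proof (rule eigenvectors_independent[OF _ _ fin, of "commutator (uea_of grading_element)"])
    fix d
    have "fls_nth f d - fls_nth g d \<in> uea_degree d"
      using f g by (auto simp: components_of_def U_completion_def intro: complex_vector.subspace_diff[OF subspace_uea_degree])
    thus "commutator (uea_of grading_element) (fls_nth f d - fls_nth g d)
        = of_int d *\<^sub>C (fls_nth f d - fls_nth g d)" by (rule uea_degree_eigen)
  qed (simp_all add: commutator_def algebra_simps mult_scaleC_left mult_scaleC_right sum_subtractf s
      complex_vector.scale_right_diff_distrib)
  thus "f = g" by (intro fls_eqI) (metis (mono_tags, lifting) UnI1 UnI2 eq_iff_diff_eq_0 mem_Collect_eq)
qed

lemma to_completion_eqI: "components_of u f \<Longrightarrow> to_completion u = f"
  unfolding to_completion_def components_of_def[symmetric]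
  by (rule the_equality) (auto intro: components_of_unique)

definition fls_monomial :: "int \<Rightarrow> 'a::zero \<Rightarrow> 'a fls" where
  "fls_monomial d a = Abs_fls (\<lambda>n. if n = d then a else 0)"

lemma fls_monomial_nth [simp]: "fls_nth (fls_monomial d a) n = (if n = d then a else 0)"
  unfolding fls_monomial_def by (rule nth_Abs_fls_lower_bound[of d]) auto

lemma fls_monomial_mult: "fls_monomial d a * fls_monomial e b = fls_monomial (d + e) (a * b :: 'a::ring_1)"
proof (rule fls_eqI)
  fix n
  have v: "vanishes_below d (fls_monomial d a)" "vanishes_below e (fls_monomial e b)"
    by (simp_all add: vanishes_below_def)
  have "(\<Sum>i=d..n-e. fls_nth (fls_monomial d a) i * fls_nth (fls_monomial e b) (n - i))
      = (\<Sum>i=d..n-e. if i = d then (if n = d + e then a * b else 0) else 0)"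
    by (intro sum.cong refl) auto
  thus "fls_nth (fls_monomial d a * fls_monomial e b) n = fls_nth (fls_monomial (d + e) (a * b)) n"
    by (simp add: fls_nth_mult[OF v] sum.delta)
qed

lemma components_of_homogeneous:
  assumes "x \<in> so_degree d"
  shows "components_of (uea_of x) (fls_monomial d (uea_of x))"
proof (rule components_ofI[of _ "{d}"])
  have "0 \<in> (uea_degree e :: 'a so uea set)" for e
    by (rule complex_vector.subspace_0[OF subspace_uea_degree])
  thus "fls_monomial d (uea_of x) \<in> U_completion"
    using assms by (simp add: U_completion_def uea_of_degree)
qed auto

lemma so_hat_homogeneous: "x \<in> so_degree d \<Longrightarrow> so_hat x = fls_monomial d (uea_of x)"
  unfolding so_hat_def by (rule to_completion_eqI[OF components_of_homogeneous])

lemma U_completion_linear: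
  "f \<in> U_completion \<Longrightarrow> g \<in> U_completion \<Longrightarrow> f + g \<in> U_completion"
  "f \<in> U_completion \<Longrightarrow> c *\<^sub>C f \<in> U_completion"
  by (auto simp: U_completion_def complex_vector.subspace_add complex_vector.subspace_scale subspace_uea_degree)

lemma components_of_add:
  assumes "components_of u f" "components_of v g" shows "components_of (u + v) (f + g)"
proof (rule components_ofI)
  let ?A = "{d. fls_nth f d \<noteq> 0} \<union> {d. fls_nth g d \<noteq> 0}"
  show "f + g \<in> U_completion" using assms U_completion_linear by (auto simp: components_of_def)
  show fin: "finite ?A" using assms by (simp add: components_of_def)
  have "(\<Sum>d\<in>?A. fls_nth f d) = u" "(\<Sum>d\<in>?A. fls_nth g d) = v"
    by (rule components_of_sum[OF assms(1) fin] components_of_sum[OF assms(2) fin]; blast)+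
  thus "(\<Sum>d\<in>?A. fls_nth (f + g) d) = u + v" by (simp add: sum.distrib)
qed auto

lemma components_of_scale:
  assumes "components_of u f" shows "components_of (c *\<^sub>C u) (c *\<^sub>C f)"
proof (rule components_ofI)
  let ?A = "{d. fls_nth f d \<noteq> 0}"
  show "c *\<^sub>C f \<in> U_completion" using assms U_completion_linear by (auto simp: components_of_def)
  show "finite ?A" using assms by (simp add: components_of_def)
  show "(\<Sum>d\<in>?A. fls_nth (c *\<^sub>C f) d) = c *\<^sub>C u"
    using assms by (auto simp: components_of_def complex_vector.scale_sum_right)
qed auto

lemma components_of_so_hat: "components_of (uea_of x) (so_hat x)"
proof -
  have "\<exists>f. components_of (uea_of x) f"
  proof (induction x rule: so_span_induct)
    case (1 i j)
    show ?case using components_of_homogeneous[OF A_so_degree[OF 1]] by blast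
  next
    case 2
    have "(0 :: 'a so) \<in> so_degree 0" by (simp add: so_degree_def lie_bracket_zero)
    from components_of_homogeneous[OF this] show ?case by blast
  next
    case (3 x y)
    thus ?case using components_of_add by (metis uea_of_add)
  next
    case (4 c x)
    thus ?case using components_of_scale by (metis uea_of_scaleC)
  qed
  then obtain f where f: "components_of (uea_of x) f" ..
  show ?thesis using f by (simp add: so_hat_def to_completion_eqI[OF f])
qed

lemma so_hat_U_completion: "so_hat x \<in> U_completion"
  using components_of_so_hat[of x] by (simp add: components_of_def)

lemma so_hat_add: "so_hat (x + y) = so_hat x + so_hat y"
proof -
  have "components_of (uea_of (x + y)) (so_hat x + so_hat y)"
    unfolding uea_of_add by (intro components_of_add components_of_so_hat)
  from components_of_unique[OF components_of_so_hat this] show ?thesis .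
qed

lemma so_hat_scaleC: "so_hat (c *\<^sub>C x) = c *\<^sub>C so_hat x"
proof -
  have "components_of (uea_of (c *\<^sub>C x)) (c *\<^sub>C so_hat x)"
    unfolding uea_of_scaleC by (intro components_of_scale components_of_so_hat)
  from components_of_unique[OF components_of_so_hat this] show ?thesis .
qed

lemma so_hat_linear: "so_hat 0 = 0" "so_hat (- x) = - so_hat x" "so_hat (x - y) = so_hat x - so_hat y"
proof -
  show "so_hat 0 = 0" using so_hat_scaleC[of 0 0] by simp
  show neg: "so_hat (- x) = - so_hat x" for x using so_hat_scaleC[of "-1" x] by (simp add: scaleC_one)
  show "so_hat (x - y) = so_hat x - so_hat y" using so_hat_add[of x "- y"] neg[of y] by simp
qed

lemma inj_so_hat: "inj (so_hat :: 'm::enum so \<Rightarrow> 'm U_series)"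
proof (rule injI)
  fix x y :: "'m so" assume "so_hat x = so_hat y"
  hence "components_of (uea_of x) (so_hat y)" using components_of_so_hat[of x] by simp
  hence "uea_of x = uea_of y" using components_of_so_hat[of y] by (simp add: components_of_def)
  thus "x = y" by (rule injD[OF inj_uea_of])
qed

lemma commutator_linear:
  "commutator 0 x = 0" "commutator x 0 = 0"
  "commutator (x + y) z = commutator x z + commutator y z"
  "commutator x (y + z) = commutator x y + commutator x z"
  "commutator (c *\<^sub>C x) (y :: 'a::complex_algebra_1) = c *\<^sub>C commutator x y"
  "commutator x (c *\<^sub>C y) = c *\<^sub>C commutator x y"
  by (simp_all add: commutator_def algebra_simps mult_scaleC_left mult_scaleC_right
      complex_vector.scale_right_diff_distrib)

lemma so_hat_bracket: "so_hat (lie_bracket x y) = commutator (so_hat x) (so_hat y)"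
proof (induction x rule: so_span_induct)
  case (1 i j)
  note ij = A_so_degree[OF 1]
  show ?case
  proof (induction y rule: so_span_induct)
    case (1 k l)
    note kl = A_so_degree[OF this]
    show ?case
      by (rule fls_eqI)
        (simp add: so_hat_homogeneous[OF ij] so_hat_homogeneous[OF kl]
          so_hat_homogeneous[OF so_degree_bracket[OF ij kl]] commutator_def fls_monomial_mult
          uea_of_bracket add.commute)
  qed (simp_all add: lie_bracket_zero so_hat_linear lie_add_right lie_scaleC_right so_hat_add so_hat_scaleC
      commutator_linear)
qed (simp_all add: lie_bracket_zero so_hat_linear lie_add_left lie_scaleC_left so_hat_add so_hat_scaleC
    commutator_linear)

lemma coproduct_so_hat: "coproduct_hat (so_hat x) = left_leg (so_hat x) + right_leg (so_hat x)"
proof (induction x rule: so_span_induct)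
  case (1 i j)
  have z: "coproduct (0 :: 'a so uea) = 0" "(0 :: 'a so uea) \<otimes> (1 :: 'a so uea) = 0" "(1 :: 'a so uea) \<otimes> (0 :: 'a so uea) = 0"
    by (rule algebra_homD(5)[OF algebra_hom_coproduct] algebra_homD(5)[OF algebra_hom_tensor_left]
       algebra_homD(5)[OF algebra_hom_tensor_right])+
  show ?case
    by (rule fls_eqI)
      (simp add: so_hat_homogeneous[OF A_so_degree[OF 1]] coproduct_hat_nth left_leg_nth right_leg_nth
        coproduct_uea_of z)
qed (simp_all add: so_hat_linear so_hat_add so_hat_scaleC algebra_homD[OF algebra_hom_coproduct_hat]
    algebra_homD[OF algebra_hom_left_leg] algebra_homD[OF algebra_hom_right_leg] scaleC_add_right)

lemma vanishes_below_so_hat_A: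
  assumes "1 \<le> i" "i < j" "j \<le> CARD('m)"
  shows "vanishes_below 1 (so_hat (A_so i j :: 'm::enum so))"
proof -
  have "i \<in> {1..CARD('m)}" "j \<in> {1..CARD('m)}" using assms by auto
  from so_hat_homogeneous[OF A_so_degree[OF this]] show ?thesis
    using so_weight_less[OF assms] by (simp add: vanishes_below_def)
qed

lemma vanishes_below_so_hat_H:
  assumes "i \<in> {1..CARD('m)}"
  shows "vanishes_below 0 (so_hat (H_so i :: 'm::enum so))"
  using so_hat_homogeneous[OF A_so_degree[OF assms assms]]
  by (simp add: H_so_def so_hat_scaleC vanishes_below_def)

section \<open>The algebra of one link\<close>

lemma commutator_eq_0_iff: "commutator x y = 0 \<longleftrightarrow> x * y = y * x"
  by (simp add: commutator_def)

lemma commutator_eqD: "commutator x y = z \<Longrightarrow> x * y = y * x + z"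
  by (drule sym) (simp add: commutator_def)

lemma commutator_anti: "commutator y x = - commutator x y"
  by (simp add: commutator_def)

lemma commutator_diff:
  "commutator (x - y) z = commutator x z - commutator y z"
  "commutator x (y - z) = commutator x y - commutator x z"
  "commutator (- x) z = - commutator x z" "commutator x (- z) = - commutator x z"
  by (simp_all add: commutator_def algebra_simps)

lemma commutator_sum:
  "commutator (\<Sum>i\<in>A. f i) x = (\<Sum>i\<in>A. commutator (f i) x)"
  "commutator x (\<Sum>i\<in>A. f i) = (\<Sum>i\<in>A. commutator x (f i))"
  by (simp_all add: commutator_def sum_distrib_left sum_distrib_right sum_subtractf)

lemma commutator_mult:
  "commutator x (y * z) = commutator x y * z + y * commutator x z"
  "commutator (x * y) z = x * commutator y z + commutator x z * y"
  by (simp_all add: commutator_def algebra_simps)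

lemma commutator_self [simp]: "commutator x x = 0"
  by (simp add: commutator_def)

lemma half_add_half: "(1/2) *\<^sub>C x + (1/2) *\<^sub>C x = x"
  by (simp add: scaleC_add_left[symmetric] scaleC_one)

lemma double_half: "(1/2) *\<^sub>C (x + x) = x"
  by (simp add: scaleC_add_right half_add_half)

text \<open>The hypotheses say that \<open>a\<close> and \<open>b\<close> transform under \<open>y\<close> like a basis of the vector representation
  under \<open>A\<^sub>i\<^sub>j\<close>, whose invariant form pairs \<open>s\<close> with its mirror image; the contraction is
  therefore invariant. With \<open>a = b\<close> this gives the invariance of \<open>I\<^sup>1\<close> and \<open>I\<^sup>2\<close>, and with \<open>a\<close>, \<open>b\<close> on
  different tensor legs that of \<open>I\<^sup>1\<^sup>\<otimes>\<^sup>2\<close>.\<close>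

lemma commutator_contraction:
  fixes a b :: "nat \<Rightarrow> 'a::complex_algebra_1"
  assumes "finite S" "bar ` S \<subseteq> S" "\<And>s. s \<in> S \<Longrightarrow> bar (bar s) = s" "i \<in> S" "j \<in> S"
    and a: "\<And>s. s \<in> S \<Longrightarrow> commutator y (a s) = (if s = bar j then a (bar i) else 0) - (if s = i then a j else 0)"
    and b: "\<And>s. s \<in> S \<Longrightarrow> commutator y (b s) = (if s = bar j then b (bar i) else 0) - (if s = i then b j else 0)"
  shows "commutator y (\<Sum>s\<in>S. a s * b (bar s)) = 0"
proof -
  have ij: "bar i \<in> S" "bar j \<in> S" "bar (bar i) = i" "bar (bar j) = j"
    using assms(2) assms(3)[OF assms(4)] assms(3)[OF assms(5)] assms(4,5) by (simp_all add: image_subset_iff)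
  have "commutator y (\<Sum>s\<in>S. a s * b (bar s))
    = (\<Sum>s\<in>S. ((if s = bar j then a (bar i) * b (bar s) else 0) - (if s = i then a j * b (bar s) else 0))
        + ((if s = j then a s * b (bar i) else 0) - (if s = bar i then a s * b j else 0)))"
    unfolding commutator_sum commutator_mult
  proof (intro sum.cong refl)
    fix s assume s: "s \<in> S"
    hence "bar s \<in> S" using assms(2) by auto
    moreover have "bar s = bar j \<longleftrightarrow> s = j" "bar s = i \<longleftrightarrow> s = bar i"
      using assms(3)[OF s] ij(3,4) by metis+
    ultimately have "commutator y (b (bar s)) = (if s = j then b (bar i) else 0) - (if s = bar i then b j else 0)"
      using b[of "bar s"] by simp
    thus "commutator y (a s) * b (bar s) + a s * commutator y (b (bar s))
        = ((if s = bar j then a (bar i) * b (bar s) else 0) - (if s = i then a j * b (bar s) else 0))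
          + ((if s = j then a s * b (bar i) else 0) - (if s = bar i then a s * b j else 0))"
      by (simp add: a[OF s] left_diff_distrib right_diff_distrib)
  qed
  also have "\<dots> = 0"
    using assms(1,4,5) ij by (simp add: sum.distrib sum_subtractf sum.delta)
  finally show ?thesis .
qed

text \<open>The relations of one link. With \<open>a = 2k + 1\<close>, \<open>b = 2k + 2\<close>, and \<open>s\<close> an index of \<open>so(M - 4(k + 1))\<close>,
  \<open>u s = A\<^sub>a\<^sub>s\<close> and \<open>v s = A\<^sub>b\<^sub>s\<close> generate a Heisenberg algebra with centre \<open>E = E\<^sub>a\<^sub>+\<^sub>b\<close>. The
  elements \<open>q\<close> and \<open>r\<close> stand for \<open>e\<^sup>\<sigma>\<^sup>/\<^sup>2\<close> and \<open>e\<^sup>-\<^sup>\<sigma>\<^sup>/\<^sup>2\<close>; only \<open>q\<^sup>2 = 1 + E\<close> and \<open>r = q\<^sup>-\<^sup>1\<close> matter.\<close>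

locale link_algebra =
  fixes S :: "nat set" and bar :: "nat \<Rightarrow> nat"
    and u v :: "nat \<Rightarrow> 'u::complex_algebra_1" and E H e12 e21 q r :: 'u
  assumes finite_S: "finite S" and bar_S: "s \<in> S \<Longrightarrow> bar s \<in> S" and bar_bar: "s \<in> S \<Longrightarrow> bar (bar s) = s"
    and uu: "s \<in> S \<Longrightarrow> t \<in> S \<Longrightarrow> commutator (u s) (u t) = 0"
    and vv: "s \<in> S \<Longrightarrow> t \<in> S \<Longrightarrow> commutator (v s) (v t) = 0"
    and uv: "s \<in> S \<Longrightarrow> t \<in> S \<Longrightarrow> commutator (u s) (v t) = (if t = bar s then E else 0)"
    and H_u: "s \<in> S \<Longrightarrow> commutator H (u s) = (1/2) *\<^sub>C u s"
    and H_v: "s \<in> S \<Longrightarrow> commutator H (v s) = - ((1/2) *\<^sub>C v s)"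
    and H_e12: "commutator H e12 = e12" and H_e21: "commutator H e21 = - e21"
    and e12_u: "s \<in> S \<Longrightarrow> commutator e12 (u s) = 0" and e12_v: "s \<in> S \<Longrightarrow> commutator e12 (v s) = - u s"
    and e21_u: "s \<in> S \<Longrightarrow> commutator e21 (u s) = - v s" and e21_v: "s \<in> S \<Longrightarrow> commutator e21 (v s) = 0"
    and e12_e21: "commutator e12 e21 = 2 *\<^sub>C H"
    and central: "c \<in> {E, q, r} \<Longrightarrow> x \<in> u ` S \<union> v ` S \<union> {H, e12, e21, E, q, r} \<Longrightarrow> commutator c x = 0"
    and q_q: "q * q = 1 + E" and q_r: "q * r = 1" and r_q: "r * q = 1"
begin

definition "I1 = (1/2) *\<^sub>C (\<Sum>s\<in>S. u s * u (bar s))"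
definition "I2 = (1/2) *\<^sub>C (\<Sum>s\<in>S. v s * v (bar s))"
definition "X = (1/2) *\<^sub>C (\<Sum>s\<in>S. u s * v (bar s) + v s * u (bar s))"

lemma bar_eq: "s \<in> S \<Longrightarrow> t \<in> S \<Longrightarrow> bar s = bar t \<longleftrightarrow> s = t" "s \<in> S \<Longrightarrow> t \<in> S \<Longrightarrow> bar s = t \<longleftrightarrow> s = bar t"
  using bar_bar by metis+

lemma sum_bar: "(\<Sum>s\<in>S. f (bar s)) = (\<Sum>s\<in>S. f s)"
  by (rule sum.reindex_bij_witness[of _ bar bar]) (auto simp: bar_S bar_bar)

lemma central':
  assumes "c \<in> {E, q, r}" and "x \<in> u ` S \<union> v ` S \<union> {H, e12, e21, E, q, r}"
  shows "commutator x c = 0" "x * c = c * x" "c * x = x * c"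
  using central[OF assms] by (simp_all add: commutator_def)

lemma central_simps:
  "s \<in> S \<Longrightarrow> commutator E (u s) = 0" "s \<in> S \<Longrightarrow> commutator (u s) E = 0"
  "s \<in> S \<Longrightarrow> commutator E (v s) = 0" "s \<in> S \<Longrightarrow> commutator (v s) E = 0"
  "s \<in> S \<Longrightarrow> commutator r (u s) = 0" "s \<in> S \<Longrightarrow> commutator (u s) r = 0"
  "s \<in> S \<Longrightarrow> commutator r (v s) = 0" "s \<in> S \<Longrightarrow> commutator (v s) r = 0"
  "commutator H r = 0" "commutator r H = 0" "commutator e12 r = 0" "commutator r e12 = 0"
  "commutator e21 r = 0" "commutator r e21 = 0" "commutator E r = 0" "commutator r E = 0"
  "commutator E q = 0" "commutator q E = 0" "commutator r q = 0" "commutator q r = 0"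
  "s \<in> S \<Longrightarrow> commutator q (v s) = 0" "s \<in> S \<Longrightarrow> commutator (v s) q = 0"
  "commutator E H = 0" "commutator E e12 = 0" "commutator E e21 = 0"
  by (rule central central'(1); simp)+

lemma r_r: "(1 + E) * (r * r) = 1" "(r * r) * (1 + E) = 1"
proof -
  have "(1 + E) * (r * r) = q * (q * r) * r" by (simp only: q_q[symmetric] mult.assoc)
  thus "(1 + E) * (r * r) = 1" by (simp add: q_r)
  have "(r * r) * (1 + E) = r * (r * q) * q" by (simp only: q_q[symmetric] mult.assoc)
  thus "(r * r) * (1 + E) = 1" by (simp add: r_q)
qed

lemma q_minus_E_r: "q - E * r = r"
proof -
  have "(1 + E) * r = q * (q * r)" by (simp only: q_q[symmetric] mult.assoc)
  hence "r + E * r = q" by (simp add: q_r distrib_right)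
  thus ?thesis by (metis add_diff_cancel_right')
qed

lemma u_I2: "s \<in> S \<Longrightarrow> commutator (u s) I2 = E * v s"
proof -
  assume s: "s \<in> S"
  have "commutator (u s) (\<Sum>t\<in>S. v t * v (bar t))
      = (\<Sum>t\<in>S. (if t = bar s then E * v (bar t) else 0) + (if t = s then v t * E else 0))"
    unfolding commutator_sum commutator_mult
    by (intro sum.cong refl) (simp add: uv s bar_S bar_eq(1))
  also have "\<dots> = E * v s + E * v s"
    using s central'(2)[of E "v s"] by (simp add: sum.distrib sum.delta finite_S bar_S bar_bar)
  finally show ?thesis by (simp add: I2_def commutator_linear double_half)
qed

lemma e12_I2: "commutator e12 I2 = - X"
  by (simp add: I2_def X_def commutator_linear commutator_sum commutator_mult e12_v bar_S
      sum_negf sum_subtractf flip: complex_vector.scale_minus_right)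
    (simp add: sum.distrib)

lemma e21_I1: "commutator e21 I1 = - X"
  by (simp add: I1_def X_def commutator_linear commutator_sum commutator_mult e21_u bar_S
      sum_negf sum_subtractf add.commute flip: complex_vector.scale_minus_right)
    (simp add: sum.distrib)

lemma I1_I2: "commutator I1 I2 = E * X"
proof -
  have "commutator (\<Sum>s\<in>S. u s * u (bar s)) I2 = E * (\<Sum>s\<in>S. u s * v (bar s) + v s * u (bar s))"
    unfolding commutator_sum commutator_mult sum_distrib_left
  proof (intro sum.cong refl)
    fix s assume s: "s \<in> S"
    have "u s * (E * v (bar s)) = E * (u s * v (bar s))"
      using central'(2)[of E "u s"] s by (simp add: mult.assoc[symmetric])
    thus "u s * commutator (u (bar s)) I2 + commutator (u s) I2 * u (bar s)
        = E * (u s * v (bar s) + v s * u (bar s))"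
      by (simp add: u_I2 s bar_S distrib_left mult.assoc)
  qed
  thus ?thesis by (simp add: I1_def X_def commutator_linear mult_scaleC_right)
qed

lemma H_I1: "commutator H I1 = I1"
  by (simp add: I1_def commutator_linear commutator_sum commutator_mult H_u bar_S mult_scaleC_left
      mult_scaleC_right half_add_half)

lemma H_I2: "commutator H I2 = - I2"
proof -
  have "commutator H (\<Sum>s\<in>S. v s * v (bar s)) = - (\<Sum>s\<in>S. v s * v (bar s))"
    unfolding commutator_sum commutator_mult sum_negf[symmetric]
  proof (intro sum.cong refl)
    fix s assume s: "s \<in> S"
    have "commutator H (v s) * v (bar s) + v s * commutator H (v (bar s))
        = - ((1/2) *\<^sub>C (v s * v (bar s)) + (1/2) *\<^sub>C (v s * v (bar s)))"
      by (simp add: H_v s bar_S mult_scaleC_left mult_scaleC_right)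
    thus "commutator H (v s) * v (bar s) + v s * commutator H (v (bar s)) = - (v s * v (bar s))"
      by (simp only: half_add_half)
  qed
  thus ?thesis by (simp add: I2_def commutator_linear)
qed

lemma rr_central: "commutator H (r * r) = 0" "commutator e12 (r * r) = 0" "commutator e21 (r * r) = 0"
  "commutator I1 (r * r) = 0" "commutator I2 (r * r) = 0" "commutator (r * r) E = 0"
  by (simp_all add: I1_def I2_def commutator_linear commutator_sum commutator_mult central_simps bar_S)

definition "G_up = e12 - I1"
definition "G_down = e21 - I2 * (r * r)"

lemma H_G_up: "commutator H G_up = G_up"
  by (simp add: G_up_def commutator_diff H_e12 H_I1)

lemma H_G_down: "commutator H G_down = - G_down"
  by (simp add: G_down_def commutator_diff commutator_mult(1)[of _ I2] H_e21 H_I2 rr_central)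

text \<open>Both \<open>[I\<^sup>2, e\<^sub>1\<^sub>2]\<close> and \<open>[I\<^sup>1, e\<^sub>2\<^sub>1]\<close> equal \<open>X\<close>, and \<open>[I\<^sup>1, I\<^sup>2] = E X\<close>; so the corrections to
  \<open>[e\<^sub>1\<^sub>2, e\<^sub>2\<^sub>1] = 2H\<close> add up to \<open>X (1 + E) r\<^sup>2 - X = 0\<close>.\<close>

lemma G_up_G_down: "commutator G_up G_down = 2 *\<^sub>C H"
proof -
  have "commutator G_up G_down = 2 *\<^sub>C H - commutator e12 I2 * (r * r) - commutator I1 e21
      + commutator I1 I2 * (r * r)"
    by (simp add: G_up_def G_down_def commutator_diff commutator_mult(1)[of _ I2] e12_e21 rr_central
        left_diff_distrib)
  also have "\<dots> = 2 *\<^sub>C H + X * (r * r) - X + (E * X) * (r * r)"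
    using e21_I1 commutator_anti[of I1 e21] by (simp add: e12_I2 I1_I2)
  also have "(E * X) * (r * r) = X * (E * (r * r))"
  proof -
    have "commutator E X = 0"
      by (simp add: X_def commutator_linear commutator_sum commutator_mult central_simps bar_S)
    thus ?thesis by (simp add: commutator_eq_0_iff flip: mult.assoc)
  qed
  also have "2 *\<^sub>C H + X * (r * r) - X + X * (E * (r * r)) = 2 *\<^sub>C H + (X * ((1 + E) * (r * r)) - X)"
    by (simp add: distrib_left distrib_right)
  also have "\<dots> = 2 *\<^sub>C H" by (simp only: r_r mult_1_right diff_self add_0_right)
  finally show ?thesis .
qed

end

section \<open>Conjugation by the twist of one link\<close>

text \<open>For invertible \<open>K\<close> this is \<open>K a K\<^sup>-\<^sup>1 = b\<close>; in this form no inverse is needed until the very end.\<close>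

definition intertwines :: "'a::complex_algebra_1 \<Rightarrow> 'a \<Rightarrow> 'a \<Rightarrow> bool" where
  "intertwines K a b \<longleftrightarrow> K * a = b * K"

lemma intertwines_add: "intertwines K a b \<Longrightarrow> intertwines K a' b' \<Longrightarrow> intertwines K (a + a') (b + b')"
  by (simp add: intertwines_def distrib_left distrib_right)

lemma intertwines_diff: "intertwines K a b \<Longrightarrow> intertwines K a' b' \<Longrightarrow> intertwines K (a - a') (b - b')"
  by (simp add: intertwines_def left_diff_distrib right_diff_distrib)

lemma intertwines_mult:
  assumes "intertwines K a b" "intertwines K a' b'" shows "intertwines K (a * a') (b * b')"
  unfolding intertwines_def
proof -
  have "K * (a * a') = b * (K * a')" using assms(1) by (simp add: intertwines_def mult.assoc[symmetric])
  thus "K * (a * a') = b * b' * K" using assms(2) by (simp add: intertwines_def mult.assoc)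
qed

lemma intertwines_scale: "intertwines K a b \<Longrightarrow> intertwines K (c *\<^sub>C a) (c *\<^sub>C b)"
  by (simp add: intertwines_def mult_scaleC_left mult_scaleC_right)

lemma intertwines_sum:
  "(\<And>i. i \<in> A \<Longrightarrow> intertwines K (a i) (b i)) \<Longrightarrow> intertwines K (\<Sum>i\<in>A. a i) (\<Sum>i\<in>A. b i)"
  by (simp add: intertwines_def sum_distrib_left sum_distrib_right)

lemma intertwines_trans: "intertwines J a b \<Longrightarrow> intertwines K b c \<Longrightarrow> intertwines (K * J) a c"
  by (simp add: intertwines_def) (metis mult.assoc)

text \<open>The two factors \<open>J\<close> and \<open>\<Phi>\<close> of the twist of a link enter only through the way they conjugate the
  generators: \<open>J\<close> multiplies \<open>x \<otimes> 1\<close> by \<open>1 \<otimes> e\<^sup>c\<^sup>\<sigma>\<close>, with \<open>c\<close> the weight of \<open>x\<close> under \<open>H\<^sub>1\<^sub>+\<^sub>2\<close>, and \<open>\<Phi>\<close>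
  acts as the exponential of \<open>ad W\<close>. Here \<open>L x = x \<otimes> 1\<close>, \<open>R x = 1 \<otimes> x\<close>, and \<open>D\<close> is the coproduct.\<close>

locale twisted_link = link_algebra S bar u v E H e12 e21 q r
  for S bar and u v :: "nat \<Rightarrow> 'u::complex_algebra_1" and E H e12 e21 q r +
  fixes L R D :: "'u \<Rightarrow> 'w::complex_algebra_1" and J \<Phi> W :: 'w
  assumes L: "algebra_hom L" and R: "algebra_hom R" and D: "algebra_hom D"
    and RL: "R y * L x = L x * R y"
    and D_eq: "x \<in> u ` S \<union> v ` S \<union> {E, H, e12, e21} \<Longrightarrow> D x = L x + R x"
    and J_L1: "x \<in> u ` S \<union> v ` S \<Longrightarrow> intertwines J (L x) (L x * R q)"
    and J_L2: "intertwines J (L E) (L E * R (q * q))"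
    and J_L0: "x \<in> {H, e12, e21} \<Longrightarrow> intertwines J (L x) (L x)"
    and J_R: "x \<in> u ` S \<union> v ` S \<union> {E, H, e12, e21} \<Longrightarrow> intertwines J (R x) (R x)"
    and W_def: "W = (\<Sum>s\<in>S. L (u s) * R (v (bar s) * r))"
    and \<Phi>: "commutator W a = b \<Longrightarrow> commutator W b = c \<Longrightarrow> commutator W c = 0 \<Longrightarrow>
      intertwines \<Phi> a (a + b + (1/2) *\<^sub>C c)"
begin

lemmas hom = algebra_homD[OF L] algebra_homD[OF R] algebra_homD[OF D]

lemma leg_commutator: "commutator (L x) (R y) = 0" "commutator (R y) (L x) = 0"
  "commutator (L x) (L y) = L (commutator x y)" "commutator (R x) (R y) = R (commutator x y)"
  by (simp_all add: RL commutator_def hom)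

lemma RL_left: "R y * (L x * z) = L x * (R y * z)"
  using RL[of y x] by (metis mult.assoc)

lemma W_L: "commutator W (L x) = (\<Sum>s\<in>S. L (commutator (u s) x) * R (v (bar s) * r))"
  by (simp add: W_def commutator_sum commutator_mult leg_commutator)

lemma W_R: "commutator W (R x) = (\<Sum>s\<in>S. L (u s) * R (commutator (v (bar s) * r) x))"
  by (simp add: W_def commutator_sum commutator_mult(2) leg_commutator)

lemma \<Phi>_invariant: "commutator W y = 0 \<Longrightarrow> intertwines \<Phi> y y"
  using \<Phi>[of y 0 0] by (simp add: commutator_linear)

lemma \<Phi>_order1: "commutator W y = z \<Longrightarrow> commutator W z = 0 \<Longrightarrow> intertwines \<Phi> y (y + z)"
  using \<Phi>[of y z 0] by (simp add: commutator_linear)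

lemma W_simps:
  "s \<in> S \<Longrightarrow> commutator W (L (u s)) = 0" "s \<in> S \<Longrightarrow> commutator W (R (v s)) = 0"
  "commutator W (L E) = 0" "commutator W (R E) = 0" "commutator W (R q) = 0" "commutator W (R r) = 0"
  "commutator W (R e21) = 0" "commutator W (L e12) = 0"
  using e12_u commutator_anti[of _ e12] e21_v commutator_anti[of _ e21]
  by (simp_all add: W_L W_R commutator_mult uu vv hom central_simps bar_S)

lemma W_L_v: "t \<in> S \<Longrightarrow> commutator W (L (v t)) = L E * R (v t * r)"
proof -
  assume t: "t \<in> S"
  have "commutator W (L (v t)) = (\<Sum>s\<in>S. if s = bar t then L E * R (v (bar s) * r) else 0)"
    unfolding W_L using t bar_eq by (intro sum.cong refl) (auto simp: uv hom)
  thus ?thesis using t by (simp add: sum.delta finite_S bar_S bar_bar)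
qed

lemma v_r_u: "s \<in> S \<Longrightarrow> t \<in> S \<Longrightarrow> commutator (v (bar s) * r) (u t) = - (if s = t then E * r else 0)"
  using uv[of t "bar s"] commutator_anti[of "v (bar s)" "u t"] bar_eq
  by (auto simp: commutator_mult central_simps bar_S)

lemma W_R_u: "t \<in> S \<Longrightarrow> commutator W (R (u t)) = - (L (u t) * R (E * r))"
proof -
  assume t: "t \<in> S"
  have "commutator W (R (u t)) = (\<Sum>s\<in>S. if s = t then - (L (u s) * R (E * r)) else 0)"
    unfolding W_R using t by (intro sum.cong refl) (simp add: v_r_u hom)
  thus ?thesis using t by (simp add: sum.delta finite_S)
qed

abbreviation "K \<equiv> \<Phi> * J"

text \<open>The factor \<open>J\<close> turns \<open>u \<otimes> 1\<close> into \<open>u \<otimes> q\<close>, and \<open>\<Phi>\<close> adds \<open>- u \<otimes> E r\<close> coming from \<open>1 \<otimes> u\<close>; the two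
  combine by \<open>q - E r = r\<close>.\<close>

lemma K_u:
  assumes s: "s \<in> S"
  shows "intertwines K (D (u s)) (L (u s) * R r + R (u s))"
proof (rule intertwines_trans)
  show "intertwines J (D (u s)) (L (u s) * R q + R (u s))"
    using s by (simp add: D_eq J_L1 J_R intertwines_add)
  have "commutator W (- (L (u s) * R (E * r))) = 0"
    by (simp add: commutator_diff commutator_mult hom W_simps s)
  hence "intertwines \<Phi> (L (u s) * R q + R (u s)) (L (u s) * R q + (R (u s) + - (L (u s) * R (E * r))))"
    by (intro intertwines_add intertwines_mult \<Phi>_invariant \<Phi>_order1 W_simps W_R_u s)
  also have "L (u s) * R q + (R (u s) + - (L (u s) * R (E * r))) = L (u s) * R (q - E * r) + R (u s)"
    by (simp add: hom right_diff_distrib)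
  finally show "intertwines \<Phi> (L (u s) * R q + R (u s)) (L (u s) * R r + R (u s))"
    by (simp add: q_minus_E_r)
qed

lemma K_v:
  assumes s: "s \<in> S"
  shows "intertwines K (D (v s)) (L (v s) * R q + L (1 + E) * R (v s))"
proof (rule intertwines_trans)
  show "intertwines J (D (v s)) (L (v s) * R q + R (v s))"
    using s by (simp add: D_eq J_L1 J_R intertwines_add)
  have "commutator W (L E * R (v s * r)) = 0"
    by (simp add: commutator_mult hom W_simps s)
  hence "intertwines \<Phi> (L (v s) * R q + R (v s)) ((L (v s) + L E * R (v s * r)) * R q + R (v s))"
    by (intro intertwines_add intertwines_mult \<Phi>_invariant \<Phi>_order1 W_simps W_L_v s)
  also have "(L (v s) + L E * R (v s * r)) * R q + R (v s)
      = L (v s) * R q + L E * R (v s * (r * q)) + R (v s)"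
    by (simp add: hom distrib_right mult.assoc)
  also have "\<dots> = L (v s) * R q + L (1 + E) * R (v s)"
    by (simp add: r_q hom distrib_right)
  finally show "intertwines \<Phi> (L (v s) * R q + R (v s)) (L (v s) * R q + L (1 + E) * R (v s))" .
qed

text \<open>The element \<open>1 + E = e\<^sup>\<sigma>\<close> becomes group-like, as it must for \<open>\<sigma>\<close> to be primitive.\<close>

lemma K_g: "intertwines K (D (1 + E)) (L (1 + E) * R (1 + E))"
proof -
  have "intertwines K (D E) (L E * R (q * q) + R E)"
  proof (rule intertwines_trans)
    show "intertwines J (D E) (L E * R (q * q) + R E)"
      by (simp add: D_eq J_L2 J_R intertwines_add)
    show "intertwines \<Phi> (L E * R (q * q) + R E) (L E * R (q * q) + R E)"
      by (intro \<Phi>_invariant) (simp add: commutator_linear commutator_mult hom W_simps)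
  qed
  moreover have "intertwines K (D 1) 1" by (simp add: intertwines_def hom)
  ultimately have "intertwines K (D 1 + D E) (1 + (L E * R (q * q) + R E))" by (intro intertwines_add)
  thus ?thesis by (simp add: q_q hom algebra_simps)
qed

lemma K_g_inverse: "intertwines K (D (r * r)) (L (r * r) * R (r * r))"
  unfolding intertwines_def
proof -
  have 1: "L (r * r) * L (1 + E) = 1" "R (r * r) * R (1 + E) = 1" "D (1 + E) * D (r * r) = 1"
    by (simp_all only: algebra_homD(2)[OF L, symmetric] algebra_homD(2)[OF R, symmetric]
        algebra_homD(2)[OF D, symmetric] r_r algebra_homD(4)[OF L] algebra_homD(4)[OF R] algebra_homD(4)[OF D])
  have 2: "L (r * r) * R (r * r) * (L (1 + E) * R (1 + E)) = 1"
  proof -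
    have "L (r * r) * R (r * r) * (L (1 + E) * R (1 + E))
        = (L (r * r) * L (1 + E)) * (R (r * r) * R (1 + E))"
      by (simp only: mult.assoc RL_left)
    thus ?thesis by (simp only: 1 mult_1_right)
  qed
  have "K * D (r * r) = (L (r * r) * R (r * r) * (L (1 + E) * R (1 + E))) * (K * D (r * r))"
    by (simp only: 2 mult_1_left)
  also have "\<dots> = L (r * r) * R (r * r) * ((L (1 + E) * R (1 + E) * K) * D (r * r))"
    by (simp only: mult.assoc)
  also have "L (1 + E) * R (1 + E) * K = K * D (1 + E)"
    using K_g by (simp add: intertwines_def)
  also have "K * D (1 + E) * D (r * r) = K" by (simp only: mult.assoc 1 mult_1_right)
  finally show "K * D (r * r) = L (r * r) * R (r * r) * K" .
qed

text \<open>The first-order corrections to \<open>1 \<otimes> e\<^sub>1\<^sub>2\<close> and to \<open>e\<^sub>2\<^sub>1 \<otimes> 1\<close> under conjugation by \<open>\<Phi>\<close>. They reappear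
  in the images of \<open>\<Delta>(I\<^sup>1)\<close> and \<open>\<Delta>(I\<^sup>2 e\<^sup>-\<^sup>\<sigma>)\<close>, which is why \<open>G\<^sub>1\<^sub>2\<close> and \<open>G\<^sub>2\<^sub>1\<close> are primitive and
  the root vectors themselves are not.\<close>

definition "V = (\<Sum>s\<in>S. L (u s) * R (u (bar s) * r))"
definition "Y = (\<Sum>s\<in>S. L (v s) * R (v (bar s) * r))"

lemma r_comm: "s \<in> S \<Longrightarrow> r * u s = u s * r" "s \<in> S \<Longrightarrow> r * v s = v s * r"
  "s \<in> S \<Longrightarrow> q * v s = v s * q"
  "E * r = r * E"
  by (rule central'; simp)+

lemma half_sum_split: "(1/2) *\<^sub>C (a + (b + b) + c) = (1/2) *\<^sub>C a + b + (1/2) *\<^sub>C c"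
  by (simp add: scaleC_add_right half_add_half)

lemma K_I1: "intertwines K (D I1) (L I1 * R (r * r) + R I1 + V)"
proof -
  have "intertwines K (D I1) ((1/2) *\<^sub>C (\<Sum>s\<in>S. (L (u s) * R r + R (u s)) * (L (u (bar s)) * R r + R (u (bar s)))))"
    unfolding I1_def hom by (intro intertwines_scale intertwines_sum intertwines_mult K_u bar_S)
  also have "(\<Sum>s\<in>S. (L (u s) * R r + R (u s)) * (L (u (bar s)) * R r + R (u (bar s))))
    = (\<Sum>s\<in>S. L (u s * u (bar s)) * R (r * r)) + (V + (\<Sum>s\<in>S. L (u (bar s)) * R (u s * r)))
      + (\<Sum>s\<in>S. R (u s * u (bar s)))"
    unfolding V_def sum.distrib[symmetric]
  proof (intro sum.cong refl)
    fix s assume s: "s \<in> S"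
    have "R r * R (u (bar s)) = R (u (bar s)) * R r" by (simp only: algebra_homD(2)[OF R, symmetric] r_comm(1)[OF bar_S[OF s]])
    thus "(L (u s) * R r + R (u s)) * (L (u (bar s)) * R r + R (u (bar s))) =
        L (u s * u (bar s)) * R (r * r) + (L (u s) * R (u (bar s) * r) + L (u (bar s)) * R (u s * r)) + R (u s * u (bar s))"
      by (simp add: hom distrib_left distrib_right RL RL_left mult.assoc)
  qed
  also have "(\<Sum>s\<in>S. L (u (bar s)) * R (u s * r)) = V"
    unfolding V_def sum_bar[of "\<lambda>s. L (u s) * R (u (bar s) * r)", symmetric]
    by (intro sum.cong refl) (simp add: bar_bar)
  also have "(1/2) *\<^sub>C ((\<Sum>s\<in>S. L (u s * u (bar s)) * R (r * r)) + (V + V) + (\<Sum>s\<in>S. R (u s * u (bar s))))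
      = L I1 * R (r * r) + V + R I1"
    unfolding half_sum_split by (simp add: I1_def hom sum_distrib_right mult_scaleC_left)
  finally show ?thesis by (simp add: algebra_simps)
qed

lemma K_I2: "intertwines K (D I2)
  (L I2 * R (1 + E) + L ((1 + E) * (1 + E)) * R I2 + (\<Sum>s\<in>S. L ((1 + E) * v s) * R (v (bar s) * q)))"
proof -
  define g where "g = 1 + E"
  define Z where "Z = (\<Sum>s\<in>S. L (g * v s) * R (v (bar s) * q))"
  have gv: "g * v s = v s * g" if "s \<in> S" for s
    using central'(2)[of E "v s"] that by (simp add: g_def distrib_left distrib_right)
  have "intertwines K (D I2) ((1/2) *\<^sub>C (\<Sum>s\<in>S. (L (v s) * R q + L g * R (v s)) *
      (L (v (bar s)) * R q + L g * R (v (bar s)))))"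
    unfolding I2_def hom by (intro intertwines_scale intertwines_sum intertwines_mult K_v[folded g_def] bar_S)
  also have "(\<Sum>s\<in>S. (L (v s) * R q + L g * R (v s)) * (L (v (bar s)) * R q + L g * R (v (bar s))))
    = (\<Sum>s\<in>S. L (v s * v (bar s)) * R (q * q)) + (Z + (\<Sum>s\<in>S. L (g * v (bar s)) * R (v s * q)))
      + (\<Sum>s\<in>S. L (g * g) * R (v s * v (bar s)))"
    unfolding Z_def sum.distrib[symmetric]
  proof (intro sum.cong refl)
    fix s assume s: "s \<in> S"
    have 1: "R q * R (v (bar s)) = R (v (bar s)) * R q" by (simp only: algebra_homD(2)[OF R, symmetric] r_comm(3)[OF bar_S[OF s]])
    have "L (v s) * L g = L g * L (v s)"
      by (simp only: algebra_homD(2)[OF L, symmetric] gv[OF s])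
    hence 2: "L (v s) * (L g * z) = L g * (L (v s) * z)" for z
      by (simp only: mult.assoc[symmetric])
    have 3: "L (x * y) = L x * L y" "R (x * y) = R x * R y" for x y by (rule hom)+
    show "(L (v s) * R q + L g * R (v s)) * (L (v (bar s)) * R q + L g * R (v (bar s))) =
        L (v s * v (bar s)) * R (q * q) + (L (g * v s) * R (v (bar s) * q) + L (g * v (bar s)) * R (v s * q))
        + L (g * g) * R (v s * v (bar s))"
      by (simp only: distrib_left[of "_ + _" "_ * R _" "_ * R _"] distrib_right[of "_ * R _" "_ * R _"]
          RL RL_left mult.assoc 1 2 3 ac_simps(1) add.assoc add.left_commute add.commute)
  qed
  also have "(\<Sum>s\<in>S. L (g * v (bar s)) * R (v s * q)) = Z"
    unfolding Z_def sum_bar[of "\<lambda>s. L (g * v s) * R (v (bar s) * q)", symmetric]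
    by (intro sum.cong refl) (simp add: bar_bar)
  also have "(1/2) *\<^sub>C ((\<Sum>s\<in>S. L (v s * v (bar s)) * R (q * q)) + (Z + Z) + (\<Sum>s\<in>S. L (g * g) * R (v s * v (bar s))))
      = L I2 * R g + Z + L (g * g) * R I2"
    unfolding half_sum_split q_q g_def[symmetric]
    by (simp add: I2_def algebra_homD(3,8)[OF L] algebra_homD(3,8)[OF R] sum_distrib_right sum_distrib_left
        mult_scaleC_left mult_scaleC_right)
  finally show ?thesis unfolding Z_def g_def by (simp only: add.assoc add.commute[of "sum _ _"])
qed

text \<open>Two brackets with \<open>W\<close> contribute: the first replaces \<open>e\<^sub>1\<^sub>2\<close> by some \<open>u\<close>, the second that \<open>u\<close> by \<open>E\<close>.\<close>

lemma \<Phi>_e12: "intertwines \<Phi> (R e12) (R e12 + V - L I1 * R (E * (r * r)))"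
proof -
  have 1: "commutator W (R e12) = V"
    unfolding W_R V_def
  proof (intro sum.cong refl)
    fix s assume "s \<in> S"
    hence "commutator (v (bar s) * r) e12 = u (bar s) * r"
      using e12_v[of "bar s"] commutator_anti[of "v (bar s)" e12]
      by (simp add: commutator_mult central_simps bar_S)
    thus "L (u s) * R (commutator (v (bar s) * r) e12) = L (u s) * R (u (bar s) * r)" by simp
  qed
  have "commutator W V = (\<Sum>s\<in>S. - (L (u s * u (bar s)) * R (E * (r * r))))"
    unfolding V_def commutator_sum
  proof (intro sum.cong refl)
    fix s assume s: "s \<in> S"
    show "commutator W (L (u s) * R (u (bar s) * r)) = - (L (u s * u (bar s)) * R (E * (r * r)))"
      by (simp add: commutator_mult hom W_simps W_R_u s bar_S mult.assoc)
  qed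
  also have "\<dots> = - (2 *\<^sub>C (L I1 * R (E * (r * r))))"
    by (simp add: I1_def hom sum_negf sum_distrib_right mult_scaleC_left scaleC_scaleC scaleC_one)
  finally have 2: "commutator W V = - (2 *\<^sub>C (L I1 * R (E * (r * r))))" .
  have 3: "commutator W (L I1 * R (E * (r * r))) = 0"
    by (simp add: I1_def hom commutator_mult commutator_linear commutator_sum W_simps bar_S)
  show ?thesis
    using \<Phi>[OF 1 2] 3
    by (simp add: commutator_diff commutator_linear scaleC_scaleC scaleC_one)
qed

lemma \<Phi>_e21: "intertwines \<Phi> (L e21) (L e21 + Y + L E * R (I2 * (r * r)))"
proof -
  have 1: "commutator W (L e21) = Y"
    unfolding W_L Y_def
  proof (intro sum.cong refl)
    fix s assume "s \<in> S"
    hence "commutator (u s) e21 = v s" using e21_u[of s] commutator_anti[of "u s" e21] by simp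
    thus "L (commutator (u s) e21) * R (v (bar s) * r) = L (v s) * R (v (bar s) * r)" by simp
  qed
  have "commutator W Y = (\<Sum>s\<in>S. L E * R (v s * v (bar s) * (r * r)))"
    unfolding Y_def commutator_sum
  proof (intro sum.cong refl)
    fix s assume s: "s \<in> S"
    have "r * (v (bar s) * z) = v (bar s) * (r * z)" for z
      using r_comm(2)[OF bar_S[OF s]] by (metis mult.assoc)
    hence "v s * r * (v (bar s) * r) = v s * v (bar s) * (r * r)" by (simp add: mult.assoc)
    moreover have "commutator W (L (v s) * R (v (bar s) * r)) = L E * R (v s * r * (v (bar s) * r))"
      by (simp only: commutator_mult hom W_simps W_L_v s bar_S mult.assoc mult_zero_left mult_zero_right add_0_right)
    ultimately show "commutator W (L (v s) * R (v (bar s) * r)) = L E * R (v s * v (bar s) * (r * r))"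
      by simp
  qed
  also have "\<dots> = 2 *\<^sub>C (L E * R (I2 * (r * r)))"
    by (simp add: I2_def hom sum_distrib_right sum_distrib_left mult_scaleC_left mult_scaleC_right
        scaleC_scaleC scaleC_one)
  finally have 2: "commutator W Y = 2 *\<^sub>C (L E * R (I2 * (r * r)))" .
  have 3: "commutator W (L E * R (I2 * (r * r))) = 0"
    by (simp add: I2_def hom commutator_mult commutator_linear commutator_sum W_simps bar_S)
  show ?thesis
    using \<Phi>[OF 1 2] 3 by (simp add: commutator_linear scaleC_scaleC scaleC_one)
qed

text \<open>The two legs of \<open>W\<close> have opposite weights under \<open>H\<^sub>1\<^sub>-\<^sub>2\<close>.\<close>

lemma twisted_H: "intertwines K (D H) (L H + R H)"
proof (rule intertwines_trans)
  show "intertwines J (D H) (L H + R H)" by (simp add: D_eq J_L0 J_R intertwines_add)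
  have "commutator W (L H) = - ((1/2) *\<^sub>C W)"
  proof -
    have "commutator (u s) H = - ((1/2) *\<^sub>C u s)" if "s \<in> S" for s
      using H_u[OF that] commutator_anti[of "u s" H] by simp
    thus ?thesis
      unfolding W_L unfolding W_def complex_vector.scale_sum_right sum_negf[symmetric]
      by (intro sum.cong refl) (simp add: hom mult_scaleC_left)
  qed
  moreover have "commutator W (R H) = (1/2) *\<^sub>C W"
  proof -
    have "commutator (v s * r) H = (1/2) *\<^sub>C (v s * r)" if "s \<in> S" for s
      using H_v[OF that] commutator_anti[of "v s" H] by (simp add: commutator_mult central_simps mult_scaleC_left)
    thus ?thesis
      unfolding W_R unfolding W_def complex_vector.scale_sum_right
      by (intro sum.cong refl) (simp add: algebra_homD(3)[OF R] bar_S mult_scaleC_right)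
  qed
  ultimately show "intertwines \<Phi> (L H + R H) (L H + R H)"
    by (intro \<Phi>_invariant) (simp add: commutator_linear)
qed

text \<open>The terms \<open>V\<close> cancel, and the terms \<open>I\<^sup>1 \<otimes> E r\<^sup>2\<close> and \<open>I\<^sup>1 \<otimes> r\<^sup>2\<close> add up to \<open>I\<^sup>1 \<otimes> 1\<close>.\<close>

lemma twisted_G_up: "intertwines K (D G_up) (L G_up + R G_up)"
proof -
  have "intertwines J (D e12) (L e12 + R e12)" by (simp add: D_eq J_L0 J_R intertwines_add)
  moreover have "intertwines \<Phi> (L e12 + R e12) (L e12 + (R e12 + V - L I1 * R (E * (r * r))))"
    by (intro intertwines_add \<Phi>_e12 \<Phi>_invariant W_simps)
  ultimately have "intertwines K (D e12 - D I1)
      (L e12 + (R e12 + V - L I1 * R (E * (r * r))) - (L I1 * R (r * r) + R I1 + V))"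
    by (intro intertwines_diff K_I1 intertwines_trans)
  also have "L e12 + (R e12 + V - L I1 * R (E * (r * r))) - (L I1 * R (r * r) + R I1 + V)
      = L e12 + R e12 - L I1 * R ((1 + E) * (r * r)) - R I1"
    unfolding distrib_right mult_1_left algebra_homD(1)[OF R] distrib_left by simp
  finally show ?thesis
    unfolding r_r by (simp add: G_up_def hom algebra_simps)
qed

text \<open>The terms \<open>Y\<close> cancel, and \<open>E \<otimes> I\<^sup>2 r\<^sup>2\<close> from \<open>e\<^sub>2\<^sub>1 \<otimes> 1\<close> reduces \<open>(1 + E) \<otimes> I\<^sup>2 r\<^sup>2\<close> to \<open>1 \<otimes> I\<^sup>2 r\<^sup>2\<close>.\<close>

lemma twisted_G_down: "intertwines K (D G_down) (L G_down + R G_down)"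
proof -
  let ?g = "1 + E" and ?h = "r * r"
  define Z where "Z = (\<Sum>s\<in>S. L (?g * v s) * R (v (bar s) * q))"
  have comm: "x * ?h = ?h * x" if "x \<in> {I2, E} \<union> v ` S" for x
  proof -
    have "commutator (r * r) (v s) = 0" if "s \<in> S" for s
      using that by (simp add: commutator_mult central_simps)
    thus ?thesis using that rr_central(5,6) by (auto simp: commutator_eq_0_iff)
  qed
  have "intertwines J (D e21) (L e21 + R e21)" by (simp add: D_eq J_L0 J_R intertwines_add)
  moreover have "intertwines \<Phi> (L e21 + R e21) (L e21 + Y + L E * R (I2 * ?h) + R e21)"
    by (intro intertwines_add[OF \<Phi>_e21] \<Phi>_invariant W_simps)
  ultimately have "intertwines K (D e21 - D I2 * D ?h) (L e21 + Y + L E * R (I2 * ?h) + R e21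
      - (L I2 * R ?g + L (?g * ?g) * R I2 + Z) * (L ?h * R ?h))"
    unfolding Z_def by (intro intertwines_diff intertwines_mult K_I2 K_g_inverse intertwines_trans)
  also have "(L I2 * R ?g + L (?g * ?g) * R I2 + Z) * (L ?h * R ?h)
      = L (I2 * ?h) * R (?g * ?h) + L (?g * (?g * ?h)) * R (I2 * ?h) + Z * (L ?h * R ?h)"
    by (simp only: distrib_right[of "_ * R _"] distrib_right[of _ Z] algebra_homD(2)[OF L] algebra_homD(2)[OF R]
        RL RL_left mult.assoc)
  also have "Z * (L ?h * R ?h) = Y"
    unfolding Z_def Y_def sum_distrib_right
  proof (intro sum.cong refl)
    fix s assume s: "s \<in> S"
    have "L (?g * v s) * R (v (bar s) * q) * (L ?h * R ?h) = L (?g * (v s * ?h)) * R (v (bar s) * (q * r) * r)"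
      by (simp only: algebra_homD(2)[OF L] algebra_homD(2)[OF R] RL RL_left mult.assoc)
    also have "?g * (v s * ?h) = ?g * ?h * v s" using comm[of "v s"] s by (simp add: mult.assoc)
    finally show "L (?g * v s) * R (v (bar s) * q) * (L ?h * R ?h) = L (v s) * R (v (bar s) * r)"
      by (simp only: r_r q_r mult_1_left mult_1_right)
  qed
  also have "L e21 + Y + L E * R (I2 * ?h) + R e21
      - (L (I2 * ?h) * R (?g * ?h) + L (?g * (?g * ?h)) * R (I2 * ?h) + Y) = L G_down + R G_down"
    unfolding r_r mult_1_right unfolding G_down_def algebra_homD(1,4,7)[OF L] algebra_homD(4,7)[OF R] distrib_right
    by simp
  finally show ?thesis by (simp add: G_down_def hom)
qed

end

section \<open>The links of the chain\<close>

definition A_hat :: "nat \<Rightarrow> nat \<Rightarrow> 'm::enum U_series" where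
  "A_hat i j = so_hat (A_so i j)"

lemma A_hat_bracket:
  assumes "i \<in> {1..CARD('m)}" "j \<in> {1..CARD('m)}" "k \<in> {1..CARD('m)}" "l \<in> {1..CARD('m)}"
  shows "commutator (A_hat i j) (A_hat k l :: 'm::enum U_series) =
      (if j = k then A_hat i l else 0) - (if j = CARD('m) + 1 - l then A_hat i (CARD('m) + 1 - k) else 0)
      - (if k = CARD('m) + 1 - i then A_hat (CARD('m) + 1 - j) l else 0) - (if i = l then A_hat k j else 0)"
  unfolding A_hat_def so_hat_bracket[symmetric] A_so_bracket[OF assms]
  by (simp only: so_hat_linear if_distrib[of so_hat])

lemma A_hat_antidiagonal:
  assumes "i \<in> {1..CARD('m)}" shows "A_hat i (CARD('m) + 1 - i) = (0 :: 'm::enum U_series)"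
proof -
  have j: "CARD('m) + 1 - i \<in> {1..CARD('m)}" and "CARD('m) + 1 - (CARD('m) + 1 - i) = i"
    using assms by auto
  with A_so_flip[OF assms j] have x: "(A_so i (CARD('m) + 1 - i) :: 'm so) = - A_so i (CARD('m) + 1 - i)" by simp
  define x where "x = (A_so i (CARD('m) + 1 - i) :: 'm so)"
  have "x + x = 0" using x unfolding x_def[symmetric] by (simp add: eq_neg_iff_add_eq_0)
  hence "(1/2) *\<^sub>C (x + x) = 0" by simp
  hence "x = 0" by (simp add: scaleC_add_right scaleC_add_left[symmetric] scaleC_one)
  thus ?thesis by (simp add: A_hat_def x_def so_hat_linear)
qed

lemma A_hat_flip:
  assumes "i \<in> {1..CARD('m)}" "j \<in> {1..CARD('m)}"
  shows "A_hat (CARD('m) + 1 - j) (CARD('m) + 1 - i) = - (A_hat i j :: 'm::enum U_series)"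
  unfolding A_hat_def A_so_flip[OF assms] so_hat_linear ..

text \<open>The element \<open>E\<^sub>1\<^sub>+\<^sub>2\<close> of the \<open>k\<close>-th link, and the exponentials \<open>e\<^sup>-\<^sup>\<sigma>\<^sup>/\<^sup>2\<close> and \<open>e\<^sup>\<sigma>\<^sup>/\<^sup>2\<close>, which are the
  inverse square root and the square root of \<open>1 + E\<^sub>1\<^sub>+\<^sub>2\<close>.\<close>

definition root_hat :: "nat \<Rightarrow> 'm::enum U_series" where
  "root_hat k = so_hat (E_plus (2*k+1) (2*k+2))"

definition sqrt_inverse :: "nat \<Rightarrow> 'm::enum U_series" where
  "sqrt_inverse k = exp_hat (- ((1/2) *\<^sub>C sigma k))"

definition sqrt_root :: "nat \<Rightarrow> 'm::enum U_series" where
  "sqrt_root k = exp_hat ((1/2) *\<^sub>C sigma k)"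

lemma A_hat_forms:
  "root_hat k = - (A_hat (2*k+1) (CARD('m) + 1 - (2*k+2)) :: 'm::enum U_series)"
  "H_link_minus k = (1/2) *\<^sub>C (A_hat (2*k+1) (2*k+1) - A_hat (2*k+2) (2*k+2) :: 'm U_series)"
  "H_link_plus k = (1/2) *\<^sub>C (A_hat (2*k+1) (2*k+1) + A_hat (2*k+2) (2*k+2) :: 'm U_series)"
  "so_hat (E_minus i j) = - (A_hat i j :: 'm U_series)"
  "so_hat (E_plus i j) = - (A_hat i (CARD('m) + 1 - j) :: 'm U_series)"
  "so_hat (E_short i) = - (A_hat i (CARD('m) div 2 + 1) :: 'm U_series)"
  by (simp_all add: root_hat_def A_hat_def E_plus_def E_minus_def E_short_def H_link_minus_def H_link_plus_def H_so_def
      so_hat_linear so_hat_add so_hat_scaleC complex_vector.scale_right_diff_distrib scaleC_add_right)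

lemma root_positive:
  assumes "4 * (k + 1) \<le> CARD('m)"
  shows "vanishes_below 1 (root_hat k :: 'm::enum U_series)"
  unfolding A_hat_forms A_hat_def
  by (intro vanishes_below_uminus vanishes_below_so_hat_A) (use assms in auto)

lemma sigma_root: "sigma k = ln1p_hat (root_hat k)"
  by (simp add: sigma_def root_hat_def)

lemma sigma_positive:
  assumes "4 * (k + 1) \<le> CARD('m)"
  shows "vanishes_below 1 (sigma k :: 'm::enum U_series)"
  unfolding sigma_root ln1p_hat_def by (rule vanishes_below_fps_apply[OF root_positive[OF assms]]) simp

lemma sigma_closure:
  assumes "4 * (k + 1) \<le> CARD('m)" "root_hat k \<in> series_closure S"
  shows "sigma k \<in> series_closure (S :: 'm::enum U_series set)"
  unfolding sigma_root ln1p_hat_def by (rule series_closure.apply_fps[OF assms(2) root_positive[OF assms(1)]])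

lemma exp_sigma_closure:
  assumes "4 * (k + 1) \<le> CARD('m)" "root_hat k \<in> series_closure S"
  shows "exp_hat (c *\<^sub>C sigma k) \<in> series_closure (S :: 'm::enum U_series set)"
  unfolding exp_hat_def
  by (intro series_closure.apply_fps series_closure.scale sigma_closure vanishes_below_scaleC sigma_positive assms)

lemma sqrt_closure:
  assumes "4 * (k + 1) \<le> CARD('m)" "root_hat k \<in> series_closure S"
  shows "sqrt_root k \<in> series_closure (S :: 'm::enum U_series set)" "sqrt_inverse k \<in> series_closure S"
  using exp_sigma_closure[OF assms, of "1/2"] exp_sigma_closure[OF assms, of "-1/2"]
  by (simp_all add: sqrt_root_def sqrt_inverse_def)

lemma exp_sigma:
  assumes "4 * (k + 1) \<le> CARD('m)"
  shows "exp_hat (sigma k) = (1 + root_hat k :: 'm::enum U_series)"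
  unfolding sigma_root by (rule exp_ln1p[OF root_positive[OF assms]])

lemma sqrt_mult:
  assumes "4 * (k + 1) \<le> CARD('m)"
  shows "sqrt_root k * sqrt_root k = (1 + root_hat k :: 'm::enum U_series)"
    "sqrt_inverse k * sqrt_inverse k = (exp_hat (- sigma k) :: 'm::enum U_series)"
    "sqrt_root k * sqrt_inverse k = (1 :: 'm::enum U_series)" "sqrt_inverse k * sqrt_root k = (1 :: 'm::enum U_series)"
proof -
  have p: "vanishes_below 1 ((1/2) *\<^sub>C sigma k :: 'm U_series)"
    by (intro vanishes_below_scaleC sigma_positive assms)
  note n = vanishes_below_uminus[OF p]
  show "sqrt_root k * sqrt_root k = (1 + root_hat k :: 'm::enum U_series)"
    unfolding sqrt_root_def exp_hat_add[OF p p refl, symmetric] half_add_half exp_sigma[OF assms] ..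
  have "- ((1/2) *\<^sub>C sigma k) + - ((1/2) *\<^sub>C sigma k) = - (sigma k :: 'm U_series)"
    by (simp only: half_add_half minus_add_distrib[symmetric])
  thus "sqrt_inverse k * sqrt_inverse k = (exp_hat (- sigma k) :: 'm::enum U_series)"
    unfolding sqrt_inverse_def exp_hat_add[OF n n refl, symmetric] by simp
  show "sqrt_root k * sqrt_inverse k = (1 :: 'm::enum U_series)" "sqrt_inverse k * sqrt_root k = (1 :: 'm::enum U_series)"
    unfolding sqrt_root_def sqrt_inverse_def by (rule exp_hat_uminus[OF p])+
qed

lemma commute_exp_sigma:
  assumes k: "4 * (k + 1) \<le> CARD('m)" and x: "commutator (root_hat k) (x :: 'm::enum U_series) = 0"
  shows "commutator (sigma k) x = 0" "commutator (sqrt_root k) x = 0" "commutator (sqrt_inverse k) x = 0"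
    "commutator (exp_hat (- sigma k)) x = 0"
proof -
  have c: "commutator z x = 0" if "z \<in> series_closure {root_hat k}" for z
    using series_closure_commute[OF _ that, of x] x by (simp add: commutator_eq_0_iff)
  have r: "root_hat k \<in> series_closure {root_hat k :: 'm U_series}" by (rule series_closure.base) simp
  show "commutator (sigma k) x = 0" "commutator (sqrt_root k) x = 0" "commutator (sqrt_inverse k) x = 0"
    by (intro c sqrt_closure sigma_closure k r)+
  show "commutator (exp_hat (- sigma k)) x = 0"
    using exp_sigma_closure[OF k r, of "-1"] by (intro c) (simp add: scaleC_one)
qed

abbreviation link_indices :: "'m::enum itself \<Rightarrow> nat \<Rightarrow> nat set" where
  "link_indices _ k \<equiv> {2*k+3..CARD('m) - (2*k+2)}"

abbreviation mirror :: "'m::enum itself \<Rightarrow> nat \<Rightarrow> nat" where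
  "mirror _ s \<equiv> CARD('m) + 1 - s"

lemma link_algebra_so:
  fixes k :: nat
  assumes k: "4 * (k + 1) \<le> CARD('m::enum)"
  shows "link_algebra (link_indices TYPE('m) k) (mirror TYPE('m))
    (A_hat (2*k+1)) (A_hat (2*k+2)) (root_hat k :: 'm U_series) (H_link_minus k)
    (so_hat (E_minus (2*k+1) (2*k+2))) (so_hat (E_minus (2*k+2) (2*k+1)))
    (sqrt_root k) (sqrt_inverse k)"
proof -
  \<comment> \<open>The mirror image \<open>c\<close> of \<open>b\<close> bounds the inner indices; all index comparisons below follow
    from \<open>ord\<close>.\<close>
  define a b c M where "a = 2*k+1" and "b = 2*k+2" and "c = CARD('m) + 1 - b" and "M = CARD('m)"
  note abcM = this
  have ord: "1 \<le> a" "a < b" "b < c" "b + c = M + 1" using k by (auto simp: abcM)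
  have S: "link_indices TYPE('m) k = {b<..<c}" by (auto simp: abcM)
  have rng: "a \<in> {1..M}" "b \<in> {1..M}" "c \<in> {1..M}" "s \<in> {b<..<c} \<Longrightarrow> s \<in> {1..M}" for s
    using ord by auto
  have flip: "Suc M - b = c" "Suc M - c = b" "a \<noteq> Suc M - a" using ord by auto
  have z: "A_hat a (Suc M - a) = (0 :: 'm U_series)" "A_hat b c = (0 :: 'm U_series)"
    using A_hat_antidiagonal[of a, where 'm = 'm] A_hat_antidiagonal[of b, where 'm = 'm] rng
    by (simp_all add: M_def[symmetric] flip)
  note br = A_hat_bracket[where 'm = 'm, folded M_def]
  note bracket = br[OF rng(1) rng(4) rng(1) rng(4)] br[OF rng(2) rng(4) rng(2) rng(4)]
    br[OF rng(1) rng(4) rng(2) rng(4)]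
    br[OF rng(1) rng(1) rng(1) rng(4)] br[OF rng(2) rng(2) rng(1) rng(4)]
    br[OF rng(1) rng(1) rng(2) rng(4)] br[OF rng(2) rng(2) rng(2) rng(4)]
    br[OF rng(1) rng(1) rng(1) rng(2)] br[OF rng(2) rng(2) rng(1) rng(2)]
    br[OF rng(1) rng(1) rng(2) rng(1)] br[OF rng(2) rng(2) rng(2) rng(1)]
    br[OF rng(1) rng(2) rng(1) rng(4)] br[OF rng(2) rng(1) rng(1) rng(4)]
    br[OF rng(1) rng(2) rng(2) rng(4)] br[OF rng(2) rng(1) rng(2) rng(4)]
    br[OF rng(1) rng(2) rng(2) rng(1)]
    br[OF rng(1) rng(3) rng(1) rng(1)] br[OF rng(1) rng(3) rng(2) rng(2)]
    br[OF rng(1) rng(3) rng(1) rng(2)] br[OF rng(1) rng(3) rng(2) rng(1)]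
    br[OF rng(1) rng(3) rng(1) rng(4)] br[OF rng(1) rng(3) rng(2) rng(4)]
  have forms: "root_hat k = - (A_hat a c :: 'm U_series)"
    "H_link_minus k = (1/2) *\<^sub>C (A_hat a a - A_hat b b :: 'm U_series)"
    "so_hat (E_minus a b) = - (A_hat a b :: 'm U_series)" "so_hat (E_minus b a) = - (A_hat b a :: 'm U_series)"
    by (simp_all only: A_hat_forms abcM)
  have neg: "(1/2) *\<^sub>C (- x - x) = - x" for x :: "'m U_series"
  proof -
    have "- x - x = - (x + x)" by simp
    thus ?thesis by (simp only: complex_vector.scale_minus_right double_half)
  qed
  have root: "commutator (root_hat k) x = 0"
    if x: "x \<in> A_hat a ` {b<..<c} \<union> A_hat b ` {b<..<c} \<union> {H_link_minus k, so_hat (E_minus a b), so_hat (E_minus b a)}"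
    for x :: "'m U_series"
    using x ord unfolding forms
    by (auto simp: commutator_linear commutator_diff bracket z flip)
  show ?thesis
    unfolding S unfolding abcM(1,2)[symmetric] M_def[symmetric]
  proof (unfold_locales, goal_cases)
    case (16 d x)
    have "commutator (root_hat k) x = 0" if "x \<in> {root_hat k, sqrt_root k, sqrt_inverse k}" for x :: "'m U_series"
      using that commute_exp_sigma[OF k, of "root_hat k"] commutator_anti[of "root_hat k :: 'm U_series" "sqrt_root k"]
        commutator_anti[of "root_hat k :: 'm U_series" "sqrt_inverse k"] by auto
    with root have "commutator (root_hat k) x = 0" using 16(2) by auto
    with commute_exp_sigma[OF k this] show ?case using 16(1) by auto
  qed (use ord in \<open>auto simp: forms sqrt_mult[OF k] commutator_linear commutator_diff bracket z flip double_half neg\<close>)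
qed

text \<open>The mirror symmetry pairs the indices below the middle with those above it and fixes the middle
  index, which exists for odd \<open>M\<close> only. This is what separates the \<open>\<delta>\<close>-terms from the sums over
  \<open>l\<close> in \<open>I\<^sup>1\<^sup>\<otimes>\<^sup>2\<close> and \<open>I\<^sup>s\<close>, and makes one uniform contraction out of them.\<close>

lemma sum_mirror:
  fixes f :: "nat \<Rightarrow> 'a::comm_monoid_add"
  assumes "1 \<le> c" "c \<le> M div 2 + 1"
  shows "(\<Sum>s=c..M + 1 - c. f s)
    = (if odd M then f (M div 2 + 1) else 0) + (\<Sum>l=c..M div 2. f l + f (M + 1 - l))"
proof -
  define N where "N = M div 2"
  have c: "c \<le> N + 1" using assms by (simp add: N_def)
  have M: "M = (if odd M then 2 * N + 1 else 2 * N)" by (simp add: N_def)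
  have "N \<le> M" by (simp add: N_def)
  have mir: "(\<Sum>l=c..N. f (M + 1 - l)) = (\<Sum>s=M + 1 - N..M + 1 - c. f s)"
    by (rule sum.reindex_bij_witness[of _ "\<lambda>s. M + 1 - s" "\<lambda>s. M + 1 - s"])
      (use assms(1) c \<open>N \<le> M\<close> in auto)
  show ?thesis
  proof (cases "odd M")
    case True
    hence M: "M = 2 * N + 1" using M by simp
    have "{c..M + 1 - c} = {c..N} \<union> ({N + 1} \<union> {M + 1 - N..M + 1 - c})"
      using c assms(1) by (auto simp: M)
    also have "sum f \<dots> = sum f {c..N} + (f (N + 1) + sum f {M + 1 - N..M + 1 - c})"
      by (subst sum.union_disjoint; (subst sum.union_disjoint)?) (auto simp: M)
    finally show ?thesis using True by (simp add: sum.distrib mir add.left_commute flip: N_def del: One_nat_def)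
  next
    case False
    hence M: "M = 2 * N" using M by simp
    have "{c..M + 1 - c} = {c..N} \<union> {M + 1 - N..M + 1 - c}"
      using c assms(1) by (auto simp: M)
    also have "sum f \<dots> = sum f {c..N} + sum f {M + 1 - N..M + 1 - c}"
      by (subst sum.union_disjoint) (auto simp: M)
    finally show ?thesis using False by (simp add: sum.distrib mir flip: N_def del: One_nat_def)
  qed
qed

lemma I_tensor_sum:
  assumes k: "4 * (k + 1) \<le> CARD('m)"
  shows "I_tensor k = (\<Sum>s\<in>link_indices TYPE('m) k. left_leg (A_hat (2*k+1) s)
    * right_leg (A_hat (2*k+2) (mirror TYPE('m) s)) :: 'm::enum UU_series)"
proof -
  let ?f = "\<lambda>s. left_leg (A_hat (2*k+1) s) * right_leg (A_hat (2*k+2) (mirror TYPE('m) s)) :: 'm UU_series"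
  note forms = A_hat_forms tensor_hat_legs algebra_homD(6)[OF algebra_hom_left_leg]
      algebra_homD(6)[OF algebra_hom_right_leg]
  have S: "link_indices TYPE('m) k = {2*k+3..CARD('m) + 1 - (2*k+3)}" by auto
  have mid: "mirror TYPE('m) (CARD('m) div 2 + 1) = CARD('m) div 2 + 1" if "odd CARD('m)"
    using that by presburger
  have dbl: "mirror TYPE('m) (mirror TYPE('m) l) = l" if "l \<in> {2*k+3..CARD('m) div 2}" for l
    using that by auto
  have "(\<Sum>s\<in>link_indices TYPE('m) k. ?f s) = (if odd CARD('m) then ?f (CARD('m) div 2 + 1) else 0)
      + (\<Sum>l=2*k+3..CARD('m) div 2. ?f l + ?f (mirror TYPE('m) l))"
    unfolding S by (rule sum_mirror) (use k in auto)
  also have "(if odd CARD('m) then ?f (CARD('m) div 2 + 1) else 0) = (if odd CARD('m) then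
      so_hat (E_short (2*k+1)) \<otimes>\<^sub>h so_hat (E_short (2*k+2)) else 0 :: 'm UU_series)"
    unfolding forms using mid by (simp del: One_nat_def)
  also have "(\<Sum>l=2*k+3..CARD('m) div 2. ?f l + ?f (mirror TYPE('m) l)) = (\<Sum>l=2*k+3..CARD('m) div 2.
      so_hat (E_plus (2*k+1) l) \<otimes>\<^sub>h so_hat (E_minus (2*k+2) l)
      + so_hat (E_minus (2*k+1) l) \<otimes>\<^sub>h so_hat (E_plus (2*k+2) l))"
  proof (rule sum.cong[OF refl])
    fix l assume l: "l \<in> {2*k+3..CARD('m) div 2}"
    show "?f l + ?f (mirror TYPE('m) l) = so_hat (E_plus (2*k+1) l) \<otimes>\<^sub>h so_hat (E_minus (2*k+2) l)
        + so_hat (E_minus (2*k+1) l) \<otimes>\<^sub>h so_hat (E_plus (2*k+2) l)"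
      unfolding forms dbl[OF l] minus_mult_minus by (rule add.commute)
  qed
  finally show ?thesis unfolding I_tensor_def ..
qed

lemma I_quad_sum:
  assumes k: "4 * (k + 1) \<le> CARD('m)" and s: "s \<in> {1, 2}"
  shows "I_quad k s = (1/2) *\<^sub>C (\<Sum>t\<in>link_indices TYPE('m) k. A_hat (2*k+s) t
    * A_hat (2*k+s) (mirror TYPE('m) t) :: 'm::enum U_series)"
proof -
  let ?A = "\<lambda>t. A_hat (2*k+s) t :: 'm U_series"
  let ?f = "\<lambda>t. ?A t * ?A (mirror TYPE('m) t)"
  interpret link_algebra "link_indices TYPE('m) k" "mirror TYPE('m)" "A_hat (2*k+1)" "A_hat (2*k+2)"
    "root_hat k :: 'm U_series" "H_link_minus k" "so_hat (E_minus (2*k+1) (2*k+2))"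
    "so_hat (E_minus (2*k+2) (2*k+1))" "sqrt_root k" "sqrt_inverse k"
    by (rule link_algebra_so[OF k])
  have S: "link_indices TYPE('m) k = {2*k+3..CARD('m) + 1 - (2*k+3)}" by auto
  have mid: "mirror TYPE('m) (CARD('m) div 2 + 1) = CARD('m) div 2 + 1" if "odd CARD('m)"
    using that by presburger
  have dbl: "mirror TYPE('m) (mirror TYPE('m) l) = l" if "l \<in> {2*k+3..CARD('m) div 2}" for l
    using that by auto
  have comm: "?A t * ?A t' = ?A t' * ?A t" if "t \<in> link_indices TYPE('m) k" "t' \<in> link_indices TYPE('m) k" for t t'
    using uu[OF that] vv[OF that] s by (auto simp: commutator_eq_0_iff)
  have "(\<Sum>t\<in>link_indices TYPE('m) k. ?f t) = (if odd CARD('m) then ?f (CARD('m) div 2 + 1) else 0)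
      + (\<Sum>l=2*k+3..CARD('m) div 2. ?f l + ?f (mirror TYPE('m) l))"
    unfolding S by (rule sum_mirror) (use k in auto)
  also have "(\<Sum>l=2*k+3..CARD('m) div 2. ?f l + ?f (mirror TYPE('m) l))
      = (\<Sum>l=2*k+3..CARD('m) div 2. 2 *\<^sub>C (?A (mirror TYPE('m) l) * ?A l))"
  proof (intro sum.cong refl)
    fix l assume l: "l \<in> {2*k+3..CARD('m) div 2}"
    have "?f l = ?A (mirror TYPE('m) l) * ?A l" by (rule comm) (use l k in auto)
    thus "?f l + ?f (mirror TYPE('m) l) = 2 *\<^sub>C (?A (mirror TYPE('m) l) * ?A l)"
      unfolding dbl[OF l] using scaleC_add_left[of 1 1 "?A (mirror TYPE('m) l) * ?A l"]
      by (simp add: scaleC_one)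
  qed
  finally have "(1/2) *\<^sub>C (\<Sum>t\<in>link_indices TYPE('m) k. ?f t)
      = (if odd CARD('m) then (1/2) *\<^sub>C (?A (CARD('m) div 2 + 1))\<^sup>2 else 0)
        + (\<Sum>l=2*k+3..CARD('m) div 2. ?A (mirror TYPE('m) l) * ?A l)"
    using mid
    by (simp add: scaleC_add_right complex_vector.scale_sum_right scaleC_scaleC scaleC_one power2_eq_square del: One_nat_def)
  also have "\<dots> = I_quad k s"
    unfolding I_quad_def A_hat_forms by (simp del: One_nat_def)
  finally show ?thesis ..
qed

text \<open>The hypothesis gives \<open>(h \<otimes> \<sigma>) (y \<otimes> 1) = (y \<otimes> 1) (h \<otimes> \<sigma> + c (1 \<otimes> \<sigma>))\<close>, and the two summands on the
  right commute, so the exponential of the sum splits.\<close>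

lemma exp_tensor_intertwines:
  fixes h y :: "'m::enum U_series"
  assumes h: "vanishes_below 0 h" and \<sigma>: "vanishes_below 1 \<sigma>" and hy: "commutator h y = c *\<^sub>C y"
  shows "intertwines (exp_hat (h \<otimes>\<^sub>h \<sigma>)) (left_leg y) (left_leg y * right_leg (exp_hat (c *\<^sub>C \<sigma>)))"
proof -
  note hom = algebra_homD[OF algebra_hom_left_leg] algebra_homD[OF algebra_hom_right_leg]
  let ?x = "left_leg h * right_leg \<sigma>" and ?y = "left_leg y" and ?s = "right_leg (c *\<^sub>C \<sigma>)"
  have x: "vanishes_below 1 ?x"
    using vanishes_below_mult[OF vanishes_below_left_leg[OF h] vanishes_below_right_leg[OF \<sigma>]] by simp
  have s: "vanishes_below 1 ?s" by (intro vanishes_below_right_leg vanishes_below_scaleC \<sigma>)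
  have "?x * ?y = left_leg (h * y) * right_leg \<sigma>"
    by (simp add: hom legs_commute mult.assoc)
  also have "h * y = y * h + c *\<^sub>C y" by (rule commutator_eqD[OF hy])
  finally have xy: "?x * ?y = ?y * (?s + ?x)"
    by (simp add: hom distrib_left distrib_right mult_scaleC_left mult_scaleC_right mult.assoc add.commute)
  have sx: "?s * ?x = ?x * ?s"
    by (simp add: hom mult_scaleC_left mult_scaleC_right mult.assoc)
      (simp add: legs_commute flip: mult.assoc)
  have "exp_hat ?x * ?y = ?y * (exp_hat ?s * exp_hat ?x)"
    using fps_apply_intertwine[OF x vanishes_below_add[OF s x] xy] exp_hat_add[OF s x sx]
    by (simp add: exp_hat_def)
  moreover have "exp_hat ?s = right_leg (exp_hat (c *\<^sub>C \<sigma>))"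
    unfolding exp_hat_def right_leg_def
    by (rule fls_map_fps_apply[OF algebra_hom_tensor_right, symmetric]) (intro vanishes_below_scaleC \<sigma>)
  ultimately show ?thesis by (simp add: intertwines_def tensor_hat_legs mult.assoc)
qed

lemma H_plus_weights:
  assumes k: "4 * (k + 1) \<le> CARD('m::enum)"
  shows "s \<in> link_indices TYPE('m) k \<Longrightarrow> commutator (H_link_plus k) (A_hat (2*k+1) s) = (1/2) *\<^sub>C (A_hat (2*k+1) s :: 'm U_series)"
    "s \<in> link_indices TYPE('m) k \<Longrightarrow> commutator (H_link_plus k) (A_hat (2*k+2) s) = (1/2) *\<^sub>C (A_hat (2*k+2) s :: 'm U_series)"
    "commutator (H_link_plus k) (root_hat k) = (root_hat k :: 'm U_series)"
    "commutator (H_link_plus k) (H_link_minus k) = (0 :: 'm U_series)"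
    "commutator (H_link_plus k) (so_hat (E_minus (2*k+1) (2*k+2))) = (0 :: 'm U_series)"
    "commutator (H_link_plus k) (so_hat (E_minus (2*k+2) (2*k+1))) = (0 :: 'm U_series)"
proof -
  define a b c M where "a = 2*k+1" and "b = 2*k+2" and "c = CARD('m) + 1 - b" and "M = CARD('m)"
  note abcM = this
  have ord: "1 \<le> a" "a < b" "b < c" "b + c = M + 1" using k by (auto simp: abcM)
  have S: "link_indices TYPE('m) k = {b<..<c}" by (auto simp: abcM)
  have rng: "a \<in> {1..M}" "b \<in> {1..M}" "c \<in> {1..M}" "s \<in> {b<..<c} \<Longrightarrow> s \<in> {1..M}" for s
    using ord by auto
  have flip: "Suc M - b = c" "Suc M - c = b" "a \<noteq> Suc M - a" using ord by auto
  note br = A_hat_bracket[where 'm = 'm, folded M_def]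
  note bracket =
    br[OF rng(1) rng(1) rng(1) rng(4)] br[OF rng(2) rng(2) rng(1) rng(4)]
    br[OF rng(1) rng(1) rng(2) rng(4)] br[OF rng(2) rng(2) rng(2) rng(4)]
    br[OF rng(1) rng(1) rng(1) rng(2)] br[OF rng(2) rng(2) rng(1) rng(2)]
    br[OF rng(1) rng(1) rng(2) rng(1)] br[OF rng(2) rng(2) rng(2) rng(1)]
    br[OF rng(1) rng(1) rng(2) rng(2)] br[OF rng(2) rng(2) rng(1) rng(1)]
    br[OF rng(1) rng(1) rng(1) rng(3)] br[OF rng(2) rng(2) rng(1) rng(3)]
  have forms: "root_hat k = - (A_hat a c :: 'm U_series)"
    "H_link_minus k = (1/2) *\<^sub>C (A_hat a a - A_hat b b :: 'm U_series)"
    "H_link_plus k = (1/2) *\<^sub>C (A_hat a a + A_hat b b :: 'm U_series)"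
    "so_hat (E_minus a b) = - (A_hat a b :: 'm U_series)" "so_hat (E_minus b a) = - (A_hat b a :: 'm U_series)"
    by (simp_all only: A_hat_forms abcM)
  have fl: "A_hat b (Suc M - a) = - (A_hat a c :: 'm U_series)"
    using A_hat_flip[where 'm = 'm and i = a and j = c] rng flip by (simp add: M_def[symmetric])
  have neg: "- ((1/2) *\<^sub>C x) - (1/2) *\<^sub>C x = - x" for x :: "'m U_series"
    by (simp only: half_add_half diff_conv_add_uminus minus_add_distrib[symmetric])
  note simps = commutator_linear commutator_diff bracket flip scaleC_add_right half_add_half
  show "s \<in> link_indices TYPE('m) k \<Longrightarrow> commutator (H_link_plus k) (A_hat (2*k+1) s) = (1/2) *\<^sub>C (A_hat (2*k+1) s :: 'm U_series)"
    "s \<in> link_indices TYPE('m) k \<Longrightarrow> commutator (H_link_plus k) (A_hat (2*k+2) s) = (1/2) *\<^sub>C (A_hat (2*k+2) s :: 'm U_series)"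
    "commutator (H_link_plus k) (root_hat k) = (root_hat k :: 'm U_series)"
    "commutator (H_link_plus k) (H_link_minus k) = (0 :: 'm U_series)"
    "commutator (H_link_plus k) (so_hat (E_minus (2*k+1) (2*k+2))) = (0 :: 'm U_series)"
    "commutator (H_link_plus k) (so_hat (E_minus (2*k+2) (2*k+1))) = (0 :: 'm U_series)"
    unfolding S unfolding abcM(1,2)[symmetric] forms using ord by (auto simp: simps fl neg)
qed

lemma vanishes_below_jordanian_exponent:
  assumes k: "4 * (k + 1) \<le> CARD('m::enum)"
  shows "vanishes_below 0 (H_link_plus k :: 'm U_series)"
    and "vanishes_below 1 (H_link_plus k \<otimes>\<^sub>h sigma k :: 'm UU_series)"
proof -
  show h: "vanishes_below 0 (H_link_plus k :: 'm U_series)"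
    unfolding H_link_plus_def so_hat_add
    by (intro vanishes_below_add vanishes_below_so_hat_H) (use k in auto)
  show "vanishes_below 1 (H_link_plus k \<otimes>\<^sub>h sigma k :: 'm UU_series)"
    unfolding tensor_hat_legs
    using vanishes_below_mult[OF vanishes_below_left_leg[OF h] vanishes_below_right_leg[OF sigma_positive[OF k]]]
    by simp
qed

lemma extension_exponent:
  fixes k :: nat
  assumes k: "4 * (k + 1) \<le> CARD('m::enum)"
  defines "W \<equiv> I_tensor k * (1 \<otimes>\<^sub>h sqrt_inverse k) :: 'm UU_series"
  shows "W = (\<Sum>s\<in>link_indices TYPE('m) k. left_leg (A_hat (2*k+1) s)
      * right_leg (A_hat (2*k+2) (mirror TYPE('m) s) * sqrt_inverse k))"
    and "vanishes_below 1 W"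
proof -
  note hom = algebra_homD[OF algebra_hom_left_leg] algebra_homD[OF algebra_hom_right_leg]
  let ?u = "A_hat (2*k+1) :: nat \<Rightarrow> 'm U_series" and ?v = "A_hat (2*k+2) :: nat \<Rightarrow> 'm U_series"
  show W: "W = (\<Sum>s\<in>link_indices TYPE('m) k. left_leg (?u s) * right_leg (?v (mirror TYPE('m) s) * sqrt_inverse k))"
    by (simp add: W_def I_tensor_sum[OF k] tensor_hat_legs sum_distrib_right hom mult.assoc)
  have rv: "vanishes_below 0 (sqrt_inverse k :: 'm U_series)"
    unfolding sqrt_inverse_def exp_hat_def by (rule vanishes_below_fps_apply_0)
  show "vanishes_below 1 W"
    unfolding W
  proof (intro vanishes_below_sum)
    fix s assume s: "s \<in> link_indices TYPE('m) k"
    have "vanishes_below 1 (?u s)" "vanishes_below 1 (?v (mirror TYPE('m) s))"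
      unfolding A_hat_def by (intro vanishes_below_so_hat_A; use s k in auto)+
    from vanishes_below_mult[OF vanishes_below_left_leg[OF this(1)]
        vanishes_below_right_leg[OF vanishes_below_mult[OF this(2) rv]]]
    show "vanishes_below 1 (left_leg (?u s) * right_leg (?v (mirror TYPE('m) s) * sqrt_inverse k))"
      by (rule vanishes_below_mono) simp
  qed
qed

lemma twisted_link_so:
  fixes k :: nat
  assumes k: "4 * (k + 1) \<le> CARD('m::enum)"
  shows "twisted_link (link_indices TYPE('m) k) (mirror TYPE('m))
    (A_hat (2*k+1)) (A_hat (2*k+2)) (root_hat k :: 'm U_series) (H_link_minus k)
    (so_hat (E_minus (2*k+1) (2*k+2))) (so_hat (E_minus (2*k+2) (2*k+1)))
    (sqrt_root k) (sqrt_inverse k) left_leg right_leg coproduct_hat (Phi_J k) (Phi_E k)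
    (I_tensor k * (1 \<otimes>\<^sub>h sqrt_inverse k))"
proof -
  let ?S = "link_indices TYPE('m) k" and ?b = "mirror TYPE('m)"
  let ?u = "A_hat (2*k+1) :: nat \<Rightarrow> 'm U_series" and ?v = "A_hat (2*k+2) :: nat \<Rightarrow> 'm U_series"
  let ?W = "I_tensor k * (1 \<otimes>\<^sub>h sqrt_inverse k) :: 'm UU_series"
  let ?e12 = "so_hat (E_minus (2*k+1) (2*k+2)) :: 'm U_series"
  let ?e21 = "so_hat (E_minus (2*k+2) (2*k+1)) :: 'm U_series"
  interpret link_algebra ?S ?b ?u ?v "root_hat k" "H_link_minus k" ?e12 ?e21 "sqrt_root k" "sqrt_inverse k"
    by (rule link_algebra_so[OF k])
  note hom = algebra_homD[OF algebra_hom_left_leg] algebra_homD[OF algebra_hom_right_leg]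
  note h = vanishes_below_jordanian_exponent(1)[OF k] and x = vanishes_below_jordanian_exponent(2)[OF k]
  note J_L = exp_tensor_intertwines[OF h sigma_positive[OF k], folded Phi_J_def]
  note W = extension_exponent(1)[OF k] and Wp = extension_exponent(2)[OF k]
  have root: "commutator (root_hat k) y = 0"
    if "y \<in> ?u ` ?S \<union> ?v ` ?S \<union> {root_hat k, H_link_minus k, ?e12, ?e21}" for y
    using central[of "root_hat k" y] that by blast
  show ?thesis
  proof (unfold_locales, goal_cases)
    case 1 show ?case by (rule algebra_hom_left_leg)
  next
    case 2 show ?case by (rule algebra_hom_right_leg)
  next
    case 3 show ?case by (rule algebra_hom_coproduct_hat)
  next
    case 4 show ?case by (rule legs_commute)
  next
    case (5 y)
    hence "y \<in> range so_hat" by (auto simp: A_hat_def root_hat_def H_link_minus_def)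
    thus ?case by (auto simp: coproduct_so_hat)
  next
    case (6 y)
    hence "commutator (H_link_plus k) y = (1/2) *\<^sub>C y" using H_plus_weights(1,2)[OF k] by auto
    from J_L[OF this] show ?case by (simp add: sqrt_root_def)
  next
    case 7
    have "commutator (H_link_plus k) (root_hat k) = 1 *\<^sub>C (root_hat k :: 'm U_series)"
      by (simp add: H_plus_weights(3)[OF k] scaleC_one)
    from J_L[OF this] show ?case by (simp add: sqrt_mult[OF k] exp_sigma[OF k] scaleC_one)
  next
    case (8 y)
    hence "commutator (H_link_plus k) y = 0 *\<^sub>C y" using H_plus_weights(4-6)[OF k] by auto
    from J_L[OF this] show ?case by (simp add: exp_hat_0 hom)
  next
    case (9 y)
    hence "commutator (sigma k) y = 0" by (intro commute_exp_sigma(1)[OF k] root) auto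
    hence c: "right_leg (sigma k) * right_leg y = right_leg y * right_leg (sigma k)"
      by (simp add: commutator_eq_0_iff flip: hom)
    have "(H_link_plus k \<otimes>\<^sub>h sigma k) * right_leg y = right_leg y * (H_link_plus k \<otimes>\<^sub>h sigma k)"
      unfolding tensor_hat_legs by (simp only: mult.assoc c) (simp only: mult.assoc[symmetric] legs_commute)
    from fps_apply_intertwine[OF x x this] show ?case
      by (simp add: intertwines_def Phi_J_def exp_hat_def)
  next
    case 10 show ?case by (rule W)
  next
    case (11 y z w)
    have "exp_hat ?W * y = (y + z + (1/2) *\<^sub>C w) * exp_hat ?W"
      by (rule exp_hat_conjugate[OF Wp commutator_eqD[OF 11(1)] commutator_eqD[OF 11(2)]])
        (use 11(3) in \<open>simp add: commutator_eq_0_iff\<close>)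
    thus ?case by (simp add: intertwines_def Phi_E_def sqrt_inverse_def)
  qed
qed

lemma link_primitive:
  assumes k: "4 * (k + 1) \<le> CARD('m::enum)"
  shows "x \<in> {H_link_minus k, G12 k, G21 k :: 'm U_series} \<Longrightarrow>
      intertwines (Phi_E k * Phi_J k) (coproduct_hat x) (left_leg x + right_leg x)"
    and "commutator (H_link_minus k) (G12 k) = (G12 k :: 'm U_series)"
    and "commutator (H_link_minus k) (G21 k) = - (G21 k :: 'm U_series)"
    and "commutator (G12 k) (G21 k) = 2 *\<^sub>C (H_link_minus k :: 'm U_series)"
proof -
  interpret twisted_link "link_indices TYPE('m) k" "mirror TYPE('m)" "A_hat (2*k+1)" "A_hat (2*k+2)"
    "root_hat k :: 'm U_series" "H_link_minus k" "so_hat (E_minus (2*k+1) (2*k+2))"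
    "so_hat (E_minus (2*k+2) (2*k+1))" "sqrt_root k" "sqrt_inverse k" left_leg right_leg coproduct_hat
    "Phi_J k" "Phi_E k" "I_tensor k * (1 \<otimes>\<^sub>h sqrt_inverse k)"
    by (rule twisted_link_so[OF k])
  have "I_quad k 1 = I1" "I_quad k 2 = I2"
    unfolding I1_def I2_def by (rule I_quad_sum[OF k]; simp)+
  hence G: "G_up = G12 k" "G_down = G21 k"
    unfolding G_up_def G_down_def G12_def G21_def sqrt_mult(2)[OF k] by simp_all
  show "intertwines (Phi_E k * Phi_J k) (coproduct_hat x) (left_leg x + right_leg x)"
    if "x \<in> {H_link_minus k, G12 k, G21 k}"
    using that twisted_H twisted_G_up twisted_G_down unfolding G by auto
  show "commutator (H_link_minus k) (G12 k) = (G12 k :: 'm U_series)"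
    "commutator (H_link_minus k) (G21 k) = - (G21 k :: 'm U_series)"
    "commutator (G12 k) (G21 k) = 2 *\<^sub>C (H_link_minus k :: 'm U_series)"
    using H_G_up H_G_down G_up_G_down unfolding G .
qed

section \<open>Interaction of the links\<close>

lemma so_sub_induct [consumes 1, case_names gen zero add scale]:
  fixes y :: "'m::enum so"
  assumes "y \<in> so_sub m"
    and gen: "\<And>i j. i \<in> {m + 1..CARD('m) - m} \<Longrightarrow> j \<in> {m + 1..CARD('m) - m} \<Longrightarrow> P (A_so i j)"
    and zero: "P 0" and add: "\<And>x y. P x \<Longrightarrow> P y \<Longrightarrow> P (x + y)" and scale: "\<And>c x. P x \<Longrightarrow> P (c *\<^sub>C x)"
  shows "P y"
  using assms(1) unfolding so_sub_def
proof (rule complex_vector.span_induct)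
  show "complex_vector.subspace {y. P y}"
    by (rule complex_vector.subspaceI) (simp_all add: zero add scale)
qed (use gen in blast)

lemma A_so_sub: "i \<in> {m + 1..CARD('m) - m} \<Longrightarrow> j \<in> {m + 1..CARD('m) - m} \<Longrightarrow> (A_so i j :: 'm::enum so) \<in> so_sub m"
  unfolding so_sub_def by (rule complex_vector.span_base) blast

lemma so_sub_mono: "m \<le> n \<Longrightarrow> so_sub n \<subseteq> (so_sub m :: 'm::enum so set)"
  unfolding so_sub_def by (intro complex_vector.span_mono) fastforce

lemma so_sub_subspace: "complex_vector.subspace (so_sub m)"
  unfolding so_sub_def by (rule complex_vector.subspace_span)

lemma so_sub_bracket:
  fixes x y :: "'m::enum so"
  assumes "x \<in> so_sub m" "y \<in> so_sub m"
  shows "lie_bracket x y \<in> so_sub m"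
proof -
  note sub = complex_vector.subspace_0[OF so_sub_subspace] complex_vector.subspace_add[OF so_sub_subspace]
    complex_vector.subspace_scale[OF so_sub_subspace] complex_vector.subspace_diff[OF so_sub_subspace]
  have "lie_bracket (A_so i j) y \<in> so_sub m"
    if ij: "i \<in> {m + 1..CARD('m) - m}" "j \<in> {m + 1..CARD('m) - m}" for i j
    using assms(2)
  proof (induction rule: so_sub_induct)
    case (gen k l)
    have mem: "n \<in> {1..CARD('m)}" "CARD('m) + 1 - n \<in> {m + 1..CARD('m) - m}"
      if "n \<in> {m + 1..CARD('m) - m}" for n using that by auto
    note r = mem(1)[OF ij(1)] mem(1)[OF ij(2)] mem(1)[OF gen(1)] mem(1)[OF gen(2)]
    have c: "(if b then x else 0) \<in> so_sub m" if "x \<in> so_sub m" for b and x :: "'m so"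
      using that by (simp add: sub(1))
    show ?case
      unfolding A_so_bracket[OF r] by (intro sub(4) c A_so_sub ij gen mem(2))
  qed (simp_all add: lie_bracket_zero lie_add_right lie_scaleC_right sub)
  with assms(1) show ?thesis
    by (induction rule: so_sub_induct) (simp_all add: lie_bracket_zero lie_add_left lie_scaleC_left sub)
qed

abbreviation so_series :: "nat \<Rightarrow> 'm::enum U_series set" where
  "so_series m \<equiv> series_closure (so_hat ` so_sub m)"

abbreviation leg_series :: "nat \<Rightarrow> 'm::enum UU_series set" where
  "leg_series m \<equiv> series_closure (left_leg ` so_hat ` so_sub m \<union> right_leg ` so_hat ` so_sub m)"

lemma so_series_mono: "m \<le> n \<Longrightarrow> so_series n \<subseteq> (so_series m :: 'm::enum U_series set)"
  by (intro series_closure_mono image_mono so_sub_mono)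

lemma leg_series_mono: "m \<le> n \<Longrightarrow> leg_series n \<subseteq> (leg_series m :: 'm::enum UU_series set)"
  by (intro series_closure_mono Un_mono image_mono so_sub_mono)

lemma leg_series_legs:
  assumes "z \<in> so_series m" shows "left_leg z \<in> leg_series m" "right_leg z \<in> leg_series m"
proof -
  have "left_leg z \<in> series_closure (left_leg ` so_hat ` so_sub m)"
    using series_closure_fls_map[OF algebra_hom_tensor_left assms] by (simp add: left_leg_def)
  thus "left_leg z \<in> leg_series m" using series_closure_mono[OF Un_upper1] by blast
  have "right_leg z \<in> series_closure (right_leg ` so_hat ` so_sub m)"
    using series_closure_fls_map[OF algebra_hom_tensor_right assms] by (simp add: right_leg_def)
  thus "right_leg z \<in> leg_series m" using series_closure_mono[OF Un_upper2] by blast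
qed

lemma so_series_commute:
  assumes "z \<in> so_series m" and "\<And>y. y \<in> so_sub m \<Longrightarrow> commutator (so_hat y) x = 0"
  shows "commutator z x = 0"
  using series_closure_commute[OF _ assms(1), of x] assms(2) by (auto simp: commutator_eq_0_iff)

lemma A_hat_so_series:
  "i \<in> {m + 1..CARD('m) - m} \<Longrightarrow> j \<in> {m + 1..CARD('m) - m} \<Longrightarrow> (A_hat i j :: 'm::enum U_series) \<in> so_series m"
  unfolding A_hat_def by (intro series_closure.base imageI A_so_sub)

lemma link_so_series:
  assumes k: "4 * (k + 1) \<le> CARD('m::enum)"
  shows "(root_hat k :: 'm U_series) \<in> so_series (2*k)" "(sigma k :: 'm U_series) \<in> so_series (2*k)"
    "(sqrt_inverse k :: 'm U_series) \<in> so_series (2*k)"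
    "(H_link_plus k :: 'm U_series) \<in> so_series (2*k)" "(H_link_minus k :: 'm U_series) \<in> so_series (2*k)"
    "(G12 k :: 'm U_series) \<in> so_series (2*k)" "(G21 k :: 'm U_series) \<in> so_series (2*k)"
proof -
  note cl = series_closure.intros series_closure_uminus series_closure_diff series_closure_sum
  have A: "(A_hat i j :: 'm U_series) \<in> so_series (2*k)"
    if "2*k+1 \<le> i" "i \<le> CARD('m) - 2*k" "2*k+1 \<le> j" "j \<le> CARD('m) - 2*k" for i j
    by (rule A_hat_so_series) (use that in auto)
  show root: "(root_hat k :: 'm U_series) \<in> so_series (2*k)"
    unfolding A_hat_forms by (intro series_closure_uminus A) (use k in auto)
  show "(sigma k :: 'm U_series) \<in> so_series (2*k)" "(sqrt_inverse k :: 'm U_series) \<in> so_series (2*k)"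
    by (rule sigma_closure[OF k root] sqrt_closure[OF k root])+
  show "(H_link_plus k :: 'm U_series) \<in> so_series (2*k)" "(H_link_minus k :: 'm U_series) \<in> so_series (2*k)"
    unfolding A_hat_forms
    by (intro series_closure.scale series_closure.add series_closure_diff A; use k in simp)+
  have I: "(I_quad k s :: 'm U_series) \<in> so_series (2*k)" if s: "s \<in> {1, 2}" for s
    unfolding I_quad_sum[OF k s]
  proof (intro series_closure.scale series_closure_sum series_closure.mult)
    fix t assume t: "t \<in> link_indices TYPE('m) k"
    show "(A_hat (2*k+s) t :: 'm U_series) \<in> so_series (2*k)"
      "(A_hat (2*k+s) (mirror TYPE('m) t) :: 'm U_series) \<in> so_series (2*k)"
      by (intro A; use s t k in auto)+
  qed
  have e: "(so_hat (E_minus (2*k+1) (2*k+2)) :: 'm U_series) \<in> so_series (2*k)"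
    "(so_hat (E_minus (2*k+2) (2*k+1)) :: 'm U_series) \<in> so_series (2*k)"
    unfolding A_hat_forms by (intro series_closure_uminus A; use k in auto)+
  have x: "exp_hat (- sigma k :: 'm U_series) \<in> so_series (2*k)"
    using exp_sigma_closure[OF k root, of "-1"] by (simp add: scaleC_one)
  show "(G12 k :: 'm U_series) \<in> so_series (2*k)" "(G21 k :: 'm U_series) \<in> so_series (2*k)"
    unfolding G12_def G21_def by (intro series_closure_diff series_closure.mult e I x; simp)+
qed

lemma exp_hat_closure:
  "x \<in> series_closure S \<Longrightarrow> vanishes_below 1 x \<Longrightarrow> exp_hat x \<in> series_closure S"
  unfolding exp_hat_def by (rule series_closure.apply_fps)

lemma exponents_leg_series:
  assumes k: "4 * (k + 1) \<le> CARD('m::enum)"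
  shows "(H_link_plus k \<otimes>\<^sub>h sigma k :: 'm UU_series) \<in> leg_series (2*k)"
    "(I_tensor k * (1 \<otimes>\<^sub>h sqrt_inverse k) :: 'm UU_series) \<in> leg_series (2*k)"
proof -
  show "(H_link_plus k \<otimes>\<^sub>h sigma k :: 'm UU_series) \<in> leg_series (2*k)"
    unfolding tensor_hat_legs by (intro series_closure.mult leg_series_legs link_so_series k)
  show "(I_tensor k * (1 \<otimes>\<^sub>h sqrt_inverse k) :: 'm UU_series) \<in> leg_series (2*k)"
    unfolding extension_exponent(1)[OF k]
    by (intro series_closure_sum series_closure.mult leg_series_legs link_so_series k A_hat_so_series; use k in auto)
qed

lemma Phi_leg_series:
  assumes k: "4 * (k + 1) \<le> CARD('m::enum)"
  shows "(Phi_E k * Phi_J k :: 'm UU_series) \<in> leg_series (2*k)"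
  unfolding Phi_E_def Phi_J_def sqrt_inverse_def[symmetric]
  by (intro series_closure.mult exp_hat_closure exponents_leg_series extension_exponent(2)
      vanishes_below_jordanian_exponent k)

lemma Phi_inverse:
  assumes k: "4 * (k + 1) \<le> CARD('m::enum)"
  shows "\<exists>G \<in> leg_series (2*k). Phi_E k * Phi_J k * G = 1 \<and> G * (Phi_E k * Phi_J k :: 'm UU_series) = 1"
proof -
  define x y where "x = (I_tensor k * (1 \<otimes>\<^sub>h sqrt_inverse k) :: 'm UU_series)"
    and "y = (H_link_plus k \<otimes>\<^sub>h sigma k :: 'm UU_series)"
  have p: "vanishes_below 1 x" "vanishes_below 1 y"
    unfolding x_def y_def by (rule extension_exponent(2)[OF k] vanishes_below_jordanian_exponent(2)[OF k])+
  have m: "x \<in> leg_series (2*k)" "y \<in> leg_series (2*k)"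
    unfolding x_def y_def by (rule exponents_leg_series[OF k])+
  have P: "Phi_E k = exp_hat x" "Phi_J k = exp_hat y"
    by (simp_all add: Phi_E_def Phi_J_def sqrt_inverse_def x_def y_def)
  have "exp_hat x * exp_hat y * (exp_hat (- y) * exp_hat (- x)) = exp_hat x * (exp_hat y * exp_hat (- y)) * exp_hat (- x)"
    "exp_hat (- y) * exp_hat (- x) * (exp_hat x * exp_hat y) = exp_hat (- y) * (exp_hat (- x) * exp_hat x) * exp_hat y"
    by (simp_all only: mult.assoc)
  hence "exp_hat x * exp_hat y * (exp_hat (- y) * exp_hat (- x)) = 1"
    "exp_hat (- y) * exp_hat (- x) * (exp_hat x * exp_hat y) = 1"
    by (simp_all add: exp_hat_uminus[OF p(1)] exp_hat_uminus[OF p(2)])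
  moreover have "exp_hat (- y) * exp_hat (- x) \<in> leg_series (2*k)"
    by (intro series_closure.mult exp_hat_closure series_closure_uminus vanishes_below_uminus p m)
  ultimately show ?thesis unfolding P by blast
qed

text \<open>An outer row \<open>(A\<^sub>r\<^sub>s)\<^sub>s\<close> spans a copy of the vector representation of the inner subalgebra.\<close>

lemma A_hat_row:
  fixes i j s r m :: nat
  assumes "i \<in> {m..CARD('m) + 1 - m}" "j \<in> {m..CARD('m) + 1 - m}" "s \<in> {m..CARD('m) + 1 - m}" "1 \<le> r" "r < m"
  shows "commutator (A_hat i j) (A_hat r s) = (if s = mirror TYPE('m) j then A_hat r (mirror TYPE('m) i) else 0)
    - (if s = i then A_hat r j else 0 :: 'm::enum U_series)"
proof -
  have rng: "i \<in> {1..CARD('m)}" "j \<in> {1..CARD('m)}" "s \<in> {1..CARD('m)}" "r \<in> {1..CARD('m)}"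
    "CARD('m) + 1 - i \<in> {1..CARD('m)}" using assms by auto
  have fl: "A_hat i (CARD('m) + 1 - r) = - (A_hat r (CARD('m) + 1 - i) :: 'm U_series)"
    using A_hat_flip[OF rng(4,5)] rng(1) by (simp del: One_nat_def)
  have ne: "j \<noteq> r" "r \<noteq> CARD('m) + 1 - i" "j = CARD('m) + 1 - s \<longleftrightarrow> s = CARD('m) + 1 - j" "i = s \<longleftrightarrow> s = i"
    using assms by auto
  show ?thesis
    unfolding A_hat_bracket[OF rng(1,2,4,3)] ne(3,4) fl using ne(1,2) by (simp del: One_nat_def)
qed

lemma link_commutes_A_hat:
  assumes k: "4 * (k + 1) \<le> CARD('m::enum)"
    and i: "i \<in> link_indices TYPE('m) k" and j: "j \<in> link_indices TYPE('m) k"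
  shows "commutator (A_hat i j) (root_hat k) = (0 :: 'm U_series)"
    "commutator (A_hat i j) (H_link_minus k) = (0 :: 'm U_series)"
    "commutator (A_hat i j) (H_link_plus k) = (0 :: 'm U_series)"
    "commutator (A_hat i j) (so_hat (E_minus (2*k+1) (2*k+2))) = (0 :: 'm U_series)"
    "commutator (A_hat i j) (so_hat (E_minus (2*k+2) (2*k+1))) = (0 :: 'm U_series)"
    "s \<in> {1, 2} \<Longrightarrow> commutator (A_hat i j) (I_quad k s) = (0 :: 'm U_series)"
    "commutator (coproduct_hat (A_hat i j)) (I_tensor k) = (0 :: 'm UU_series)"
proof -
  have rng: "i \<in> {1..CARD('m)}" "j \<in> {1..CARD('m)}" "2*k+1 \<in> {1..CARD('m)}" "2*k+2 \<in> {1..CARD('m)}"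
    "CARD('m) + 1 - (2*k+2) \<in> {1..CARD('m)}" using i j k by auto
  have b: "commutator (A_hat i j) (A_hat r t) = (0 :: 'm U_series)"
    if "r \<in> {2*k+1, 2*k+2}" "t \<in> {2*k+1, 2*k+2, CARD('m) + 1 - (2*k+2)}" for r t
  proof -
    have "r \<in> {1..CARD('m)}" "t \<in> {1..CARD('m)}" using that rng by blast+
    moreover have "j \<noteq> r" "j \<noteq> CARD('m) + 1 - t" "r \<noteq> CARD('m) + 1 - i" "i \<noteq> t" using that i j k by auto
    ultimately show ?thesis by (simp add: A_hat_bracket[OF rng(1,2)] del: One_nat_def)
  qed
  show "commutator (A_hat i j) (root_hat k) = (0 :: 'm U_series)"
    "commutator (A_hat i j) (H_link_minus k) = (0 :: 'm U_series)"
    "commutator (A_hat i j) (H_link_plus k) = (0 :: 'm U_series)"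
    "commutator (A_hat i j) (so_hat (E_minus (2*k+1) (2*k+2))) = (0 :: 'm U_series)"
    "commutator (A_hat i j) (so_hat (E_minus (2*k+2) (2*k+1))) = (0 :: 'm U_series)"
    unfolding A_hat_forms commutator_diff commutator_linear by (subst b; (subst b)?; simp)+
  have S: "link_indices TYPE('m) k = {2*k+3..CARD('m) + 1 - (2*k+3)}" by auto
  have bar: "mirror TYPE('m) ` link_indices TYPE('m) k \<subseteq> link_indices TYPE('m) k"
    "\<And>s. s \<in> link_indices TYPE('m) k \<Longrightarrow> mirror TYPE('m) (mirror TYPE('m) s) = s" by auto
  note row = A_hat_row[OF i[unfolded S] j[unfolded S], folded S]
  have row': "commutator (A_hat i j) (A_hat (2*k+r) s) = (if s = mirror TYPE('m) j then A_hat (2*k+r) (mirror TYPE('m) i) else 0)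
    - (if s = i then A_hat (2*k+r) j else 0 :: 'm U_series)"
    if "s \<in> link_indices TYPE('m) k" "r \<in> {1, 2}" for r s
    by (rule row[OF that(1)]) (use that(2) in auto)
  show "commutator (A_hat i j) (I_quad k s) = (0 :: 'm U_series)" if s: "s \<in> {1, 2}"
    unfolding I_quad_sum[OF k s] commutator_linear
    by (subst commutator_contraction[OF _ bar i j row'[OF _ s] row'[OF _ s]]) auto
  have leg: "commutator (coproduct_hat (A_hat i j)) (left_leg y) = left_leg (commutator (A_hat i j) y)"
    "commutator (coproduct_hat (A_hat i j)) (right_leg y) = right_leg (commutator (A_hat i j) y)"
    for y :: "'m U_series"
    by (simp_all add: A_hat_def coproduct_so_hat commutator_def legs_commute algebra_simps
        algebra_homD[OF algebra_hom_left_leg] algebra_homD[OF algebra_hom_right_leg])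
  show "commutator (coproduct_hat (A_hat i j)) (I_tensor k) = (0 :: 'm UU_series)"
    unfolding I_tensor_sum[OF k]
  proof (rule commutator_contraction[OF _ bar i j])
    fix s assume s: "s \<in> link_indices TYPE('m) k"
    show "commutator (coproduct_hat (A_hat i j)) (left_leg (A_hat (2*k+1) s))
      = (if s = mirror TYPE('m) j then left_leg (A_hat (2*k+1) (mirror TYPE('m) i)) else 0)
        - (if s = i then left_leg (A_hat (2*k+1) j) else 0 :: 'm UU_series)"
      using row'[OF s, of 1] by (simp add: leg algebra_homD[OF algebra_hom_left_leg] del: One_nat_def)
    show "commutator (coproduct_hat (A_hat i j)) (right_leg (A_hat (2*k+2) s))
      = (if s = mirror TYPE('m) j then right_leg (A_hat (2*k+2) (mirror TYPE('m) i)) else 0)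
        - (if s = i then right_leg (A_hat (2*k+2) j) else 0 :: 'm UU_series)"
      using row'[OF s, of 2] by (simp add: leg algebra_homD[OF algebra_hom_right_leg] del: One_nat_def)
  qed simp
qed

lemma link_commutes_so_sub:
  assumes k: "4 * (k + 1) \<le> CARD('m::enum)" and y: "(y :: 'm so) \<in> so_sub (2 * (k + 1))"
  shows "commutator (so_hat y) (sigma k) = 0" "commutator (so_hat y) (sqrt_inverse k) = 0"
    "commutator (so_hat y) (H_link_minus k) = 0" "commutator (so_hat y) (H_link_plus k) = 0"
    "commutator (so_hat y) (G12 k) = 0" "commutator (so_hat y) (G21 k) = 0"
    "commutator (coproduct_hat (so_hat y)) (I_tensor k) = 0"
proof -
  have S: "{2 * (k + 1) + 1..CARD('m) - 2 * (k + 1)} = link_indices TYPE('m) k" by auto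
  have lin: "commutator (so_hat y) x = 0"
    if "\<And>i j. i \<in> link_indices TYPE('m) k \<Longrightarrow> j \<in> link_indices TYPE('m) k \<Longrightarrow> commutator (A_hat i j) x = 0" for x
    using y
  proof (induction rule: so_sub_induct)
    case (gen i j)
    thus ?case using that unfolding S by (simp add: A_hat_def)
  qed (simp_all add: so_hat_linear so_hat_add so_hat_scaleC commutator_linear)
  note g = link_commutes_A_hat[OF k]
  have root: "commutator (so_hat y) (root_hat k) = 0" by (rule lin[OF g(1)])
  hence "commutator (root_hat k) (so_hat y) = 0" using commutator_anti[of "root_hat k" "so_hat y"] by simp
  note s = commute_exp_sigma[OF k this]
  have anti: "commutator (so_hat y) x = 0" if "commutator x (so_hat y) = 0" for x
    using that commutator_anti[of "so_hat y" x] by simp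
  show "commutator (so_hat y) (sigma k) = 0" "commutator (so_hat y) (sqrt_inverse k) = 0"
    by (rule anti[OF s(1)] anti[OF s(3)])+
  show "commutator (so_hat y) (G21 k) = 0"
  proof -
    have "commutator (so_hat y) (so_hat (E_minus (2*k+2) (2*k+1))) = 0"
      "commutator (so_hat y) (I_quad k 2) = 0"
      by (rule lin[OF g(5)] lin[OF g(6)]; simp)+
    thus ?thesis unfolding G21_def commutator_diff commutator_mult anti[OF s(4)] by simp
  qed
  show "commutator (so_hat y) (H_link_minus k) = 0" by (rule lin[OF g(2)])
  show "commutator (so_hat y) (H_link_plus k) = 0" by (rule lin[OF g(3)])
  show "commutator (so_hat y) (G12 k) = 0"
  proof -
    have "commutator (so_hat y) (so_hat (E_minus (2*k+1) (2*k+2))) = 0"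
      "commutator (so_hat y) (I_quad k 1) = 0"
      by (rule lin[OF g(4)] lin[OF g(6)]; simp)+
    thus ?thesis unfolding G12_def commutator_diff by simp
  qed
  show "commutator (coproduct_hat (so_hat y)) (I_tensor k) = 0"
    using y
  proof (induction rule: so_sub_induct)
    case (gen i j)
    thus ?case using g(7) unfolding S by (simp add: A_hat_def)
  qed (simp_all add: so_hat_linear so_hat_add so_hat_scaleC commutator_linear algebra_homD[OF algebra_hom_coproduct_hat])
qed

lemma exp_hat_commute:
  "vanishes_below 1 x \<Longrightarrow> commutator x y = 0 \<Longrightarrow> commutator (exp_hat x) y = 0"
  unfolding commutator_eq_0_iff exp_hat_def by (rule fps_apply_intertwine)

lemma Phi_commutes_coproduct_so_hat:
  assumes k: "4 * (k + 1) \<le> CARD('m::enum)" and y: "(y :: 'm so) \<in> so_sub (2 * (k + 1))"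
  shows "commutator (coproduct_hat (so_hat y)) (Phi_E k * Phi_J k) = 0"
proof -
  note c = link_commutes_so_sub[OF k y]
  have leg: "commutator (coproduct_hat (so_hat y)) (left_leg z) = left_leg (commutator (so_hat y) z)"
    "commutator (coproduct_hat (so_hat y)) (right_leg z) = right_leg (commutator (so_hat y) z)"
    for z :: "'m U_series"
    by (simp_all add: coproduct_so_hat commutator_def legs_commute algebra_simps
        algebra_homD[OF algebra_hom_left_leg] algebra_homD[OF algebra_hom_right_leg])
  have 0: "left_leg 0 = (0 :: 'm UU_series)" "right_leg 0 = (0 :: 'm UU_series)"
    by (rule algebra_homD(5)[OF algebra_hom_left_leg] algebra_homD(5)[OF algebra_hom_right_leg])+
  have 1: "commutator (coproduct_hat (so_hat y)) (H_link_plus k \<otimes>\<^sub>h sigma k) = 0"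
    by (simp add: tensor_hat_legs commutator_mult leg c 0)
  have 2: "commutator (coproduct_hat (so_hat y)) (I_tensor k * (1 \<otimes>\<^sub>h sqrt_inverse k)) = 0"
    by (simp add: tensor_hat_legs commutator_mult leg c 0 algebra_homD(4)[OF algebra_hom_left_leg])
  have "commutator (coproduct_hat (so_hat y)) (Phi_J k) = 0"
    using exp_hat_commute[OF vanishes_below_jordanian_exponent(2)[OF k], of "coproduct_hat (so_hat y)"] 1
    by (simp add: commutator_eq_0_iff Phi_J_def)
  moreover have "commutator (coproduct_hat (so_hat y)) (Phi_E k) = 0"
    using exp_hat_commute[OF extension_exponent(2)[OF k], of "coproduct_hat (so_hat y)"] 2
    by (simp add: commutator_eq_0_iff Phi_E_def sqrt_inverse_def)
  ultimately show ?thesis by (simp add: commutator_mult)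
qed

text \<open>On the generators this is the invariance of \<open>I\<^sup>1\<^sup>\<otimes>\<^sup>2\<close>; the coproduct is a homomorphism and carries it to
  all series in them.\<close>

lemma Phi_commutes_coproduct:
  assumes k: "4 * (k + 1) \<le> CARD('m::enum)" and z: "(z :: 'm U_series) \<in> so_series (2 * (k + 1))"
  shows "intertwines (Phi_E k * Phi_J k) (coproduct_hat z) (coproduct_hat z)"
proof -
  have "coproduct_hat z \<in> series_closure (coproduct_hat ` so_hat ` so_sub (2 * (k + 1)))"
    using series_closure_fls_map[OF algebra_hom_coproduct z] by (simp add: coproduct_hat_def)
  hence "coproduct_hat z * (Phi_E k * Phi_J k) = Phi_E k * Phi_J k * coproduct_hat z"
    by (rule series_closure_commute[rotated])
      (use Phi_commutes_coproduct_so_hat[OF k] in \<open>auto simp only: commutator_eq_0_iff\<close>)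
  thus ?thesis by (simp add: intertwines_def)
qed

text \<open>The \<open>k\<close>-th factor of the twist is a series in \<open>y \<otimes> 1\<close> and \<open>1 \<otimes> y\<close> with \<open>y\<close> in \<open>so(M - 4k)\<close>.\<close>

lemma Phi_commutes_legs:
  assumes k: "4 * (k + 1) \<le> CARD('m::enum)"
    and x: "\<And>y. y \<in> so_sub (2*k) \<Longrightarrow> commutator (so_hat y) (x :: 'm U_series) = 0"
  shows "intertwines (Phi_E k * Phi_J k) (left_leg x + right_leg x) (left_leg x + right_leg x)"
  unfolding intertwines_def
proof (rule series_closure_commute[OF _ Phi_leg_series[OF k]])
  fix s assume "s \<in> left_leg ` so_hat ` so_sub (2*k) \<union> (right_leg ` so_hat ` so_sub (2*k) :: 'm UU_series set)"
  then obtain y where y: "y \<in> so_sub (2*k)" "s = left_leg (so_hat y) \<or> s = right_leg (so_hat y)" by blast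
  have "so_hat y * x = x * so_hat y" using x[OF y(1)] by (simp add: commutator_eq_0_iff)
  hence "left_leg (so_hat y) * left_leg x = left_leg x * left_leg (so_hat y)"
    "right_leg (so_hat y) * right_leg x = right_leg x * right_leg (so_hat y)"
    by (simp_all flip: algebra_homD(2)[OF algebra_hom_left_leg] algebra_homD(2)[OF algebra_hom_right_leg])
  thus "s * (left_leg x + right_leg x) = (left_leg x + right_leg x) * s"
    using y(2) by (auto simp: distrib_left distrib_right legs_commute)
qed

lemma chain_commutes_coproduct:
  assumes "4 * (p + 1) \<le> CARD('m::enum)" and "(z :: 'm U_series) \<in> so_series (2 * (p + 1))"
  shows "intertwines (chain_twist p) (coproduct_hat z) (coproduct_hat z)"
  using assms
proof (induction p)
  case 0
  show ?case using Phi_commutes_coproduct[OF 0] by simp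
next
  case (Suc p)
  have "z \<in> so_series (2 * (p + 1))" using Suc.prems(2) so_series_mono[of "2 * (p + 1)" "2 * (Suc p + 1)"] by auto
  with Suc have "intertwines (chain_twist p) (coproduct_hat z) (coproduct_hat z)" by simp
  from intertwines_trans[OF this Phi_commutes_coproduct[OF Suc.prems]] show ?case by simp
qed

text \<open>The factors of the chain before the \<open>k\<close>-th fix \<open>\<Delta>(x)\<close>, the \<open>k\<close>-th one makes it primitive, and the later
  ones commute with both legs of \<open>x\<close>.\<close>

lemma chain_link:
  assumes "4 * (p + 1) \<le> CARD('m::enum)" "k \<le> p" and x: "x \<in> {H_link_minus k, G12 k, G21 k :: 'm U_series}"
  shows "intertwines (chain_twist p) (coproduct_hat x) (left_leg x + right_leg x)"
  using assms(1,2)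
proof (induction p)
  case 0
  thus ?case using link_primitive(1)[of 0, OF 0(1), of x] x by simp
next
  case (Suc p)
  show ?case
  proof (cases "k = Suc p")
    case True
    have "x \<in> so_series (2 * (p + 1))" using x link_so_series(5-7)[OF Suc.prems(1)] True by auto
    with Suc.prems have "intertwines (chain_twist p) (coproduct_hat x) (coproduct_hat x)"
      by (intro chain_commutes_coproduct) auto
    moreover have "intertwines (Phi_E (Suc p) * Phi_J (Suc p)) (coproduct_hat x) (left_leg x + right_leg x)"
      using x True by (intro link_primitive(1) Suc.prems(1)) simp
    ultimately show ?thesis using intertwines_trans by fastforce
  next
    case False
    hence kp: "k \<le> p" using Suc.prems by simp
    have k: "4 * (k + 1) \<le> CARD('m)" using Suc.prems kp by simp
    have "commutator (so_hat y) x = 0" if "y \<in> so_sub (2 * Suc p)" for y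
    proof -
      have "y \<in> so_sub (2 * (k + 1))" using that so_sub_mono[of "2 * (k + 1)" "2 * Suc p"] kp by auto
      from link_commutes_so_sub(3,5,6)[OF k this] show ?thesis using x by auto
    qed
    with Suc.prems(1)
    have "intertwines (Phi_E (Suc p) * Phi_J (Suc p)) (left_leg x + right_leg x) (left_leg x + right_leg x)"
      by (intro Phi_commutes_legs)
    moreover have "intertwines (chain_twist p) (coproduct_hat x) (left_leg x + right_leg x)"
      using Suc kp by simp
    ultimately show ?thesis using intertwines_trans by fastforce
  qed
qed

lemma chain_twist_inverse:
  assumes "4 * (p + 1) \<le> CARD('m::enum)"
  shows "\<exists>G \<in> leg_series 0. chain_twist p * G = 1 \<and> G * (chain_twist p :: 'm UU_series) = 1"
  using assms
proof (induction p)
  case 0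
  thus ?case using Phi_inverse[of 0, OF 0] by simp
next
  case (Suc p)
  then obtain G where G: "G \<in> leg_series 0" "chain_twist p * G = 1" "G * (chain_twist p :: 'm UU_series) = 1" by auto
  let ?P = "Phi_E (Suc p) * Phi_J (Suc p) :: 'm UU_series"
  obtain G' where G': "G' \<in> leg_series (2 * Suc p)" "?P * G' = 1" "G' * ?P = 1"
    using Phi_inverse[OF Suc.prems] by blast
  have "?P * chain_twist p * (G * G') = ?P * (chain_twist p * G) * G'"
    "G * G' * (?P * chain_twist p) = G * (G' * ?P) * chain_twist p" by (simp_all only: mult.assoc)
  hence "?P * chain_twist p * (G * G') = 1" "G * G' * (?P * chain_twist p) = 1"
    using G G' by simp_all
  moreover have "G * G' \<in> leg_series 0"
    using G(1) G'(1) leg_series_mono[of 0 "2 * Suc p"] by (intro series_closure.mult) auto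
  ultimately show ?case by (auto intro!: bexI[of _ "G * G'"])
qed

lemma so_series_U_completion: "so_series m \<subseteq> (U_completion :: 'm::enum U_series set)"
  unfolding U_completion_graded
  by (rule graded_series_closure[OF graded_algebra_uea]) (auto simp: so_hat_U_completion simp flip: U_completion_graded)

lemma leg_series_UU_completion: "leg_series m \<subseteq> (UU_completion :: 'm::enum UU_series set)"
  unfolding UU_completion_graded
proof (rule graded_series_closure[OF graded_algebra_tensor])
  have one: "1 \<in> (uea_degree 0 :: 'm so uea set)" using graded_algebra_uea by (auto simp: graded_algebra_def)
  have "left_leg (so_hat y) \<in> graded_series tensor_degree" "right_leg (so_hat y) \<in> graded_series tensor_degree" for y :: "'m so"
    using so_hat_U_completion[of y] tensor_degreeI[OF _ one] tensor_degreeI[OF one]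
    by (force simp: graded_series_def U_completion_def left_leg_nth right_leg_nth)+
  thus "left_leg ` so_hat ` so_sub m \<union> right_leg ` so_hat ` so_sub m
      \<subseteq> (graded_series tensor_degree :: 'm UU_series set)" by auto
qed

lemma primitive_chainI:
  assumes p: "4 * (p + 1) \<le> CARD('m::enum)"
    and x: "intertwines (chain_twist p) (coproduct_hat x) (left_leg x + right_leg (x :: 'm U_series))"
  shows "primitive (chain_twist p) x"
proof -
  obtain G where G: "G \<in> leg_series 0" "chain_twist p * G = 1" "G * (chain_twist p :: 'm UU_series) = 1"
    using chain_twist_inverse[OF p] by blast
  have "UU_inverse (chain_twist p) = G"
    unfolding UU_inverse_def
  proof (rule the_equality)
    show "G \<in> UU_completion \<and> chain_twist p * G = 1 \<and> G * chain_twist p = 1"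
      using G leg_series_UU_completion by auto
    fix G' :: "'m UU_series" assume G': "G' \<in> UU_completion \<and> chain_twist p * G' = 1 \<and> G' * chain_twist p = 1"
    have "G' = G' * (chain_twist p * G)" by (simp add: G)
    also have "\<dots> = G" using G' by (simp flip: mult.assoc)
    finally show "G' = G" .
  qed
  hence "twisted_coproduct (chain_twist p) x = (left_leg x + right_leg x) * (chain_twist p * G)"
    using x by (simp add: twisted_coproduct_def intertwines_def mult.assoc)
  thus ?thesis
    by (simp add: primitive_def G tensor_hat_legs algebra_homD(4)[OF algebra_hom_left_leg]
        algebra_homD(4)[OF algebra_hom_right_leg])
qed

section \<open>The Lie algebras of primitive elements\<close>

lemma lie_embedding_image:
  assumes \<phi>: "lie_embedding S \<phi>" and S: "complex_vector.subspace S"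
    and br: "\<And>x y. x \<in> S \<Longrightarrow> y \<in> S \<Longrightarrow> lie_bracket x y \<in> S"
  shows "lie_subalgebra (\<phi> ` S)"
proof -
  have add: "\<phi> (x + y) = \<phi> x + \<phi> y" and bracket: "\<phi> (lie_bracket x y) = commutator (\<phi> x) (\<phi> y)"
    if "x \<in> S" "y \<in> S" for x y using \<phi> that by (auto simp: lie_embedding_def)
  have scale: "\<phi> (c *\<^sub>C x) = c *\<^sub>C \<phi> x" if "x \<in> S" for x c using \<phi> that by (auto simp: lie_embedding_def)
  have "\<phi> 0 = 0" using scale[OF complex_vector.subspace_0[OF S], of 0] by simp
  hence zero: "0 \<in> \<phi> ` S" using complex_vector.subspace_0[OF S] by (metis imageI)
  show ?thesis
    unfolding lie_subalgebra_def
  proof (intro conjI ballI complex_vector.subspaceI zero)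
    fix x y assume "x \<in> \<phi> ` S" "y \<in> \<phi> ` S"
    then obtain x' y' where xy: "x = \<phi> x'" "y = \<phi> y'" "x' \<in> S" "y' \<in> S" by blast
    show "x + y \<in> \<phi> ` S"
      unfolding xy add[OF xy(3,4), symmetric] by (rule imageI[OF complex_vector.subspace_add[OF S xy(3,4)]])
    show "commutator x y \<in> \<phi> ` S"
      unfolding xy bracket[OF xy(3,4), symmetric] by (rule imageI[OF br[OF xy(3,4)]])
  next
    fix c x assume "x \<in> \<phi> ` S"
    then obtain x' where x: "x = \<phi> x'" "x' \<in> S" by blast
    show "c *\<^sub>C x \<in> \<phi> ` S"
      unfolding x scale[OF x(2), symmetric] by (rule imageI[OF complex_vector.subspace_scale[OF S x(2)]])
  qed
qed

lemma A_so_entry: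
  assumes "i \<in> {1..CARD('m)}" "j \<in> {1..CARD('m)}" "r \<in> {1..CARD('m)}" "s \<in> {1..CARD('m)}"
  shows "Rep_so (A_so i j :: 'm::enum so) $ idx r $ idx s =
    (if r = i \<and> s = j then 1 else 0) - (if r = CARD('m) + 1 - j \<and> s = CARD('m) + 1 - i then 1 else 0)"
proof -
  have "CARD('m) + 1 - i \<in> {1..CARD('m)}" "CARD('m) + 1 - j \<in> {1..CARD('m)}" using assms by auto
  thus ?thesis
    unfolding A_so_rep[OF assms(1,2)] A_mat_def mat_unit_def using assms
    by (simp add: idx_eq_iff del: One_nat_def)
qed

lemma H_link_minus_nonzero:
  assumes k: "4 * (k + 1) \<le> CARD('m::enum)"
  shows "(H_link_minus k :: 'm U_series) \<noteq> 0"
proof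
  assume "(H_link_minus k :: 'm U_series) = 0"
  hence "so_hat (H_so (2*k+1) - H_so (2*k+2) :: 'm so) = so_hat 0" by (simp add: H_link_minus_def so_hat_linear)
  hence "H_so (2*k+1) - H_so (2*k+2) = (0 :: 'm so)" by (rule injD[OF inj_so_hat])
  hence "Rep_so (H_so (2*k+1) - H_so (2*k+2) :: 'm so) $ idx (2*k+1) $ idx (2*k+1) = 0" by (simp add: zero_so.rep_eq)
  moreover have "2*k+1 \<in> {1..CARD('m)}" "2*k+2 \<in> {1..CARD('m)}" using k by auto
  moreover have "2*k+1 \<noteq> CARD('m) + 1 - (2*k+1)" "2*k+1 \<noteq> CARD('m) + 1 - (2*k+2)" using k by auto
  ultimately show False
    unfolding H_so_def minus_so.rep_eq scaleC_so.rep_eq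
    by (simp add: A_so_entry scaleC_vec_def scaleC_complex_def del: One_nat_def)
qed

text \<open>The elements \<open>H\<close>, \<open>G\<close>, \<open>G'\<close> are eigenvectors of \<open>ad H\<close> for the eigenvalues \<open>0\<close>, \<open>1\<close>, \<open>-1\<close>. This
  separates the three terms of a linear combination: the span has no centre, and \<open>H \<noteq> 0\<close> forces
  linear independence.\<close>

locale so3_triple =
  fixes H G G' :: "'a::complex_algebra_1"
  assumes HG: "commutator H G = G" and HG': "commutator H G' = - G'" and GG': "commutator G G' = 2 *\<^sub>C H"
begin

lemma anti: "commutator G H = - G" "commutator G' H = G'" "commutator G' G = - (2 *\<^sub>C H)"
  using HG HG' GG' commutator_anti[of G H] commutator_anti[of G' H] commutator_anti[of G' G] by simp_all

lemma eigenvectors: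
  assumes 1: "b *\<^sub>C G - c *\<^sub>C G' = 0"
  shows "b *\<^sub>C G = 0" "c *\<^sub>C G' = 0"
proof -
  define x y where "x = b *\<^sub>C G" and "y = c *\<^sub>C G'"
  have "commutator H (b *\<^sub>C G - c *\<^sub>C G') = 0" by (simp only: 1 commutator_linear)
  hence 2: "x + y = 0" by (simp add: commutator_linear commutator_diff HG HG' x_def y_def)
  have "2 *\<^sub>C x = (x - y) + (x + y)"
    using scaleC_add_left[of 1 1 x] by (simp add: scaleC_one)
  also have "\<dots> = 0" using 1 2 unfolding x_def y_def by simp
  finally have "x = 0" by simp
  thus "b *\<^sub>C G = 0" "c *\<^sub>C G' = 0" using 2 unfolding x_def y_def by (simp_all only: add_0_left)
qed

lemma central_eq_0:
  assumes x: "x = a *\<^sub>C H + b *\<^sub>C G + c *\<^sub>C G'"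
    and 0: "commutator H x = 0" "commutator G x = 0"
  shows "x = 0"
proof -
  have "b *\<^sub>C G - c *\<^sub>C G' = 0"
    using 0(1) by (simp add: x commutator_linear HG HG')
  note bG = eigenvectors(1)[OF this] and cG' = eigenvectors(2)[OF this]
  have xa: "x = a *\<^sub>C H" by (simp add: x bG cG')
  have "a *\<^sub>C G = 0" using 0(2) by (simp add: xa commutator_linear anti)
  hence "a = 0 \<or> G = 0" by simp
  thus "x = 0"
  proof
    assume "G = 0"
    hence "2 *\<^sub>C H = 0" using GG' by (simp add: commutator_linear)
    thus ?thesis by (simp add: xa)
  qed (simp add: xa)
qed

lemma independent:
  assumes "H \<noteq> 0" and x: "a *\<^sub>C H + b *\<^sub>C G + c *\<^sub>C G' = 0"
  shows "a = 0 \<and> b = 0 \<and> c = 0"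
proof -
  have G: "G \<noteq> 0" "G' \<noteq> 0" using GG' assms(1) by (auto simp: commutator_linear)
  have "b *\<^sub>C G - c *\<^sub>C G' = 0"
    using arg_cong[OF x, of "commutator H"] by (simp add: commutator_linear HG HG')
  from eigenvectors[OF this] x G assms(1) show ?thesis by auto
qed

lemma span_form: "x \<in> complex_vector.span {H, G, G'} \<longleftrightarrow> (\<exists>a b c. x = a *\<^sub>C H + b *\<^sub>C G + c *\<^sub>C G')"
proof
  assume "x \<in> complex_vector.span {H, G, G'}"
  then obtain a b c where "x - a *\<^sub>C H - b *\<^sub>C G - c *\<^sub>C G' = 0"
    by (auto simp: complex_vector.span_insert)
  hence "x = a *\<^sub>C H + b *\<^sub>C G + c *\<^sub>C G'" by (simp add: algebra_simps)
  thus "\<exists>a b c. x = a *\<^sub>C H + b *\<^sub>C G + c *\<^sub>C G'" by blast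
next
  assume "\<exists>a b c. x = a *\<^sub>C H + b *\<^sub>C G + c *\<^sub>C G'"
  thus "x \<in> complex_vector.span {H, G, G'}"
    by (auto intro!: complex_vector.span_add complex_vector.span_scale intro: complex_vector.span_base)
qed

end

definition so3_coord :: "nat \<Rightarrow> nat \<Rightarrow> 3 so \<Rightarrow> complex" where
  "so3_coord r s x = Rep_so x $ idx r $ idx s"

lemma so3_coord_linear:
  "so3_coord r s 0 = 0" "so3_coord r s (x + y) = so3_coord r s x + so3_coord r s y"
  "so3_coord r s (c *\<^sub>C x) = c * so3_coord r s x"
  by (simp_all add: so3_coord_def zero_so.rep_eq plus_so.rep_eq scaleC_so.rep_eq scaleC_vec_def scaleC_complex_def)

lemma so3_A_so: "A_so 1 3 = (0 :: 3 so)" "A_so 2 2 = (0 :: 3 so)" "A_so 3 1 = (0 :: 3 so)"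
  "A_so 2 3 = - (A_so 1 2 :: 3 so)" "A_so 3 2 = - (A_so 2 1 :: 3 so)" "A_so 3 3 = - (A_so 1 1 :: 3 so)"
proof -
  have self_neg: "x = 0" if "x = - x" for x :: "3 so"
  proof -
    have "2 *\<^sub>C x = x + x" using scaleC_add_left[of 1 1 x] by (simp add: scaleC_one)
    also have "\<dots> = 0" using that by (simp add: eq_neg_iff_add_eq_0)
    finally show ?thesis by simp
  qed
  show "A_so 1 3 = (0 :: 3 so)"
    by (rule self_neg) (use A_so_flip[of 1 3, where 'm = 3] in simp)
  show "A_so 2 2 = (0 :: 3 so)"
    by (rule self_neg) (use A_so_flip[of 2 2, where 'm = 3] in simp)
  show "A_so 3 1 = (0 :: 3 so)"
    by (rule self_neg) (use A_so_flip[of 3 1, where 'm = 3] in simp)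
  show "A_so 2 3 = - (A_so 1 2 :: 3 so)" "A_so 3 2 = - (A_so 2 1 :: 3 so)" "A_so 3 3 = - (A_so 1 1 :: 3 so)"
    using A_so_flip[of 1 2, where 'm = 3] A_so_flip[of 2 1, where 'm = 3] A_so_flip[of 1 1, where 'm = 3] by simp_all
qed

lemma so3_coord_basis:
  "so3_coord 1 1 (A_so 1 1) = 1" "so3_coord 1 1 (A_so 1 2) = 0" "so3_coord 1 1 (A_so 2 1) = 0"
  "so3_coord 1 2 (A_so 1 1) = 0" "so3_coord 1 2 (A_so 1 2) = 1" "so3_coord 1 2 (A_so 2 1) = 0"
  "so3_coord 2 1 (A_so 1 1) = 0" "so3_coord 2 1 (A_so 1 2) = 0" "so3_coord 2 1 (A_so 2 1) = 1"
  unfolding so3_coord_def by (simp_all add: A_so_entry del: One_nat_def)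

lemma so3_decompose:
  "x = so3_coord 1 1 x *\<^sub>C A_so 1 1 + so3_coord 1 2 x *\<^sub>C A_so 1 2 + so3_coord 2 1 x *\<^sub>C (A_so 2 1 :: 3 so)"
proof (induction x rule: so_span_induct)
  case (1 i j)
  have neg: "so3_coord r s (- x) = - so3_coord r s x" for r s x
    using so3_coord_linear(3)[of r s "-1" x] by (simp add: scaleC_one)
  from 1 have "i = 1 \<or> i = 2 \<or> i = 3" "j = 1 \<or> j = 2 \<or> j = 3" by auto
  thus ?case
    by (elim disjE; simp only: so3_A_so neg so3_coord_basis so3_coord_linear)
      (simp_all add: scaleC_one)
next
  case (3 x y)
  show ?case
    by (rule trans[OF arg_cong2[of _ _ _ _ "(+)", OF 3]])
      (simp add: so3_coord_linear scaleC_add_left algebra_simps)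
next
  case (4 c x)
  show ?case
    by (rule trans[OF arg_cong[of _ _ "(*\<^sub>C) c", OF 4]])
      (simp add: so3_coord_linear scaleC_add_right scaleC_scaleC)
qed (simp add: so3_coord_linear)

lemma so3_bracket:
  "lie_bracket (A_so 1 1) (A_so 1 2) = (A_so 1 2 :: 3 so)"
  "lie_bracket (A_so 1 1) (A_so 2 1) = - (A_so 2 1 :: 3 so)"
  "lie_bracket (A_so 1 2) (A_so 2 1) = (A_so 1 1 :: 3 so)"
  by (subst A_so_bracket; simp add: so3_A_so[unfolded One_nat_def])+

text \<open>The basis \<open>A\<^sub>1\<^sub>1\<close>, \<open>A\<^sub>1\<^sub>2\<close>, \<open>A\<^sub>2\<^sub>1\<close> of \<open>so(3)\<close> goes to \<open>H\<close>, \<open>G\<close>, \<open>G'/2\<close>; the factor \<open>1/2\<close>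
  compensates for \<open>[A\<^sub>1\<^sub>2, A\<^sub>2\<^sub>1] = A\<^sub>1\<^sub>1\<close> against \<open>[G, G'] = 2H\<close>.\<close>

lemma (in so3_triple) so3_embedding:
  assumes H: "H \<noteq> 0"
  shows "\<exists>\<phi> :: 3 so \<Rightarrow> 'a. lie_embedding UNIV \<phi> \<and> range \<phi> = complex_vector.span {H, G, G'}"
proof -
  define p q r where "p = (A_so 1 1 :: 3 so)" and "q = (A_so 1 2 :: 3 so)" and "r = (A_so 2 1 :: 3 so)"
  define a b c where "a = so3_coord 1 1" and "b = so3_coord 1 2" and "c = so3_coord 2 1"
  note lin = so3_coord_linear[of 1 1, folded a_def] so3_coord_linear[of 1 2, folded b_def]
    so3_coord_linear[of 2 1, folded c_def]
  note basis = so3_coord_basis[folded p_def q_def r_def a_def b_def c_def]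
  have x: "x = a x *\<^sub>C p + b x *\<^sub>C q + c x *\<^sub>C r" for x
    unfolding a_def b_def c_def p_def q_def r_def by (rule so3_decompose)
  note br = so3_bracket[folded p_def q_def r_def]
  have br': "lie_bracket q p = - q" "lie_bracket r p = r" "lie_bracket r q = - p"
    using br lie_bracket_anti[of q p] lie_bracket_anti[of r p] lie_bracket_anti[of r q] by simp_all
  have bracket: "lie_bracket x y = (b x * c y - c x * b y) *\<^sub>C p + (a x * b y - b x * a y) *\<^sub>C q
      + (c x * a y - a x * c y) *\<^sub>C r" for x y
  proof -
    have "lie_bracket x y = lie_bracket (a x *\<^sub>C p + b x *\<^sub>C q + c x *\<^sub>C r) (a y *\<^sub>C p + b y *\<^sub>C q + c y *\<^sub>C r)"
      using x by metis
    thus ?thesis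
      by (simp add: lie_add_left lie_add_right lie_scaleC_left lie_scaleC_right lie_alternating br br'
          scaleC_scaleC complex_vector.scale_left_diff_distrib mult.commute algebra_simps)
  qed
  define \<phi> where "\<phi> x = a x *\<^sub>C H + b x *\<^sub>C G + (c x / 2) *\<^sub>C G'" for x
  have add: "\<phi> (x + y) = \<phi> x + \<phi> y" for x y
    by (simp add: \<phi>_def lin scaleC_add_left add_divide_distrib algebra_simps)
  have scale: "\<phi> (d *\<^sub>C x) = d *\<^sub>C \<phi> x" for d x
    by (simp add: \<phi>_def lin scaleC_add_right scaleC_scaleC)
  have "\<phi> (lie_bracket x y) = commutator (\<phi> x) (\<phi> y)" for x y
  proof -
    have "a (lie_bracket x y) = b x * c y - c x * b y" "b (lie_bracket x y) = a x * b y - b x * a y"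
      "c (lie_bracket x y) = c x * a y - a x * c y"
      unfolding bracket lin basis by simp_all
    hence "\<phi> (lie_bracket x y) = (b x * c y - c x * b y) *\<^sub>C H + (a x * b y - b x * a y) *\<^sub>C G
        + ((c x * a y - a x * c y) / 2) *\<^sub>C G'"
      by (simp only: \<phi>_def)
    also have "\<dots> = commutator (\<phi> x) (\<phi> y)"
      unfolding \<phi>_def commutator_linear HG HG' GG' anti commutator_self
      by (simp add: scaleC_scaleC complex_vector.scale_left_diff_distrib diff_divide_distrib mult.commute
          algebra_simps)
    finally show ?thesis .
  qed
  moreover have "inj \<phi>"
  proof (rule injI)
    fix x y assume "\<phi> x = \<phi> y"
    hence "(a x - a y) *\<^sub>C H + (b x - b y) *\<^sub>C G + (c x / 2 - c y / 2) *\<^sub>C G' = 0"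
      unfolding \<phi>_def complex_vector.scale_left_diff_distrib by (simp add: algebra_simps)
    from independent[OF H this] have "a x = a y" "b x = b y" "c x = c y" by auto
    thus "x = y" using x[of x] x[of y] by simp
  qed
  ultimately have "lie_embedding UNIV \<phi>" using add scale by (simp add: lie_embedding_def)
  moreover have "range \<phi> = complex_vector.span {H, G, G'}"
  proof (intro equalityI subsetI)
    fix z assume "z \<in> range \<phi>"
    thus "z \<in> complex_vector.span {H, G, G'}" unfolding span_form \<phi>_def by blast
  next
    fix z assume "z \<in> complex_vector.span {H, G, G'}"
    then obtain \<alpha> \<beta> \<gamma> where z: "z = \<alpha> *\<^sub>C H + \<beta> *\<^sub>C G + \<gamma> *\<^sub>C G'" unfolding span_form by blast
    have "\<phi> (\<alpha> *\<^sub>C p + \<beta> *\<^sub>C q + (2 * \<gamma>) *\<^sub>C r) = z"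
      unfolding \<phi>_def lin basis z by simp
    thus "z \<in> range \<phi>" by blast
  qed
  ultimately show ?thesis by blast
qed

lemma so3_triple_link:
  assumes k: "4 * (k + 1) \<le> CARD('m::enum)"
  shows "so3_triple (H_link_minus k :: 'm U_series) (G12 k) (G21 k)"
  by unfold_locales (rule link_primitive(2-4)[OF k]; simp)+

lemma lie_embedding_so_hat: "lie_embedding S (so_hat :: 'm::enum so \<Rightarrow> 'm U_series)"
  unfolding lie_embedding_def
  by (simp add: so_hat_add so_hat_scaleC so_hat_bracket inj_on_subset[OF inj_so_hat])

lemma so3_G_induct [consumes 1, case_names gen zero add scale]:
  assumes "x \<in> so3_G k"
    and gen: "\<And>x. x \<in> {H_link_minus k, G12 k, G21 k} \<Longrightarrow> P x"
    and zero: "P 0" and add: "\<And>x y. P x \<Longrightarrow> P y \<Longrightarrow> P (x + y)" and scale: "\<And>c x. P x \<Longrightarrow> P (c *\<^sub>C x)"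
  shows "P x"
  using assms(1) unfolding so3_G_def
proof (rule complex_vector.span_induct)
  show "complex_vector.subspace {y. P y}"
    by (rule complex_vector.subspaceI) (simp_all add: zero add scale)
qed (use gen in blast)

lemma so3_G_gen: "H_link_minus k \<in> so3_G k" "G12 k \<in> so3_G k" "G21 k \<in> so3_G k"
  unfolding so3_G_def by (rule complex_vector.span_base; simp)+

lemma so3_G_commutes_so_sub:
  assumes k: "4 * (k + 1) \<le> CARD('m::enum)" and x: "(x :: 'm U_series) \<in> so3_G k"
    and y: "y \<in> so_sub (2 * (k + 1))"
  shows "commutator (so_hat y) x = 0"
  using x link_commutes_so_sub(3,5,6)[OF k y]
  by (induction rule: so3_G_induct) (auto simp: commutator_linear)

lemma so3_G_so_series:
  assumes k: "4 * (k + 1) \<le> CARD('m::enum)" and x: "(x :: 'm U_series) \<in> so3_G k"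
  shows "x \<in> so_series (2*k)"
  using x link_so_series(5-7)[OF k]
  by (induction rule: so3_G_induct) (auto intro: series_closure_zero series_closure.add series_closure.scale)

lemma so3_G_primitive:
  assumes p: "4 * (p + 1) \<le> CARD('m::enum)" and k: "k \<le> p" and x: "(x :: 'm U_series) \<in> so3_G k"
  shows "primitive (chain_twist p) x"
proof (rule primitive_chainI[OF p])
  note hom = algebra_homD[OF algebra_hom_left_leg] algebra_homD[OF algebra_hom_right_leg]
    algebra_homD[OF algebra_hom_coproduct_hat]
  show "intertwines (chain_twist p) (coproduct_hat x) (left_leg x + right_leg x)"
    using x
  proof (induction rule: so3_G_induct)
    case (add x y)
    from intertwines_add[OF add] show ?case by (simp add: hom add.assoc add.left_commute)
  next
    case (scale c x)
    from intertwines_scale[OF this, of c] show ?case by (simp add: hom scaleC_add_right)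
  qed (use chain_link[OF p k] in \<open>auto simp: hom intertwines_def\<close>)
qed

lemma so_sub_primitive:
  assumes p: "4 * (p + 1) \<le> CARD('m::enum)" and y: "(y :: 'm so) \<in> so_sub (2 * (p + 1))"
  shows "primitive (chain_twist p) (so_hat y)"
proof (rule primitive_chainI[OF p])
  have "so_hat y \<in> so_series (2 * (p + 1))" by (intro series_closure.base imageI y)
  from chain_commutes_coproduct[OF p this]
  show "intertwines (chain_twist p) (coproduct_hat (so_hat y)) (left_leg (so_hat y) + right_leg (so_hat y))"
    by (simp add: coproduct_so_hat)
qed

text \<open>If the \<open>x i\<close> add up to zero, each \<open>x i\<close> commutes with \<open>L i\<close> because all other summands do, hence lies
  in the centre of \<open>L i\<close>. The last \<open>L i\<close> may
  have a centre, but once the other summands vanish so does its own.\<close>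

lemma lie_direct_sum_of_centerless:
  fixes L :: "nat \<Rightarrow> 'a::complex_algebra_1 set"
  assumes sub: "\<And>i. i \<le> Suc p \<Longrightarrow> lie_subalgebra (L i)"
    and comm: "\<And>i j x y. i < j \<Longrightarrow> j \<le> Suc p \<Longrightarrow> x \<in> L i \<Longrightarrow> y \<in> L j \<Longrightarrow> commutator y x = 0"
    and center: "\<And>i x. i \<le> p \<Longrightarrow> x \<in> L i \<Longrightarrow> (\<And>y. y \<in> L i \<Longrightarrow> commutator y x = 0) \<Longrightarrow> x = 0"
  shows "lie_direct_sum {..Suc p} L"
  unfolding lie_direct_sum_def
proof (intro conjI ballI allI impI)
  have comm': "commutator x y = 0" if "i \<le> Suc p" "j \<le> Suc p" "i \<noteq> j" "x \<in> L i" "y \<in> L j" for i j x y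
  proof (cases "i < j")
    case True
    thus ?thesis using comm[OF True that(2,4,5)] commutator_anti[of x y] by simp
  next
    case False
    hence "j < i" using that by simp
    thus ?thesis using comm[OF _ that(1,5,4)] by simp
  qed
  show "lie_subalgebra (L i)" if "i \<in> {..Suc p}" for i using sub that by simp
  show "commutator x y = 0" if "i \<in> {..Suc p}" "j \<in> {..Suc p}" "i \<noteq> j" "x \<in> L i" "y \<in> L j" for i j x y
    using comm'[of i j x y] that by simp
  fix x i
  assume x: "(\<forall>i\<in>{..Suc p}. x i \<in> L i) \<and> sum x {..Suc p} = 0"
  have z: "x i = 0" if i: "i \<le> p" for i
  proof (rule center[OF i])
    show "x i \<in> L i" using x i by simp
    fix y assume y: "y \<in> L i"
    have "0 = commutator y (sum x {..Suc p})" using x by (simp add: commutator_linear)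
    also have "\<dots> = (\<Sum>j\<le>Suc p. commutator y (x j))" by (rule commutator_sum)
    also have "\<dots> = (\<Sum>j\<in>{i}. commutator y (x j))"
    proof (rule sum.mono_neutral_right)
      show "\<forall>j\<in>{..Suc p} - {i}. commutator y (x j) = 0"
        using comm'[OF _ _ _ y] x i by auto
    qed (use i in auto)
    finally show "commutator y (x i) = 0" by simp
  qed
  moreover have "sum x {..Suc p} = x (Suc p)" using z by simp
  hence "x (Suc p) = 0" using x by simp
  moreover assume "i \<in> {..Suc p}"
  ultimately show "x i = 0" by (cases "i = Suc p") auto
qed

theorem mainTheorem2:
  fixes M p :: nat and F :: "'m::enum UU_series"
  assumes "M = CARD('m)" and "M \<ge> 4" and "4 * (p + 1) \<le> M"
    and "F = chain_twist p"
  shows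
    "(\<forall>k\<le>p. primitive F (H_link_minus k) \<and> primitive F (G12 k) \<and> primitive F (G21 k))
     \<and>
     (\<forall>k\<le>p.
       commutator (H_link_minus k) (G12 k) = (G12 k :: 'm U_series) \<and>
       commutator (H_link_minus k) (G21 k) = - (G21 k :: 'm U_series) \<and>
       commutator (G12 k) (G21 k) = 2 *\<^sub>C (H_link_minus k :: 'm U_series) \<and>
       (\<exists>\<phi> :: 3 so \<Rightarrow> 'm U_series. lie_embedding UNIV \<phi> \<and> range \<phi> = so3_G k) \<and>
       (\<forall>x \<in> so3_G k. \<forall>y \<in> so_sub (2 * (k + 1)). commutator x (so_hat y :: 'm U_series) = 0))
     \<and>
     (\<forall>x \<in> so_sub (2 * (p + 1)). primitive F (so_hat x))
     \<and>
     lie_embedding (so_sub (2 * (p + 1)) :: 'm so set) so_hat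
     \<and>
     (let L = (\<lambda>k. if k \<le> p then so3_G k else so_hat ` so_sub (2 * (p + 1)))
      in lie_direct_sum {..p + 1} L \<and>
         (\<forall>k \<le> p + 1. L k \<subseteq> U_completion \<and> (\<forall>x \<in> L k. primitive F x)))"
proof -
  define L :: "nat \<Rightarrow> 'm U_series set"
    where "L = (\<lambda>k. if k \<le> p then so3_G k else so_hat ` so_sub (2 * (p + 1)))"
  have p: "4 * (p + 1) \<le> CARD('m)" using assms by simp
  have k: "4 * (k + 1) \<le> CARD('m)" if "k \<le> p" for k using p that by simp
  have emb: "\<exists>\<phi> :: 3 so \<Rightarrow> 'm U_series. lie_embedding UNIV \<phi> \<and> range \<phi> = so3_G k" if "k \<le> p" for k
    unfolding so3_G_def
    by (rule so3_triple.so3_embedding[OF so3_triple_link H_link_minus_nonzero]; rule k[OF that])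
  have L_series: "L k \<subseteq> so_series (2*k)" if "k \<le> p + 1" for k
  proof (cases "k \<le> p")
    case True
    thus ?thesis using so3_G_so_series[OF k] by (auto simp: L_def)
  next
    case False
    hence "k = p + 1" using that by simp
    thus ?thesis by (auto simp: L_def intro: series_closure.base)
  qed
  have L_primitive: "primitive F x" if "k \<le> p + 1" "x \<in> L k" for k x
    using that so3_G_primitive[OF p] so_sub_primitive[OF p] by (auto simp: L_def assms(4) split: if_splits)
  have "lie_direct_sum {..Suc p} L"
  proof (rule lie_direct_sum_of_centerless)
    fix i assume "i \<le> Suc p"
    show "lie_subalgebra (L i)"
    proof (cases "i \<le> p")
      case True
      then obtain \<phi> :: "3 so \<Rightarrow> 'm U_series" where "lie_embedding UNIV \<phi>" "range \<phi> = so3_G i" using emb by blast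
      with lie_embedding_image[of UNIV \<phi>] show ?thesis using True by (simp add: L_def)
    next
      case False
      thus ?thesis
        using lie_embedding_image[OF lie_embedding_so_hat so_sub_subspace so_sub_bracket] by (simp add: L_def)
    qed
  next
    fix i j x y assume ij: "i < j" "j \<le> Suc p" and x: "x \<in> L i" and y: "y \<in> L j"
    have ip: "i \<le> p" and x: "x \<in> so3_G i" using ij x by (auto simp: L_def)
    have "y \<in> so_series (2*j)" using L_series ij y by auto
    thus "commutator y x = 0"
    proof (rule so_series_commute)
      fix z :: "'m so" assume "z \<in> so_sub (2*j)"
      hence "z \<in> so_sub (2 * (i + 1))" using so_sub_mono[of "2 * (i + 1)" "2*j"] ij by auto
      thus "commutator (so_hat z) x = 0" by (rule so3_G_commutes_so_sub[OF k[OF ip] x])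
    qed
  next
    fix i x assume i: "i \<le> p" and x: "x \<in> L i" and c: "\<And>y. y \<in> L i \<Longrightarrow> commutator y x = 0"
    interpret so3_triple "H_link_minus i :: 'm U_series" "G12 i" "G21 i" by (rule so3_triple_link[OF k[OF i]])
    from x i obtain a b d where "x = a *\<^sub>C H_link_minus i + b *\<^sub>C G12 i + d *\<^sub>C G21 i"
      by (auto simp: L_def so3_G_def span_form)
    thus "x = 0" by (rule central_eq_0) (use c i so3_G_gen in \<open>auto simp: L_def\<close>)
  qed
  moreover have "L k \<subseteq> U_completion" if "k \<le> p + 1" for k
    using L_series[OF that] so_series_U_completion by blast
  moreover have "commutator x (so_hat y) = 0"
    if "k \<le> p" "x \<in> so3_G k" "y \<in> so_sub (2 * (k + 1))" for k and x :: "'m U_series" and y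
    using so3_G_commutes_so_sub[OF k[OF that(1)] that(2,3)] commutator_anti[of x "so_hat y"] by simp
  moreover have "primitive F (H_link_minus k) \<and> primitive F (G12 k) \<and> primitive F (G21 k)" if "k \<le> p" for k
    using L_primitive[of k] that so3_G_gen[of k] by (auto simp: L_def)
  moreover have "primitive F (so_hat x)" if "x \<in> so_sub (2 * (p + 1))" for x
    using so_sub_primitive[OF p that] by (simp add: assms(4))
  ultimately show ?thesis
    using emb link_primitive(2-4)[OF k] L_primitive lie_embedding_so_hat
    unfolding L_def[symmetric] Let_def by (simp add: assms(1))
qed

end
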